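(* Let $\theta$ be a rational inner function on $\mathbb{D}^2$. Then $\theta$ has a pair of Agler kernels $(K_1,K_2)$ such that the associated Agler spaces $$\mathcal{S}_1 = \mathcal{H}\left(\frac{K_1(z,w)}{1-z_1\bar w_1}\right) \quad\text{and}\quad \mathcal{S}_2 = \mathcal{H}\left(\frac{K_2(z,w)}{1-z_2\bar w_2}\right)$$ are reducing subspaces for $S_{z_1}$ if and only if $\theta$ is a product of two one variable inner functions, i.e. $\theta(z)=\phi(z_1)\psi(z_2)$ with $\phi,\psi$ inner functions on $\mathbb{D}$. By symmetry, this occurs if and only if $\theta$ has a pair of Agler kernels $(\widetilde K_1,\widetilde K_2)$ such that the associated Agler spaces $\mathcal{H}\left(\frac{\widetilde K_1(z,w)}{1-z_1\bar w_1}\right)$ and $\mathcal{H}\left(\frac{\widetilde K_2(z,w)}{1-z_2\bar w_2}\right)$ are reducing subspaces for $S_{z_2}$.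
   Context: $H^2(\mathbb{D}^2)$ is the Hardy space on the bidisk, with variables $z=(z_1,z_2)$. An inner function on $\mathbb{D}^d$ ($d=1,2$) is a bounded holomorphic function whose radial boundary values are unimodular almost everywhere on $\mathbb{T}^d$ (unimodular constants are included); a rational inner function is an inner function that is a quotient of two polynomials. For $\theta$ inner on $\mathbb{D}^2$, $\mathcal{K}_\theta = H^2(\mathbb{D}^2)\ominus\theta H^2(\mathbb{D}^2)$, $P_\theta$ is the orthogonal projection onto $\mathcal{K}_\theta$, $T_{z_j}$ is multiplication by $z_j$ on $H^2(\mathbb{D}^2)$, and $S_{z_j} = P_\theta T_{z_j}|_{\mathcal{K}_\theta}$ for $j=1,2$. A pair of Agler kernels of $\theta$ is a pair $(K_1,K_2)$ of positive (semidefinite) kernels $K_1,K_2:\mathbb{D}^2\times\mathbb{D}^2\to\mathbb{C}$ such that $$1-\theta(z)\overline{\theta(w)} = (1-z_1\bar w_1)K_2(z,w) + (1-z_2\bar w_2)K_1(z,w)\qquad (z,w\in\mathbb{D}^2).$$ $\mathcal{H}(K)$ denotes the reproducing kernel Hilbert space with reproducing kernel $K$. To say that such a Hilbert space is a reducing subspace for $S_{z_j}$ means that it is a closed subspace of $\mathcal{K}_\theta$ (with the norm inherited from $\mathcal{K}_\theta$) that is invariant under both $S_{z_j}$ and $S_{z_j}^*$. *)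

theory Defs
  imports "HOL-Complex_Analysis.Complex_Analysis"
begin

(* Functions on a set X are represented by total functions. Elements of a space of functions
   (H2, the model space, a reproducing kernel Hilbert space) are required to vanish off X, so that
   equality of functions on X is equality; of theta and of kernels only the values on the
   bidisk are ever used. *)

section \<open>Inner functions\<close>

abbreviation bidisk :: "(complex \<times> complex) set"
  where "bidisk \<equiv> ball 0 1 \<times> ball 0 1"

definition holomorphic2 :: "(complex \<times> complex \<Rightarrow> complex) \<Rightarrow> bool"
  where "holomorphic2 f \<longleftrightarrow>
    (\<forall>z\<in>bidisk. \<exists>a b. (f has_derivative (\<lambda>h. a * fst h + b * snd h)) (at z))"

(* The torus is parametrized by angles. *)
definition inner1 :: "(complex \<Rightarrow> complex) \<Rightarrow> bool"
  where "inner1 \<phi> \<longleftrightarrow>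
    \<phi> holomorphic_on ball 0 1 \<and> bounded (\<phi> ` ball 0 1) \<and>
    (AE t in lebesgue_on {0..2 * pi}.
       \<exists>l. cmod l = 1 \<and> ((\<lambda>r. \<phi> (of_real r * cis t)) \<longlongrightarrow> l) (at_left 1))"

definition inner2 :: "(complex \<times> complex \<Rightarrow> complex) \<Rightarrow> bool"
  where "inner2 \<theta> \<longleftrightarrow>
    holomorphic2 \<theta> \<and> bounded (\<theta> ` bidisk) \<and>
    (AE t in lebesgue_on ({0..2 * pi} \<times> {0..2 * pi}).
       \<exists>l. cmod l = 1 \<and>
         ((\<lambda>r. \<theta> (of_real r * cis (fst t), of_real r * cis (snd t))) \<longlongrightarrow> l) (at_left 1))"

(* An element of "complex poly poly" is a polynomial in the second variable whose coefficients
   are polynomials in the first. *)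
definition poly2 :: "complex poly poly \<Rightarrow> complex \<times> complex \<Rightarrow> complex"
  where "poly2 p z = poly (poly p [:snd z:]) (fst z)"

(* Zeros of the denominator in the bidisk are allowed for; there the value of theta is determined
   by continuity. *)
definition rational_inner2 :: "(complex \<times> complex \<Rightarrow> complex) \<Rightarrow> bool"
  where "rational_inner2 \<theta> \<longleftrightarrow>
    inner2 \<theta> \<and>
    (\<exists>p q. q \<noteq> 0 \<and> (\<forall>z\<in>bidisk. poly2 q z \<noteq> 0 \<longrightarrow> \<theta> z = poly2 p z / poly2 q z))"


section \<open>The Hardy space of the bidisk\<close>

definition power_series2 :: "(nat \<times> nat \<Rightarrow> complex) \<Rightarrow> (complex \<times> complex \<Rightarrow> complex) \<Rightarrow> bool"
  where "power_series2 a f \<longleftrightarrow>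
    (\<forall>z\<in>bidisk. ((\<lambda>(m, n). a (m, n) * fst z ^ m * snd z ^ n) has_sum f z) UNIV)"

definition H2 :: "(complex \<times> complex \<Rightarrow> complex) set"
  where "H2 = {f. (\<forall>z. z \<notin> bidisk \<longrightarrow> f z = 0) \<and>
    (\<exists>a. power_series2 a f \<and> (\<lambda>i. (cmod (a i))\<^sup>2) summable_on UNIV)}"

definition coeff2 :: "(complex \<times> complex \<Rightarrow> complex) \<Rightarrow> nat \<times> nat \<Rightarrow> complex"
  where "coeff2 f = (THE a. power_series2 a f)"

definition H2_inner ::
    "(complex \<times> complex \<Rightarrow> complex) \<Rightarrow> (complex \<times> complex \<Rightarrow> complex) \<Rightarrow> complex"
  where "H2_inner f g = (\<Sum>\<^sub>\<infinity>i\<in>UNIV. coeff2 f i * cnj (coeff2 g i))"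


section \<open>Hilbert spaces of functions and reproducing kernels\<close>

definition ip_norm :: "(('a \<Rightarrow> complex) \<Rightarrow> ('a \<Rightarrow> complex) \<Rightarrow> complex) \<Rightarrow> ('a \<Rightarrow> complex) \<Rightarrow> real"
  where "ip_norm ip f = sqrt (Re (ip f f))"

definition fun_subspace :: "('a \<Rightarrow> complex) set \<Rightarrow> bool"
  where "fun_subspace M \<longleftrightarrow>
    (\<lambda>_. 0) \<in> M \<and>
    (\<forall>f\<in>M. \<forall>g\<in>M. (\<lambda>x. f x + g x) \<in> M) \<and>
    (\<forall>c. \<forall>f\<in>M. (\<lambda>x. c * f x) \<in> M)"

definition positive_kernel :: "'a set \<Rightarrow> ('a \<Rightarrow> 'a \<Rightarrow> complex) \<Rightarrow> bool"
  where "positive_kernel X K \<longleftrightarrow>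
    (\<forall>F c. finite F \<longrightarrow> F \<subseteq> X \<longrightarrow>
      (\<Sum>x\<in>F. \<Sum>y\<in>F. cnj (c x) * c y * K x y) \<in> \<real>\<^sub>\<ge>\<^sub>0)"

(* "rkhs X H ip K": the set H of functions on X with the inner product ip is the Hilbert space
   with reproducing kernel K. By the Moore-Aronszajn theorem H, and ip on H, are determined by K,
   and they exist if K is positive. *)
locale rkhs =
  fixes X :: "'a set"
    and H :: "('a \<Rightarrow> complex) set"
    and ip :: "('a \<Rightarrow> complex) \<Rightarrow> ('a \<Rightarrow> complex) \<Rightarrow> complex"
    and K :: "'a \<Rightarrow> 'a \<Rightarrow> complex"
  assumes vanish_off: "f \<in> H \<Longrightarrow> x \<notin> X \<Longrightarrow> f x = 0"
    and subspace: "fun_subspace H"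
    and ip_add: "f \<in> H \<Longrightarrow> g \<in> H \<Longrightarrow> h \<in> H \<Longrightarrow> ip (\<lambda>x. f x + g x) h = ip f h + ip g h"
    and ip_scale: "f \<in> H \<Longrightarrow> g \<in> H \<Longrightarrow> ip (\<lambda>x. c * f x) g = c * ip f g"
    and ip_cnj: "f \<in> H \<Longrightarrow> g \<in> H \<Longrightarrow> ip g f = cnj (ip f g)"
    and ip_pos: "f \<in> H \<Longrightarrow> f \<noteq> (\<lambda>_. 0) \<Longrightarrow> 0 < Re (ip f f)"
    and complete: "(\<And>n. F n \<in> H) \<Longrightarrow>
      (\<And>e. 0 < e \<Longrightarrow> \<exists>N. \<forall>m\<ge>N. \<forall>n\<ge>N. ip_norm ip (\<lambda>x. F m x - F n x) < e) \<Longrightarrow>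
      \<exists>f\<in>H. (\<lambda>n::nat. ip_norm ip (\<lambda>x. F n x - f x)) \<longlonglongrightarrow> 0"
    and kernel_mem: "w \<in> X \<Longrightarrow> (\<lambda>z. if z \<in> X then K z w else 0) \<in> H"
    and reproducing: "f \<in> H \<Longrightarrow> w \<in> X \<Longrightarrow> ip f (\<lambda>z. if z \<in> X then K z w else 0) = f w"


section \<open>The model space and the compressed shifts\<close>

definition model_space :: "(complex \<times> complex \<Rightarrow> complex) \<Rightarrow> (complex \<times> complex \<Rightarrow> complex) set"
  where "model_space \<theta> = {f\<in>H2. \<forall>g\<in>H2. H2_inner f (\<lambda>z. \<theta> z * g z) = 0}"

definition model_proj ::
    "(complex \<times> complex \<Rightarrow> complex) \<Rightarrow> (complex \<times> complex \<Rightarrow> complex) \<Rightarrow> complex \<times> complex \<Rightarrow> complex"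
  where "model_proj \<theta> f =
    (THE g. g \<in> model_space \<theta> \<and> (\<forall>h\<in>model_space \<theta>. H2_inner (\<lambda>z. f z - g z) h = 0))"

(* The first argument is the coordinate function, fst or snd. *)
definition mult_coord ::
    "(complex \<times> complex \<Rightarrow> complex) \<Rightarrow> (complex \<times> complex \<Rightarrow> complex) \<Rightarrow> complex \<times> complex \<Rightarrow> complex"
  where "mult_coord p f = (\<lambda>z. p z * f z)"

definition comp_shift ::
    "(complex \<times> complex \<Rightarrow> complex) \<Rightarrow> (complex \<times> complex \<Rightarrow> complex) \<Rightarrow>
     (complex \<times> complex \<Rightarrow> complex) \<Rightarrow> complex \<times> complex \<Rightarrow> complex"
  where "comp_shift \<theta> p f = model_proj \<theta> (mult_coord p f)"

definition comp_shift_adj ::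
    "(complex \<times> complex \<Rightarrow> complex) \<Rightarrow> (complex \<times> complex \<Rightarrow> complex) \<Rightarrow>
     (complex \<times> complex \<Rightarrow> complex) \<Rightarrow> complex \<times> complex \<Rightarrow> complex"
  where "comp_shift_adj \<theta> p f =
    (THE g. g \<in> model_space \<theta> \<and>
      (\<forall>h\<in>model_space \<theta>. H2_inner (comp_shift \<theta> p h) f = H2_inner h g))"

definition closed_model_subspace ::
    "(complex \<times> complex \<Rightarrow> complex) \<Rightarrow> (complex \<times> complex \<Rightarrow> complex) set \<Rightarrow> bool"
  where "closed_model_subspace \<theta> M \<longleftrightarrow>
    M \<subseteq> model_space \<theta> \<and> fun_subspace M \<and>
    (\<forall>F. \<forall>f\<in>model_space \<theta>. (\<forall>n::nat. F n \<in> M) \<longrightarrow>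
      (\<lambda>n. ip_norm H2_inner (\<lambda>z. F n z - f z)) \<longlonglongrightarrow> 0 \<longrightarrow> f \<in> M)"

(* The Hilbert space with reproducing kernel L is a reducing subspace for the compressed shift
   of the coordinate function p. *)
definition rkhs_reducing ::
    "(complex \<times> complex \<Rightarrow> complex) \<Rightarrow> (complex \<times> complex \<Rightarrow> complex) \<Rightarrow>
     (complex \<times> complex \<Rightarrow> complex \<times> complex \<Rightarrow> complex) \<Rightarrow> bool"
  where "rkhs_reducing \<theta> p L \<longleftrightarrow>
    (\<exists>H ip. rkhs bidisk H ip L \<and>
      closed_model_subspace \<theta> H \<and>
      (\<forall>f\<in>H. ip_norm ip f = ip_norm H2_inner f) \<and>
      comp_shift \<theta> p ` H \<subseteq> H \<and>
      comp_shift_adj \<theta> p ` H \<subseteq> H)"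


section \<open>Agler kernels\<close>

definition agler_kernels ::
    "(complex \<times> complex \<Rightarrow> complex) \<Rightarrow>
     (complex \<times> complex \<Rightarrow> complex \<times> complex \<Rightarrow> complex) \<Rightarrow>
     (complex \<times> complex \<Rightarrow> complex \<times> complex \<Rightarrow> complex) \<Rightarrow> bool"
  where "agler_kernels \<theta> K1 K2 \<longleftrightarrow>
    positive_kernel bidisk K1 \<and> positive_kernel bidisk K2 \<and>
    (\<forall>z\<in>bidisk. \<forall>w\<in>bidisk.
      1 - \<theta> z * cnj (\<theta> w) =
        (1 - fst z * cnj (fst w)) * K2 z w + (1 - snd z * cnj (snd w)) * K1 z w)"

(* Kernels of the Agler spaces: p = fst for the first space and p = snd for the second. *)
definition agler_space_kernel ::
    "(complex \<times> complex \<Rightarrow> complex) \<Rightarrow>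
     (complex \<times> complex \<Rightarrow> complex \<times> complex \<Rightarrow> complex) \<Rightarrow>
     complex \<times> complex \<Rightarrow> complex \<times> complex \<Rightarrow> complex"
  where "agler_space_kernel p K z w = K z w / (1 - p z * cnj (p w))"

end

theory Submission
  imports Defs
begin

text \<open>
  The kernel of \<open>K\<^sub>\<theta>\<close> is the sum of the kernels of the two Agler spaces, so these are orthogonal complements
  of each other in \<open>K\<^sub>\<theta>\<close>. Positivity of \<open>K\<^sub>1\<close> makes \<open>S\<^sub>1\<close> invariant under multiplication by \<open>z\<^sub>1\<close>, and
  \<open>S\<^sub>z\<^sub>1\<close> has the backward shift as its adjoint. Hence \<open>S\<^sub>1\<close> reduces multiplication by \<open>z\<^sub>1\<close> on \<open>H\<^sup>2\<close>, and
  \<open>K\<^sub>1\<close> depends on \<open>z\<^sub>2\<close>, \<open>w\<^sub>2\<close> only. Then \<open>B = 1 - (1 - z\<^sub>2 cnj w\<^sub>2) K\<^sub>1\<close> is the kernel of the wandering subspace of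
  a shift invariant subspace of \<open>H\<^sup>2\<close> in \<open>z\<^sub>2\<close>, so it has rank at most one, and \<open>B - \<theta> cnj \<theta>\<close> is positive
  for fixed \<open>z\<^sub>1 = w\<^sub>1\<close>. This forces \<open>\<theta> (z\<^sub>1, z\<^sub>2) \<theta> (w\<^sub>1, w\<^sub>2) = \<theta> (z\<^sub>1, w\<^sub>2) \<theta> (w\<^sub>1, z\<^sub>2)\<close>, that is, \<open>\<theta>\<close> is
  a product. Conversely, if \<open>\<theta> = \<phi> (z\<^sub>1) \<psi> (z\<^sub>2)\<close>, then the model space of \<open>\<psi> (z\<^sub>2)\<close> and its complement in
  \<open>K\<^sub>\<theta>\<close> reduce \<open>S\<^sub>z\<^sub>1\<close>.
\<close>

section \<open>Closed subspaces of reproducing kernel Hilbert spaces\<close>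

text \<open>All Hilbert space arguments run inside \<open>H2\<close>, described by coefficients. The
  one analytic input, that an inner function multiplies isometrically, comes from integral means
  over tori of radius below 1. \<open>K1\<close> is independent of the first variable because
  \<open>(1 - z1 cnj w1)\<close> times the kernel of \<open>S1\<close> at \<open>w\<close> lies in
  \<open>S1\<close> and is orthogonal to \<open>z1 S1\<close>; as \<open>S1\<close> is also
  invariant under the backward shift, that function depends on \<open>z2\<close> alone. The rank
  argument multiplies elements of \<open>H2\<close> with each other, so it needs bounded functions.
  \<open>B\<close> is bounded since it is determined by the slice \<open>z1 = w1 = 0\<close>, where
  it equals \<open>\<theta> cnj \<theta> + K2\<close> and the diagonal of \<open>K2\<close> is at
  most 1. On a slice, a vector killed by \<open>B\<close> turns the form of
  \<open>B - \<theta> cnj \<theta>\<close> into minus a square, which positivity forces to be 0. So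
  \<open>\<theta>\<close> is proportional to a column of \<open>B\<close> along the slice, and these
  columns are common to all slices. Splitting \<open>\<theta>\<close> into functions is then easy;
  the remaining obstacle is that only their product is known to have radial limits.\<close>

lemma fun_subspace_zero: "fun_subspace M \<Longrightarrow> (\<lambda>_. 0) \<in> M"
  and fun_subspace_add: "fun_subspace M \<Longrightarrow> f \<in> M \<Longrightarrow> g \<in> M \<Longrightarrow> (\<lambda>x. f x + g x) \<in> M"
  and fun_subspace_scale: "fun_subspace M \<Longrightarrow> f \<in> M \<Longrightarrow> (\<lambda>x. c * f x) \<in> M"
  unfolding fun_subspace_def by simp_all

lemma fun_subspace_diff:
  assumes "fun_subspace M" "f \<in> M" "g \<in> M"
  shows "(\<lambda>x. f x - g x) \<in> M"
  using fun_subspace_add[OF assms(1,2) fun_subspace_scale[OF assms(1,3), of "-1"]] by simp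

lemma fun_subspace_sum:
  assumes "fun_subspace M" "\<And>i. i \<in> A \<Longrightarrow> F i \<in> M"
  shows "(\<lambda>x. \<Sum>i\<in>A. c i * F i x) \<in> M"
  using assms(2)
proof (induction A rule: infinite_finite_induct)
  case (insert i A)
  then show ?case
    using fun_subspace_add[OF assms(1) fun_subspace_scale[OF assms(1), of "F i" "c i"]] by simp
qed (use fun_subspace_zero[OF assms(1)] in auto)

section \<open>Inner product calculus in a reproducing kernel Hilbert space\<close>

context rkhs
begin

abbreviation nrm :: "('a \<Rightarrow> complex) \<Rightarrow> real"
  where "nrm \<equiv> ip_norm ip"

definition kernel_fun :: "'a \<Rightarrow> 'a \<Rightarrow> complex"
  where "kernel_fun w = (\<lambda>z. if z \<in> X then K z w else 0)"

lemma kernel_fun_mem: "w \<in> X \<Longrightarrow> kernel_fun w \<in> H"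
  unfolding kernel_fun_def by (rule kernel_mem)

lemma ip_kernel_fun: "f \<in> H \<Longrightarrow> w \<in> X \<Longrightarrow> ip f (kernel_fun w) = f w"
  unfolding kernel_fun_def by (rule reproducing)

lemma zero_mem: "(\<lambda>_. 0) \<in> H"
  and add_mem: "f \<in> H \<Longrightarrow> g \<in> H \<Longrightarrow> (\<lambda>x. f x + g x) \<in> H"
  and scale_mem: "f \<in> H \<Longrightarrow> (\<lambda>x. c * f x) \<in> H"
  using fun_subspace_zero[OF subspace] fun_subspace_add[OF subspace] fun_subspace_scale[OF subspace]
  by auto

lemmas diff_mem = fun_subspace_diff[OF subspace]
lemmas sum_mem = fun_subspace_sum[OF subspace]

lemma ip_add_right:
  assumes "f \<in> H" "g \<in> H" "h \<in> H"
  shows "ip h (\<lambda>x. f x + g x) = ip h f + ip h g"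
  using ip_cnj[OF add_mem[OF assms(1,2)] assms(3)] ip_add[OF assms] ip_cnj[of f h] ip_cnj[of g h] assms
  by simp

lemma ip_scale_right:
  assumes "f \<in> H" "h \<in> H"
  shows "ip h (\<lambda>x. c * f x) = cnj c * ip h f"
  using ip_cnj[OF scale_mem[OF assms(1)] assms(2)] ip_scale[OF assms] ip_cnj[OF assms] by simp

lemma ip_diff:
  assumes "f \<in> H" "g \<in> H" "h \<in> H"
  shows "ip (\<lambda>x. f x - g x) h = ip f h - ip g h"
  using ip_add[of f "\<lambda>x. (-1) * g x" h] ip_scale[of g h "-1"] scale_mem[of g "-1"] assms by simp

lemma ip_diff_right:
  assumes "f \<in> H" "g \<in> H" "h \<in> H"
  shows "ip h (\<lambda>x. f x - g x) = ip h f - ip h g"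
  using ip_cnj[OF diff_mem[OF assms(1,2)] assms(3)] ip_diff[OF assms] ip_cnj[of f h] ip_cnj[of g h] assms
  by simp

lemma ip_zero: "h \<in> H \<Longrightarrow> ip (\<lambda>_. 0) h = 0"
  using ip_scale[of "\<lambda>_. 0" h 0] zero_mem by simp

lemma ip_zero_right: "h \<in> H \<Longrightarrow> ip h (\<lambda>_. 0) = 0"
  using ip_scale_right[of "\<lambda>_. 0" h 0] zero_mem by simp

lemma ip_sum:
  assumes "\<And>i. i \<in> A \<Longrightarrow> F i \<in> H" "h \<in> H"
  shows "ip (\<lambda>x. \<Sum>i\<in>A. c i * F i x) h = (\<Sum>i\<in>A. c i * ip (F i) h)"
  using assms(1)
proof (induction A rule: infinite_finite_induct)
  case (insert i A)
  then show ?case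
    using ip_add[of "\<lambda>x. c i * F i x" "\<lambda>x. \<Sum>i\<in>A. c i * F i x" h] sum_mem[of A F c]
      scale_mem[of "F i"] ip_scale[of "F i" h] assms by simp
qed (use ip_zero assms in auto)

lemma ip_sum_right:
  assumes "\<And>i. i \<in> A \<Longrightarrow> F i \<in> H" "h \<in> H"
  shows "ip h (\<lambda>x. \<Sum>i\<in>A. c i * F i x) = (\<Sum>i\<in>A. cnj (c i) * ip h (F i))"
proof -
  have "ip h (\<lambda>x. \<Sum>i\<in>A. c i * F i x) = cnj (\<Sum>i\<in>A. c i * ip (F i) h)"
    using ip_sum[of A F h c] ip_cnj[OF sum_mem[of A F c] assms(2)] assms by auto
  also have "\<dots> = (\<Sum>i\<in>A. cnj (c i) * ip h (F i))"
    using assms by (simp add: ip_cnj[of _ h])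
  finally show ?thesis .
qed

lemma ip_self: assumes "f \<in> H" shows "ip f f = of_real ((nrm f)\<^sup>2)" "0 \<le> Re (ip f f)"
proof -
  have "Im (ip f f) = 0" using arg_cong[OF ip_cnj[OF assms assms], of Im] by simp
  moreover show "0 \<le> Re (ip f f)" using ip_pos[of f] ip_zero[of f] assms by fastforce
  ultimately show "ip f f = of_real ((nrm f)\<^sup>2)" by (simp add: complex_eq_iff ip_norm_def)
qed

lemma nrm_sq: "f \<in> H \<Longrightarrow> (nrm f)\<^sup>2 = Re (ip f f)"
  by (simp add: ip_self)

lemma nrm_nonneg: "f \<in> H \<Longrightarrow> 0 \<le> nrm f"
  using ip_self(2) by (simp add: ip_norm_def)

lemma nrm_eq_0: "f \<in> H \<Longrightarrow> nrm f = 0 \<longleftrightarrow> f = (\<lambda>_. 0)"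
  using ip_pos[of f] ip_zero[of f] by (fastforce simp: ip_norm_def)

lemma ip_self_eq_0: "f \<in> H \<Longrightarrow> ip f f = 0 \<Longrightarrow> f = (\<lambda>_. 0)"
  using ip_pos[of f] by fastforce

lemma nrm_diff_sq:
  assumes "f \<in> H" "g \<in> H"
  shows "(nrm (\<lambda>x. f x - c * g x))\<^sup>2 = (nrm f)\<^sup>2 - 2 * Re (cnj c * ip f g) + (cmod c)\<^sup>2 * (nrm g)\<^sup>2"
proof -
  have s: "(\<lambda>x. c * g x) \<in> H" using assms scale_mem by blast
  have "ip (\<lambda>x. f x - c * g x) (\<lambda>x. f x - c * g x)
     = ip f f - cnj c * ip f g - cnj (cnj c * ip f g) + c * cnj c * ip g g"
    using assms s by (simp add: ip_diff ip_diff_right ip_scale ip_scale_right diff_mem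
        ip_cnj[of f g] algebra_simps)
  moreover have "Re (c * cnj c * ip g g) = (cmod c)\<^sup>2 * Re (ip g g)"
    by (simp add: complex_norm_square[symmetric] del: of_real_power)
  ultimately show ?thesis using nrm_sq assms diff_mem s by simp
qed

lemma cauchy_schwarz:
  assumes "f \<in> H" "g \<in> H"
  shows "cmod (ip f g) \<le> nrm f * nrm g"
proof (cases "g = (\<lambda>_. 0)")
  case True
  then show ?thesis using assms by (simp add: ip_zero_right nrm_nonneg)
next
  case False
  then have g: "nrm g > 0" using assms nrm_eq_0[of g] nrm_nonneg[of g] by (simp add: less_le)
  define c where "c = ip f g / of_real ((nrm g)\<^sup>2)"
  have 1: "cnj c * ip f g = of_real ((cmod (ip f g))\<^sup>2 / (nrm g)\<^sup>2)"
    unfolding c_def by (simp add: complex_norm_square mult.commute del: of_real_power)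
  have 2: "(cmod c)\<^sup>2 * (nrm g)\<^sup>2 = (cmod (ip f g))\<^sup>2 / (nrm g)\<^sup>2"
    using g by (simp add: c_def norm_divide power_divide power2_eq_square del: of_real_power of_real_mult)
  have "0 \<le> (nrm (\<lambda>x. f x - c * g x))\<^sup>2" by simp
  also have "\<dots> = (nrm f)\<^sup>2 - (cmod (ip f g))\<^sup>2 / (nrm g)\<^sup>2"
    unfolding nrm_diff_sq[OF assms] 1 2 Re_complex_of_real by simp
  finally have "(cmod (ip f g))\<^sup>2 \<le> (nrm f * nrm g)\<^sup>2"
    using g by (simp add: field_simps power_mult_distrib)
  then show ?thesis by (rule power2_le_imp_le) (simp add: assms nrm_nonneg)
qed

lemma nrm_scale: "f \<in> H \<Longrightarrow> nrm (\<lambda>x. c * f x) = cmod c * nrm f"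
proof -
  assume f: "f \<in> H"
  have "(nrm (\<lambda>x. c * f x))\<^sup>2 = (cmod c * nrm f)\<^sup>2"
    using nrm_diff_sq[of "\<lambda>_. 0" f "-c"] f zero_mem ip_zero
    by (simp add: power_mult_distrib ip_norm_def)
  then show ?thesis
    using nrm_nonneg[OF scale_mem[OF f]] nrm_nonneg[OF f] by simp
qed

lemma nrm_triangle:
  assumes "f \<in> H" "g \<in> H"
  shows "nrm (\<lambda>x. f x + g x) \<le> nrm f + nrm g"
proof -
  have "(nrm (\<lambda>x. f x + g x))\<^sup>2 = (nrm f)\<^sup>2 + 2 * Re (ip f g) + (nrm g)\<^sup>2"
    using nrm_diff_sq[OF assms, of "-1"] by simp
  also have "Re (ip f g) \<le> nrm f * nrm g"
    using cauchy_schwarz[OF assms] complex_Re_le_cmod order_trans by blast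
  finally have "(nrm (\<lambda>x. f x + g x))\<^sup>2 \<le> (nrm f + nrm g)\<^sup>2" by (simp add: power2_sum)
  then show ?thesis by (rule power2_le_imp_le) (simp add: assms nrm_nonneg)
qed

lemma nrm_minus: "f \<in> H \<Longrightarrow> g \<in> H \<Longrightarrow> nrm (\<lambda>x. f x - g x) = nrm (\<lambda>x. g x - f x)"
  using nrm_scale[of "\<lambda>x. f x - g x" "-1"] diff_mem[of f g] by simp

lemma nrm_triangle_diff:
  assumes "f \<in> H" "g \<in> H" "h \<in> H"
  shows "nrm (\<lambda>x. f x - h x) \<le> nrm (\<lambda>x. f x - g x) + nrm (\<lambda>x. g x - h x)"
  using nrm_triangle[of "\<lambda>x. f x - g x" "\<lambda>x. g x - h x"] assms diff_mem by simp

lemma ip_tendsto: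
  assumes "\<And>n. F n \<in> H" "f \<in> H" "g \<in> H" "(\<lambda>n. nrm (\<lambda>x. F n x - f x)) \<longlonglongrightarrow> 0"
  shows "(\<lambda>n::nat. ip (F n) g) \<longlonglongrightarrow> ip f g"
proof -
  have "(\<lambda>n. ip (F n) g - ip f g) \<longlonglongrightarrow> 0"
  proof (rule Lim_null_comparison)
    show "\<forall>\<^sub>F n in sequentially. norm (ip (F n) g - ip f g) \<le> nrm (\<lambda>x. F n x - f x) * nrm g"
      using cauchy_schwarz diff_mem assms by (simp flip: ip_diff)
    show "(\<lambda>n. nrm (\<lambda>x. F n x - f x) * nrm g) \<longlonglongrightarrow> 0"
      using tendsto_mult_left_zero[OF assms(4)] by simp
  qed
  then show ?thesis using Lim_null by blast
qed

lemma nrm_tendsto: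
  assumes "\<And>n. F n \<in> H" "f \<in> H" "(\<lambda>n. nrm (\<lambda>x. F n x - f x)) \<longlonglongrightarrow> 0"
  shows "(\<lambda>n::nat. nrm (F n)) \<longlonglongrightarrow> nrm f"
proof -
  have "(\<lambda>n. nrm (F n) - nrm f) \<longlonglongrightarrow> 0"
  proof (rule Lim_null_comparison[OF _ assms(3)], intro always_eventually allI)
    fix n
    have d: "(\<lambda>x. F n x - f x) \<in> H" "(\<lambda>x. f x - F n x) \<in> H" using assms diff_mem by auto
    have "nrm (F n) \<le> nrm (\<lambda>x. F n x - f x) + nrm f" using nrm_triangle[OF d(1) assms(2)] by simp
    moreover have "nrm f \<le> nrm (\<lambda>x. F n x - f x) + nrm (F n)"
      using nrm_triangle[OF d(2) assms(1)[of n]] nrm_minus assms by simp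
    ultimately show "norm (nrm (F n) - nrm f) \<le> nrm (\<lambda>x. F n x - f x)" by (simp add: abs_le_iff)
  qed
  then show ?thesis using Lim_null by blast
qed

lemma pointwise_tendsto:
  assumes "\<And>n. F n \<in> H" "f \<in> H" "(\<lambda>n. nrm (\<lambda>x. F n x - f x)) \<longlonglongrightarrow> 0"
  shows "(\<lambda>n::nat. F n w) \<longlonglongrightarrow> f w"
proof (cases "w \<in> X")
  case True
  then show ?thesis
    using ip_tendsto[OF assms(1,2) kernel_fun_mem assms(3)] ip_kernel_fun assms by simp
next
  case False
  then show ?thesis using vanish_off[OF assms(1)] vanish_off[OF assms(2)] by simp
qed

section \<open>Closed subspaces, orthogonal complements and projections\<close>

definition closed_sub :: "('a \<Rightarrow> complex) set \<Rightarrow> bool"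
  where "closed_sub M \<longleftrightarrow> M \<subseteq> H \<and> fun_subspace M \<and>
    (\<forall>F. \<forall>f\<in>H. (\<forall>n::nat. F n \<in> M) \<longrightarrow> (\<lambda>n. nrm (\<lambda>x. F n x - f x)) \<longlonglongrightarrow> 0 \<longrightarrow> f \<in> M)"

definition orth :: "('a \<Rightarrow> complex) set \<Rightarrow> ('a \<Rightarrow> complex) set"
  where "orth M = {f\<in>H. \<forall>g\<in>M. ip f g = 0}"

lemma closed_subI:
  assumes "M \<subseteq> H" "fun_subspace M"
    and "\<And>F f. f \<in> H \<Longrightarrow> (\<And>n::nat. F n \<in> M) \<Longrightarrow> (\<lambda>n. nrm (\<lambda>x. F n x - f x)) \<longlonglongrightarrow> 0 \<Longrightarrow> f \<in> M"
  shows "closed_sub M"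
  unfolding closed_sub_def
proof (intro conjI allI ballI impI)
  fix F :: "nat \<Rightarrow> _" and f
  assume "f \<in> H" "\<forall>n. F n \<in> M" "(\<lambda>n. nrm (\<lambda>x. F n x - f x)) \<longlonglongrightarrow> 0"
  then show "f \<in> M" using assms(3)[of f F] by simp
qed (use assms in auto)

lemma closed_subD:
  assumes "closed_sub M"
  shows "M \<subseteq> H" "fun_subspace M"
    and "f \<in> H \<Longrightarrow> (\<And>n::nat. F n \<in> M) \<Longrightarrow> (\<lambda>n. nrm (\<lambda>x. F n x - f x)) \<longlonglongrightarrow> 0 \<Longrightarrow> f \<in> M"
proof -
  show "M \<subseteq> H" "fun_subspace M" using assms unfolding closed_sub_def by simp_all
  assume f: "f \<in> H" "\<And>n::nat. F n \<in> M" "(\<lambda>n. nrm (\<lambda>x. F n x - f x)) \<longlonglongrightarrow> 0"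
  then have "\<forall>n. F n \<in> M" by simp
  then show "f \<in> M" using assms f(1,3) unfolding closed_sub_def by (elim conjE allE[of _ F]) simp
qed

lemma closed_sub_orth: assumes "M \<subseteq> H" shows "closed_sub (orth M)"
proof (rule closed_subI)
  show "orth M \<subseteq> H" unfolding orth_def by auto
  have MH: "g \<in> H" if "g \<in> M" for g using assms that by auto
  show "fun_subspace (orth M)"
    unfolding fun_subspace_def
  proof (intro conjI ballI allI)
    show "(\<lambda>_. 0) \<in> orth M" using MH zero_mem ip_zero unfolding orth_def by auto
    show "(\<lambda>x. f x + g x) \<in> orth M" if "f \<in> orth M" "g \<in> orth M" for f g
      using that MH add_mem ip_add unfolding orth_def by simp
    show "(\<lambda>x. c * f x) \<in> orth M" if "f \<in> orth M" for c f
      using that MH scale_mem ip_scale unfolding orth_def by simp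
  qed
  fix F :: "nat \<Rightarrow> _" and f
  assume f: "f \<in> H" and F: "\<And>n. F n \<in> orth M" and lim: "(\<lambda>n. nrm (\<lambda>x. F n x - f x)) \<longlonglongrightarrow> 0"
  have "ip f g = 0" if g: "g \<in> M" for g
  proof -
    have FH: "F n \<in> H" for n using F[of n] unfolding orth_def by simp
    have "(\<lambda>n. ip (F n) g) \<longlonglongrightarrow> ip f g" by (rule ip_tendsto[OF FH f MH[OF g] lim])
    moreover have "ip (F n) g = 0" for n using F[of n] g unfolding orth_def by simp
    ultimately show ?thesis by (simp add: LIMSEQ_const_iff)
  qed
  then show "f \<in> orth M" using f unfolding orth_def by simp
qed

lemma parallelogram:
  assumes "f \<in> H" "g \<in> H"
  shows "(nrm (\<lambda>x. f x - g x))\<^sup>2 + (nrm (\<lambda>x. f x + g x))\<^sup>2 = 2 * (nrm f)\<^sup>2 + 2 * (nrm g)\<^sup>2"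
  using nrm_diff_sq[OF assms, of 1] nrm_diff_sq[OF assms, of "-1"] by simp

text \<open>A minimizing sequence for the distance from \<open>f\<close> to \<open>M\<close> is
  Cauchy by the parallelogram law, and at the minimum no direction \<open>h\<close> in
  \<open>M\<close> can shorten the distance, which is orthogonality.\<close>

theorem projection:
  assumes M: "closed_sub M" and f: "f \<in> H"
  shows "\<exists>g\<in>M. \<forall>h\<in>M. ip (\<lambda>x. f x - g x) h = 0"
proof -
  have MH: "M \<subseteq> H" and sub: "fun_subspace M" using closed_subD[OF M] by auto
  have M0: "(\<lambda>_. 0) \<in> M" by (rule fun_subspace_zero[OF sub])
  define D where "D = (\<lambda>g. (nrm (\<lambda>x. f x - g x))\<^sup>2) ` M"
  define d where "d = Inf D"
  have bdd: "bdd_below D" unfolding D_def by (intro bdd_belowI[of _ 0]) auto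
  have ne: "D \<noteq> {}" using M0 unfolding D_def by blast
  have d_le: "d \<le> (nrm (\<lambda>x. f x - g x))\<^sup>2" if "g \<in> M" for g
    unfolding d_def using bdd that by (intro cInf_lower) (auto simp: D_def)
  have "\<exists>g\<in>M. (nrm (\<lambda>x. f x - g x))\<^sup>2 < d + e" if "e > 0" for e
  proof -
    have "Inf D < d + e" using that unfolding d_def by simp
    then show ?thesis using cInf_lessD[OF ne] unfolding D_def by blast
  qed
  then have "\<forall>n::nat. \<exists>g\<in>M. (nrm (\<lambda>x. f x - g x))\<^sup>2 < d + inverse (real (Suc n))" by simp
  then obtain F where F: "\<And>n. F n \<in> M" "\<And>n::nat. (nrm (\<lambda>x. f x - F n x))\<^sup>2 < d + inverse (real (Suc n))"
    by metis
  have FH: "F n \<in> H" for n using F MH by blast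
  have close: "(nrm (\<lambda>x. F m x - F n x))\<^sup>2 < 2 * inverse (real (Suc m)) + 2 * inverse (real (Suc n))" for m n
  proof -
    let ?u = "\<lambda>x. f x - F m x" and ?v = "\<lambda>x. f x - F n x"
    have uv: "?u \<in> H" "?v \<in> H" using diff_mem f FH by auto
    \<comment> \<open>The midpoint of \<open>F m\<close> and \<open>F n\<close> stays in
      \<open>M\<close>, so its squared distance to \<open>f\<close> is at least \<open>d\<close>.
      This bounds the sum term of the parallelogram law from below.\<close>
    let ?c = "\<lambda>x. (1/2) * (F m x + F n x)"
    have cM: "?c \<in> M" using fun_subspace_scale[OF sub fun_subspace_add[OF sub F(1) F(1)]] .
    then have "(\<lambda>x. f x - ?c x) \<in> H" using diff_mem[OF f] MH by auto
    then have "nrm (\<lambda>x. 2 * (f x - ?c x)) = 2 * nrm (\<lambda>x. f x - ?c x)" by (subst nrm_scale) auto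
    moreover have "(\<lambda>x. 2 * (f x - ?c x)) = (\<lambda>x. ?u x + ?v x)" by (auto simp: algebra_simps)
    ultimately have "(nrm (\<lambda>x. ?u x + ?v x))\<^sup>2 \<ge> 4 * d"
      using d_le[OF cM] by (simp add: power_mult_distrib)
    moreover have "nrm (\<lambda>x. ?u x - ?v x) = nrm (\<lambda>x. F m x - F n x)"
      using nrm_minus[OF FH FH, of m n] by simp
    ultimately show ?thesis using parallelogram[OF uv] F(2)[of m] F(2)[of n] by simp
  qed
  have "\<exists>g\<in>H. (\<lambda>n::nat. nrm (\<lambda>x. F n x - g x)) \<longlonglongrightarrow> 0"
  proof (rule complete[OF FH])
    fix e :: real assume e: "e > 0"
    then obtain N where N: "inverse (real (Suc N)) < e\<^sup>2 / 4" using reals_Archimedean[of "e\<^sup>2/4"] by auto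
    have "nrm (\<lambda>x. F m x - F n x) < e" if "m \<ge> N" "n \<ge> N" for m n
    proof -
      have "inverse (real (Suc m)) \<le> inverse (real (Suc N))" "inverse (real (Suc n)) \<le> inverse (real (Suc N))"
        using that by (auto simp: le_imp_inverse_le)
      then have "(nrm (\<lambda>x. F m x - F n x))\<^sup>2 < e\<^sup>2" using close[of m n] N by linarith
      then show ?thesis using e power_less_imp_less_base by fastforce
    qed
    then show "\<exists>N. \<forall>m\<ge>N. \<forall>n\<ge>N. nrm (\<lambda>x. F m x - F n x) < e" by blast
  qed
  then obtain g where g: "g \<in> H" "(\<lambda>n. nrm (\<lambda>x. F n x - g x)) \<longlonglongrightarrow> 0" by blast
  have gM: "g \<in> M" by (rule closed_subD(3)[OF M g(1) F(1) g(2)])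
  have "(\<lambda>n. nrm (\<lambda>x. f x - F n x)) \<longlonglongrightarrow> nrm (\<lambda>x. f x - g x)"
  proof (rule nrm_tendsto)
    have "(\<lambda>n. nrm (\<lambda>x. g x - F n x)) \<longlonglongrightarrow> 0" using g nrm_minus FH by simp
    then show "(\<lambda>n. nrm (\<lambda>x. f x - F n x - (f x - g x))) \<longlonglongrightarrow> 0" by simp
  qed (use diff_mem f FH g in auto)
  then have "(\<lambda>n. (nrm (\<lambda>x. f x - F n x))\<^sup>2) \<longlonglongrightarrow> (nrm (\<lambda>x. f x - g x))\<^sup>2" by (intro tendsto_power)
  moreover have "(\<lambda>n. d + inverse (real (Suc n))) \<longlonglongrightarrow> d"
    using tendsto_add[OF tendsto_const LIMSEQ_inverse_real_of_nat] by simp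
  ultimately have min: "(nrm (\<lambda>x. f x - g x))\<^sup>2 \<le> d"
    by (rule LIMSEQ_le) (use F(2) in \<open>auto intro!: exI[of _ 0] less_imp_le\<close>)
  have "ip (\<lambda>x. f x - g x) h = 0" if h: "h \<in> M" for h
  proof (cases "h = (\<lambda>_. 0)")
    case True
    then show ?thesis using ip_zero_right diff_mem f g by simp
  next
    case False
    have hH: "h \<in> H" using h MH by blast
    have nz: "nrm h > 0" using False nrm_eq_0[OF hH] nrm_nonneg[OF hH] by (simp add: less_le)
    let ?u = "\<lambda>x. f x - g x"
    have u: "?u \<in> H" using diff_mem[OF f g(1)] .
    \<comment> \<open>This \<open>c\<close> minimizes the norm of \<open>?u - c h\<close>. The gain
      over \<open>c = 0\<close> is \<open>|ip ?u h|^2 / |h|^2\<close>, which minimality of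
      \<open>g\<close> forces to vanish.\<close>
    define c where "c = ip ?u h / of_real ((nrm h)\<^sup>2)"
    have "(\<lambda>x. g x + c * h x) \<in> M" using fun_subspace_add[OF sub gM fun_subspace_scale[OF sub h]] .
    then have "(nrm ?u)\<^sup>2 \<le> (nrm (\<lambda>x. f x - (g x + c * h x)))\<^sup>2" by (rule order_trans[OF min d_le])
    also have "(\<lambda>x. f x - (g x + c * h x)) = (\<lambda>x. ?u x - c * h x)" by (auto simp: algebra_simps)
    also have "(nrm (\<lambda>x. ?u x - c * h x))\<^sup>2 = (nrm ?u)\<^sup>2 - 2 * Re (cnj c * ip ?u h) + (cmod c)\<^sup>2 * (nrm h)\<^sup>2"
      by (rule nrm_diff_sq[OF u hH])
    finally have *: "2 * Re (cnj c * ip ?u h) \<le> (cmod c)\<^sup>2 * (nrm h)\<^sup>2" by simp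
    have 1: "cnj c * ip ?u h = of_real ((cmod (ip ?u h))\<^sup>2 / (nrm h)\<^sup>2)"
      unfolding c_def by (simp add: complex_norm_square mult.commute del: of_real_power)
    have 2: "(cmod c)\<^sup>2 * (nrm h)\<^sup>2 = (cmod (ip ?u h))\<^sup>2 / (nrm h)\<^sup>2"
      using nz by (simp add: c_def norm_divide power_divide power2_eq_square del: of_real_power of_real_mult)
    have "(cmod (ip ?u h))\<^sup>2 / (nrm h)\<^sup>2 \<le> 0" using * unfolding 1 2 Re_complex_of_real by simp
    then have "(cmod (ip ?u h))\<^sup>2 \<le> 0" using nz by (simp add: divide_le_0_iff)
    then show ?thesis by simp
  qed
  then show ?thesis using gM by auto
qed

text \<open>The form in which density arguments are run: the elements with a given closed linear
  property fill \<open>H\<close> once nothing but 0 is orthogonal to them.\<close>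

lemma closed_sub_eq_H:
  assumes M: "closed_sub M" and "\<And>u. u \<in> H \<Longrightarrow> (\<And>h. h \<in> M \<Longrightarrow> ip u h = 0) \<Longrightarrow> u = (\<lambda>_. 0)"
  shows "M = H"
proof -
  have "f \<in> M" if f: "f \<in> H" for f
  proof -
    obtain g where g: "g \<in> M" "\<forall>h\<in>M. ip (\<lambda>x. f x - g x) h = 0" using projection[OF M f] by blast
    have "(\<lambda>x. f x - g x) = (\<lambda>_. 0)"
      using assms(2)[OF diff_mem[OF f]] g closed_subD(1)[OF M] by auto
    then have "f = g" by (metis eq_iff_diff_eq_0 ext)
    then show ?thesis using g by simp
  qed
  then show ?thesis using closed_subD(1)[OF M] by auto
qed

text \<open>The closure is written with epsilons so that approximants can be taken from
  \<open>M\<close> itself, as \<open>kernel_dense\<close> requires; a limit of limits is reached by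
  halving \<open>e\<close>.\<close>

lemma closed_sub_closure:
  assumes M: "M \<subseteq> H" "fun_subspace M"
  defines "C \<equiv> {u\<in>H. \<forall>e>0. \<exists>v\<in>M. nrm (\<lambda>x. v x - u x) < e}"
  shows "closed_sub C"
proof (rule closed_subI)
  show "C \<subseteq> H" unfolding C_def by auto
  show "u \<in> C" if u: "u \<in> H" "\<And>n. F n \<in> C" "(\<lambda>n::nat. nrm (\<lambda>x. F n x - u x)) \<longlonglongrightarrow> 0" for F u
  proof -
    have "\<exists>v\<in>M. nrm (\<lambda>x. v x - u x) < e" if "e > 0" for e
    proof -
      have "\<forall>\<^sub>F n in sequentially. nrm (\<lambda>x. F n x - u x) < e / 2"
        using u(3) that by (intro order_tendstoD) auto
      then obtain n where n: "nrm (\<lambda>x. F n x - u x) < e / 2" using eventually_happens by fastforce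
      obtain v where v: "v \<in> M" "nrm (\<lambda>x. v x - F n x) < e / 2" using u(2)[of n] half_gt_zero[OF \<open>e > 0\<close>] unfolding C_def by fast
      have "F n \<in> H" "v \<in> H" using u v M unfolding C_def by auto
      then have "nrm (\<lambda>x. v x - u x) < e" using nrm_triangle_diff[of v "F n" u] u n v by simp
      then show ?thesis using v by blast
    qed
    then show ?thesis using u unfolding C_def by simp
  qed
  show "fun_subspace C"
    unfolding fun_subspace_def
  proof (intro conjI ballI allI)
    show "(\<lambda>_. 0) \<in> C" using zero_mem fun_subspace_zero[OF M(2)] nrm_eq_0[OF zero_mem] unfolding C_def
      by (auto intro!: bexI[of _ "\<lambda>_. 0"])
  next
    fix f g assume fg: "f \<in> C" "g \<in> C"
    have "\<exists>v\<in>M. nrm (\<lambda>x. v x - (f x + g x)) < e" if "e > 0" for e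
    proof -
      have "e / 2 > 0" using that by simp
      then obtain v w where vw: "v \<in> M" "nrm (\<lambda>x. v x - f x) < e / 2" "w \<in> M" "nrm (\<lambda>x. w x - g x) < e / 2"
        using fg unfolding C_def by blast
      have "f \<in> H" "g \<in> H" "v \<in> H" "w \<in> H" using fg vw M unfolding C_def by auto
      then have "nrm (\<lambda>x. (v x - f x) + (w x - g x)) < e"
        using nrm_triangle[of "\<lambda>x. v x - f x" "\<lambda>x. w x - g x"] vw diff_mem by force
      then have "nrm (\<lambda>x. (v x + w x) - (f x + g x)) < e" by (simp add: add_diff_add)
      moreover have "(\<lambda>x. v x + w x) \<in> M" using fun_subspace_add[OF M(2)] vw by blast
      ultimately show ?thesis by auto
    qed
    then show "(\<lambda>x. f x + g x) \<in> C" using fg add_mem unfolding C_def by simp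
  next
    fix c f assume f: "f \<in> C"
    have "\<exists>v\<in>M. nrm (\<lambda>x. v x - c * f x) < e" if "e > 0" for e
    proof -
      \<comment> \<open>Adding 1 covers the case \<open>c = 0\<close>.\<close>
      have "e / (cmod c + 1) > 0" using that by (simp add: add_nonneg_pos)
      then obtain v where v: "v \<in> M" "nrm (\<lambda>x. v x - f x) < e / (cmod c + 1)"
        using f unfolding C_def by blast
      have vf: "(\<lambda>x. v x - f x) \<in> H" using f v M diff_mem unfolding C_def by auto
      have "cmod c * nrm (\<lambda>x. v x - f x) \<le> (cmod c + 1) * nrm (\<lambda>x. v x - f x)"
        using nrm_nonneg[OF vf] by (intro mult_right_mono) auto
      also have "\<dots> < e" using v(2) by (subst (asm) pos_less_divide_eq) (auto simp: mult.commute add_nonneg_pos)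
      finally have "nrm (\<lambda>x. c * (v x - f x)) < e" using nrm_scale[OF vf, of c] by simp
      then have "nrm (\<lambda>x. c * v x - c * f x) < e" by (simp add: right_diff_distrib)
      moreover have "(\<lambda>x. c * v x) \<in> M" using fun_subspace_scale[OF M(2) v(1)] .
      ultimately show ?thesis by auto
    qed
    then show "(\<lambda>x. c * f x) \<in> C" using f scale_mem unfolding C_def by simp
  qed
qed

text \<open>An element orthogonal to all kernel functions vanishes at every point by the reproducing
  property, so the closure of their span is all of \<open>H\<close>.\<close>

lemma kernel_dense:
  assumes u: "u \<in> H" and e: "e > 0"
  obtains F c where "finite F" "F \<subseteq> X" "nrm (\<lambda>x. (\<Sum>w\<in>F. c w * kernel_fun w x) - u x) < e"
proof -
  define M where "M = {v. \<exists>F c. finite F \<and> F \<subseteq> X \<and> v = (\<lambda>x. \<Sum>w\<in>F. c w * kernel_fun w x)}"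
  have MI: "(\<lambda>x. \<Sum>w\<in>F. c w * kernel_fun w x) \<in> M" if "finite F" "F \<subseteq> X" for F c
    unfolding M_def by (intro CollectI exI[of _ F] exI[of _ c] conjI that refl)
  have MH: "M \<subseteq> H" unfolding M_def by (auto intro!: sum_mem kernel_fun_mem)
  have sub: "fun_subspace M"
    unfolding fun_subspace_def
  proof (intro conjI ballI allI)
    show "(\<lambda>_. 0) \<in> M" using MI[of "{}"] by simp
  next
    fix f g assume "f \<in> M" "g \<in> M"
    then obtain F c G d where fg: "finite F" "F \<subseteq> X" "f = (\<lambda>x. \<Sum>w\<in>F. c w * kernel_fun w x)"
      "finite G" "G \<subseteq> X" "g = (\<lambda>x. \<Sum>w\<in>G. d w * kernel_fun w x)" unfolding M_def by blast
    \<comment> \<open>Extending both coefficient families by zero places them on the common index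
      set \<open>F \<union> G\<close>.\<close>
    let ?e = "\<lambda>w. (if w \<in> F then c w else 0) + (if w \<in> G then d w else 0)"
    have "f x + g x = (\<Sum>w\<in>F\<union>G. ?e w * kernel_fun w x)" for x
    proof -
      have "f x = (\<Sum>w\<in>F\<union>G. (if w \<in> F then c w else 0) * kernel_fun w x)"
        unfolding fg using fg by (intro sum.mono_neutral_cong_left) auto
      moreover have "g x = (\<Sum>w\<in>F\<union>G. (if w \<in> G then d w else 0) * kernel_fun w x)"
        unfolding fg using fg by (intro sum.mono_neutral_cong_left) auto
      ultimately show ?thesis by (simp add: sum.distrib[symmetric] distrib_right)
    qed
    then have "(\<lambda>x. f x + g x) = (\<lambda>x. \<Sum>w\<in>F\<union>G. ?e w * kernel_fun w x)" by (rule ext)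
    moreover have "finite (F \<union> G)" "F \<union> G \<subseteq> X" using fg by auto
    ultimately show "(\<lambda>x. f x + g x) \<in> M" using MI[of "F \<union> G" ?e] by simp
  next
    fix c f assume "f \<in> M"
    then obtain F d where f: "finite F" "F \<subseteq> X" "f = (\<lambda>x. \<Sum>w\<in>F. d w * kernel_fun w x)"
      unfolding M_def by blast
    then have "(\<lambda>x. c * f x) = (\<lambda>x. \<Sum>w\<in>F. (c * d w) * kernel_fun w x)"
      by (simp add: sum_distrib_left mult.assoc)
    then show "(\<lambda>x. c * f x) \<in> M" using MI[OF f(1,2), of "\<lambda>w. c * d w"] by simp
  qed
  define C where "C = {u\<in>H. \<forall>e>0. \<exists>v\<in>M. nrm (\<lambda>x. v x - u x) < e}"
  have kC: "kernel_fun w \<in> C" if w: "w \<in> X" for w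
  proof -
    have "kernel_fun w \<in> M" using MI[of "{w}" "\<lambda>_. 1"] w by simp
    then show ?thesis unfolding C_def using w kernel_fun_mem
      nrm_eq_0[OF zero_mem] by (auto intro!: bexI[of _ "kernel_fun w"])
  qed
  have "C = H"
  proof (rule closed_sub_eq_H)
    show "closed_sub C" unfolding C_def by (rule closed_sub_closure[OF MH sub])
    fix u assume u: "u \<in> H" "\<And>h. h \<in> C \<Longrightarrow> ip u h = 0"
    have "u w = 0" for w
      using u kC ip_kernel_fun[OF u(1), of w] vanish_off[OF u(1), of w] by (cases "w \<in> X") auto
    then show "u = (\<lambda>_. 0)" by blast
  qed
  then have "\<exists>v\<in>M. nrm (\<lambda>x. v x - u x) < e" using u e unfolding C_def by blast
  then obtain F c where "finite F" "F \<subseteq> X" "nrm (\<lambda>x. (\<Sum>w\<in>F. c w * kernel_fun w x) - u x) < e"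
    unfolding M_def by blast
  then show ?thesis using that by blast
qed

text \<open>Positivity of \<open>(1 - p z cnj (p w)) k(z, w)\<close> says that \<open>k\<^sub>w \<mapsto> cnj (p w) k\<^sub>w\<close> is contractive
  on \<open>S\<close>. Testing it on combinations of the \<open>k\<^sub>w\<close> whose lifts to the ambient space approximate
  \<open>e = p f - P\<^sub>S (p f)\<close> gives \<open>\<langle>e, p f\<rangle> = 0\<close>.\<close>

theorem multiplier_closed_sub:
  assumes S: "closed_sub S"
    and k: "\<And>w. w \<in> X \<Longrightarrow> k w \<in> S" "\<And>f w. f \<in> S \<Longrightarrow> w \<in> X \<Longrightarrow> ip f (k w) = f w"
    and pos: "positive_kernel X (\<lambda>z w. (1 - p z * cnj (p w)) * k w z)"
    and f: "f \<in> S" and pf: "(\<lambda>x. p x * f x) \<in> H"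
  shows "(\<lambda>x. p x * f x) \<in> S"
proof -
  let ?F = "\<lambda>x. p x * f x"
  have SH: "S \<subseteq> H" using closed_subD[OF S] by blast
  have kH: "k w \<in> H" if "w \<in> X" for w using k that SH by blast
  have fH: "f \<in> H" using f SH by blast
  obtain g where g: "g \<in> S" "\<forall>h\<in>S. ip (\<lambda>x. ?F x - g x) h = 0" using projection[OF S pf] by blast
  define e where "e = (\<lambda>x. ?F x - g x)"
  have eH: "e \<in> H" unfolding e_def using diff_mem[OF pf] g(1) SH by auto
  have bound: "cmod (ip e ?F) \<le> d * (nrm ?F + nrm f)" if d: "d > 0" for d
  proof -
    obtain A c where A: "finite A" "A \<subseteq> X" "nrm (\<lambda>x. (\<Sum>w\<in>A. c w * kernel_fun w x) - e x) < d"
      using kernel_dense[OF eH d] by blast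
    \<comment> \<open>\<open>u\<close> approximates \<open>e\<close>; \<open>a\<close> is the
      projection of \<open>u\<close> to \<open>S\<close>; \<open>b\<close> is the image of
      \<open>a\<close> under the contraction that multiplies \<open>k w\<close> by
      \<open>cnj (p w)\<close>.\<close>
    define u where "u = (\<lambda>x. \<Sum>w\<in>A. c w * kernel_fun w x)"
    define a where "a = (\<lambda>x. \<Sum>w\<in>A. c w * k w x)"
    define b where "b = (\<lambda>x. \<Sum>w\<in>A. (c w * cnj (p w)) * k w x)"
    have u: "u \<in> H" unfolding u_def using A kernel_fun_mem by (intro sum_mem) auto
    have aS: "a \<in> S" unfolding a_def using A k S by (intro fun_subspace_sum closed_subD(2)[OF S]) auto
    have b: "b \<in> H" unfolding b_def using A kH by (intro sum_mem) auto
    have aH: "a \<in> H" using aS SH by blast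
    have ipk: "ip (k w) h = cnj (h w)" if "w \<in> X" "h \<in> S" for w h
      using ip_cnj[of h "k w"] that k SH by auto
    have ipK: "ip (kernel_fun w) h = cnj (h w)" if "w \<in> X" "h \<in> H" for w h
      using ip_cnj[of h "kernel_fun w"] that ip_kernel_fun kernel_fun_mem by auto
    have uh: "ip u h = (\<Sum>w\<in>A. c w * cnj (h w))" if "h \<in> H" for h
      unfolding u_def using A that kernel_fun_mem by (subst ip_sum) (auto simp: ipK intro!: sum.cong)
    have ah: "ip a h = (\<Sum>w\<in>A. c w * cnj (h w))" if "h \<in> S" for h
      unfolding a_def using A that kH SH by (subst ip_sum) (auto simp: ipk intro!: sum.cong)
    \<comment> \<open>The contraction is the adjoint of multiplication by \<open>p\<close>: on
      kernel functions the factor \<open>cnj (p w)\<close> passes from \<open>b\<close> to the value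
      of \<open>f\<close>.\<close>
    have "ip b f = ip u ?F"
      unfolding uh[OF pf] unfolding b_def using A f fH kH
      by (subst ip_sum) (auto simp: ipk intro!: sum.cong)
    \<comment> \<open>The difference of the two Gram sums is the quadratic form of the positive
      kernel in \<open>pos\<close>.\<close>
    have "nrm b \<le> nrm a"
    proof -
      have gram: "ip (\<lambda>x. \<Sum>w\<in>A. d w * k w x) (\<lambda>x. \<Sum>w\<in>A. d w * k w x)
          = (\<Sum>x\<in>A. \<Sum>y\<in>A. cnj (d x) * d y * k y x)" for d
      proof -
        let ?v = "\<lambda>x. \<Sum>w\<in>A. d w * k w x"
        have v: "?v \<in> H" using A kH by (intro sum_mem) auto
        have "ip ?v ?v = (\<Sum>x\<in>A. cnj (d x) * ip ?v (k x))"
          using A kH v by (intro ip_sum_right) auto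
        also have "\<dots> = (\<Sum>x\<in>A. cnj (d x) * (\<Sum>y\<in>A. d y * ip (k y) (k x)))"
        proof (intro sum.cong refl)
          fix x assume "x \<in> A"
          then have "ip ?v (k x) = (\<Sum>y\<in>A. d y * ip (k y) (k x))" using A kH by (intro ip_sum) auto
          then show "cnj (d x) * ip ?v (k x) = cnj (d x) * (\<Sum>y\<in>A. d y * ip (k y) (k x))" by simp
        qed
        also have "\<dots> = (\<Sum>x\<in>A. cnj (d x) * (\<Sum>y\<in>A. d y * k y x))"
        proof (intro sum.cong refl arg_cong2[where f="(*)"])
          fix x y assume "x \<in> A" "y \<in> A"
          then show "ip (k y) (k x) = k y x" using A k by blast
        qed
        also have "\<dots> = (\<Sum>x\<in>A. \<Sum>y\<in>A. cnj (d x) * d y * k y x)"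
          by (simp add: sum_distrib_left mult.assoc)
        finally show ?thesis .
      qed
      have 1: "ip a a = (\<Sum>x\<in>A. \<Sum>y\<in>A. cnj (c x) * c y * k y x)"
        unfolding a_def by (rule gram)
      have 2: "ip b b = (\<Sum>x\<in>A. \<Sum>y\<in>A. cnj (c x) * c y * (p x * cnj (p y)) * k y x)"
        unfolding b_def gram by (simp add: mult_ac)
      have "ip a a - ip b b = (\<Sum>x\<in>A. \<Sum>y\<in>A. cnj (c x) * c y * ((1 - p x * cnj (p y)) * k y x))"
        unfolding 1 2 by (simp add: sum_subtractf[symmetric] algebra_simps)
      then have "ip a a - ip b b \<in> \<real>\<^sub>\<ge>\<^sub>0" using pos A unfolding positive_kernel_def by simp
      then have "Re (ip b b) \<le> Re (ip a a)" by (auto simp: complex_nonneg_Reals_iff)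
      then show ?thesis by (simp add: ip_norm_def)
    qed
    \<comment> \<open>Since \<open>e\<close> is orthogonal to \<open>S\<close>, \<open>a\<close> is
      also the projection of \<open>u - e\<close>, whose norm is below \<open>d\<close>.\<close>
    moreover have "nrm a \<le> nrm (\<lambda>x. u x - e x)"
    proof -
      have ea: "ip e a = 0" unfolding e_def using g aS by blast
      have "ip a a = ip (\<lambda>x. u x - e x) a" using ip_diff[OF u eH aH] ea ah[OF aS] uh[OF aH] by simp
      then have "cmod (of_real ((nrm a)\<^sup>2)) = cmod (ip (\<lambda>x. u x - e x) a)" using ip_self(1)[OF aH] by simp
      then have "(nrm a)\<^sup>2 \<le> nrm (\<lambda>x. u x - e x) * nrm a"
        using cauchy_schwarz[OF diff_mem[OF u eH] aH] unfolding norm_of_real by simp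
      then show ?thesis using nrm_nonneg[OF aH] nrm_nonneg[OF diff_mem[OF u eH]]
        by (cases "nrm a = 0") (auto simp: power2_eq_square)
    qed
    ultimately have bd: "nrm b \<le> d" using A(3) unfolding u_def by simp
    have "ip e ?F = ip b f - ip (\<lambda>x. u x - e x) ?F" using ip_diff[OF u eH pf] \<open>ip b f = ip u ?F\<close> by simp
    then have "cmod (ip e ?F) \<le> cmod (ip b f) + cmod (ip (\<lambda>x. u x - e x) ?F)" using norm_triangle_ineq4 by simp
    also have "\<dots> \<le> nrm b * nrm f + nrm (\<lambda>x. u x - e x) * nrm ?F"
      using cauchy_schwarz b fH diff_mem u eH pf by (intro add_mono) auto
    also have "\<dots> \<le> d * nrm f + d * nrm ?F"
      using bd A(3) nrm_nonneg fH pf unfolding u_def by (intro add_mono mult_right_mono) auto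
    finally show ?thesis by (simp add: algebra_simps)
  qed
  have "cmod (ip e ?F) \<le> 0"
  proof (rule field_le_epsilon)
    fix d :: real assume d: "d > 0"
    let ?c = "nrm ?F + nrm f"
    have c: "?c \<ge> 0" using nrm_nonneg pf fH by simp
    have "cmod (ip e ?F) \<le> (d / (?c + 1)) * ?c" using d c by (intro bound) auto
    also have "\<dots> \<le> d" using d c by (simp add: field_simps)
    finally show "cmod (ip e ?F) \<le> 0 + d" by simp
  qed
  then have eF: "ip e ?F = 0" by simp
  have "ip e e = ip e ?F - ip e g" unfolding e_def using ip_diff_right[OF pf _ eH[unfolded e_def]] g(1) SH by auto
  moreover have "ip e g = 0" using g unfolding e_def by blast
  ultimately have "ip e e = 0" using eF by simp
  then have "e = (\<lambda>_. 0)" using ip_self_eq_0 eH by blast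
  then have "?F = g" unfolding e_def by (metis eq_iff_diff_eq_0 ext)
  then show ?thesis using g by simp
qed

lemma rkhs_closed_sub:
  assumes S: "closed_sub S"
    and k: "\<And>w. w \<in> X \<Longrightarrow> (\<lambda>z. if z \<in> X then L z w else 0) \<in> S"
      "\<And>f w. f \<in> S \<Longrightarrow> w \<in> X \<Longrightarrow> ip f (\<lambda>z. if z \<in> X then L z w else 0) = f w"
  shows "rkhs X S ip L"
proof -
  have SH: "S \<subseteq> H" and sub: "fun_subspace S" using closed_subD[OF S] by auto
  show ?thesis
  proof
    fix F :: "nat \<Rightarrow> _"
    assume F: "\<And>n. F n \<in> S""\<And>e. 0 < e \<Longrightarrow> \<exists>N. \<forall>m\<ge>N. \<forall>n\<ge>N. nrm (\<lambda>x. F m x - F n x) < e"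
    then obtain f where "f \<in> H" "(\<lambda>n. nrm (\<lambda>x. F n x - f x)) \<longlonglongrightarrow> 0"
      using complete[of F] SH by blast
    then show "\<exists>f\<in>S. (\<lambda>n. nrm (\<lambda>x. F n x - f x)) \<longlonglongrightarrow> 0" using closed_subD(3)[OF S] F(1) by blast
  next
    show "ip g f = cnj (ip f g)" if "f \<in> S" "g \<in> S" for f g
      using ip_cnj[of f g] that SH by auto
    show "0 < Re (ip f f)" if "f \<in> S" "f \<noteq> (\<lambda>_. 0)" for f
      using ip_pos[of f] that SH by auto
  qed (use SH sub k vanish_off ip_add ip_scale in \<open>auto simp: subset_iff\<close>)
qed

text \<open>The double sum is the squared norm of a combination of kernel functions at the points
  \<open>\<pi> y\<close>. The map \<open>\<pi>\<close> admits restriction to a slice, from which the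
  Agler kernels of a product get their positivity.\<close>

lemma gram_positive:
  assumes "\<And>x. x \<in> Y \<Longrightarrow> \<pi> x \<in> X"
  shows "positive_kernel Y (\<lambda>x y. a x * cnj (a y) * K (\<pi> x) (\<pi> y))"
  unfolding positive_kernel_def
proof (intro allI impI)
  fix F c assume F: "finite F" "F \<subseteq> Y"
  define v where "v = (\<lambda>x. \<Sum>y\<in>F. (c y * cnj (a y)) * kernel_fun (\<pi> y) x)"
  have v: "v \<in> H" unfolding v_def using F assms kernel_fun_mem by (intro sum_mem) auto
  have "ip v v = (\<Sum>x\<in>F. cnj (c x * cnj (a x)) * ip v (kernel_fun (\<pi> x)))"
    using v F assms kernel_fun_mem unfolding v_def by (subst (1) ip_sum_right) auto
  also have "\<dots> = (\<Sum>x\<in>F. cnj (c x * cnj (a x)) * v (\<pi> x))"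
    using F assms ip_kernel_fun[OF v] by (intro sum.cong) auto
  also have "\<dots> = (\<Sum>x\<in>F. \<Sum>y\<in>F. cnj (c x) * c y * (a x * cnj (a y) * K (\<pi> x) (\<pi> y)))"
    unfolding v_def using F assms
    by (intro sum.cong refl) (auto simp: sum_distrib_left kernel_fun_def subset_iff mult_ac intro!: sum.cong)
  finally show "(\<Sum>x\<in>F. \<Sum>y\<in>F. cnj (c x) * c y * (a x * cnj (a y) * K (\<pi> x) (\<pi> y))) \<in> \<real>\<^sub>\<ge>\<^sub>0"
    using ip_self[OF v] by (metis nonneg_Reals_of_real_iff zero_le_power2)
qed

end


section \<open>The Hardy space as a reproducing kernel Hilbert space\<close>

definition ell2 :: "('i \<Rightarrow> complex) \<Rightarrow> bool"
  where "ell2 a \<longleftrightarrow> (\<lambda>i. (cmod (a i))\<^sup>2) summable_on UNIV"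

lemma ell2_prod_abs_summable:
  assumes "ell2 a" "ell2 b"
  shows "(\<lambda>i. norm (a i * b i)) summable_on UNIV"
proof (rule abs_summable_product)
  show "(\<lambda>i. norm (a i * a i)) summable_on UNIV" "(\<lambda>i. norm (b i * b i)) summable_on UNIV"
    using assms unfolding ell2_def by (simp_all add: norm_mult power2_eq_square)
qed

lemma ell2_cnj: "ell2 a \<Longrightarrow> ell2 (\<lambda>i. cnj (a i))"
  unfolding ell2_def by simp

lemma ell2_prod_summable:
  assumes "ell2 a" "ell2 b"
  shows "(\<lambda>i. a i * b i) summable_on UNIV" "(\<lambda>i. a i * cnj (b i)) summable_on UNIV"
  using ell2_prod_abs_summable[OF assms] ell2_prod_abs_summable[OF assms(1) ell2_cnj[OF assms(2)]]
  by (auto intro: abs_summable_summable)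

lemma ell2_bound:
  assumes "\<And>F. finite F \<Longrightarrow> (\<Sum>i\<in>F. (cmod (a i))\<^sup>2) \<le> B"
  shows "ell2 a" "(\<Sum>\<^sub>\<infinity>i. (cmod (a i))\<^sup>2) \<le> B"
proof -
  show "ell2 a" unfolding ell2_def
    by (rule nonneg_bounded_partial_sums_imp_summable_on[where C = B])
      (auto intro!: eventually_finite_subsets_at_top_weakI assms)
  then show "(\<Sum>\<^sub>\<infinity>i. (cmod (a i))\<^sup>2) \<le> B"
    unfolding ell2_def by (rule infsum_le_finite_sums) (auto intro: assms)
qed

lemma ell2_finite_sum_le:
  "ell2 a \<Longrightarrow> finite F \<Longrightarrow> (\<Sum>i\<in>F. (cmod (a i))\<^sup>2) \<le> (\<Sum>\<^sub>\<infinity>i. (cmod (a i))\<^sup>2)"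
  unfolding ell2_def by (rule finite_sum_le_infsum) auto

lemma ell2_zero: "ell2 (\<lambda>_. 0)"
  unfolding ell2_def by simp

lemma ell2_add: assumes "ell2 a" "ell2 b" shows "ell2 (\<lambda>i. a i + b i)"
  unfolding ell2_def
proof (rule summable_on_comparison_test)
  show "(\<lambda>i. 2 * (cmod (a i))\<^sup>2 + 2 * (cmod (b i))\<^sup>2) summable_on UNIV"
    using assms unfolding ell2_def by (intro summable_on_add summable_on_cmult_right)
  fix i
  have "(cmod (a i + b i))\<^sup>2 \<le> (cmod (a i) + cmod (b i))\<^sup>2"
    by (intro power_mono norm_triangle_ineq) auto
  also have "\<dots> \<le> 2 * (cmod (a i))\<^sup>2 + 2 * (cmod (b i))\<^sup>2"
    using sum_squares_bound[of "cmod (a i)" "cmod (b i)"] by (simp add: power2_sum)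
  finally show "(cmod (a i + b i))\<^sup>2 \<le> 2 * (cmod (a i))\<^sup>2 + 2 * (cmod (b i))\<^sup>2" .
qed auto

lemma ell2_scale: "ell2 a \<Longrightarrow> ell2 (\<lambda>i. c * a i)"
  unfolding ell2_def by (simp add: norm_mult power_mult_distrib summable_on_cmult_right)

lemma ell2_diff: "ell2 a \<Longrightarrow> ell2 b \<Longrightarrow> ell2 (\<lambda>i. a i - b i)"
  using ell2_add[OF _ ell2_scale[of b "-1"], of a] by simp

text \<open>The limit is taken entry by entry. The Cauchy bound holds for every finite partial sum,
  survives the limit in \<open>m\<close> there, and then extends to the full sum.\<close>

lemma ell2_complete:
  assumes A: "\<And>n::nat. ell2 (A n)"
    and cauchy: "\<And>e. e > 0 \<Longrightarrow> \<exists>N. \<forall>m\<ge>N. \<forall>n\<ge>N. (\<Sum>\<^sub>\<infinity>i. (cmod (A m i - A n i))\<^sup>2) < e"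
  shows "\<exists>a. ell2 a \<and> (\<lambda>n. \<Sum>\<^sub>\<infinity>i. (cmod (A n i - a i))\<^sup>2) \<longlonglongrightarrow> 0"
proof -
  have "Cauchy (\<lambda>n. A n i)" for i
  proof (rule metric_CauchyI)
    fix e :: real assume e: "e > 0"
    obtain N where N: "\<forall>m\<ge>N. \<forall>n\<ge>N. (\<Sum>\<^sub>\<infinity>i. (cmod (A m i - A n i))\<^sup>2) < e\<^sup>2"
      using cauchy[of "e\<^sup>2"] e by auto
    have "dist (A m i) (A n i) < e" if "m \<ge> N" "n \<ge> N" for m n
    proof -
      have "(cmod (A m i - A n i))\<^sup>2 < e\<^sup>2"
        using ell2_finite_sum_le[OF ell2_diff[OF A A], of "{i}" m n] N that
        by (auto intro: le_less_trans)
      then show ?thesis using e power_less_imp_less_base[of _ 2 e] by (simp add: dist_norm)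
    qed
    then show "\<exists>N. \<forall>m\<ge>N. \<forall>n\<ge>N. dist (A m i) (A n i) < e" by blast
  qed
  then have "\<forall>i. \<exists>l. (\<lambda>n. A n i) \<longlonglongrightarrow> l" using Cauchy_convergent convergent_def by blast
  then obtain a where a: "\<And>i. (\<lambda>n. A n i) \<longlonglongrightarrow> a i" by metis
  have key: "\<exists>N. \<forall>n\<ge>N. ell2 (\<lambda>i. A n i - a i) \<and> (\<Sum>\<^sub>\<infinity>i. (cmod (A n i - a i))\<^sup>2) \<le> e" if "e > 0" for e
  proof -
    obtain N where N: "\<forall>m\<ge>N. \<forall>n\<ge>N. (\<Sum>\<^sub>\<infinity>i. (cmod (A m i - A n i))\<^sup>2) < e"
      using cauchy[of e] \<open>e > 0\<close> by auto
    have "(\<Sum>i\<in>F. (cmod (A n i - a i))\<^sup>2) \<le> e" if "n \<ge> N" "finite F" for n F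
    proof (rule LIMSEQ_le_const2)
      show "(\<lambda>m. \<Sum>i\<in>F. (cmod (A n i - A m i))\<^sup>2) \<longlonglongrightarrow> (\<Sum>i\<in>F. (cmod (A n i - a i))\<^sup>2)"
        by (intro tendsto_intros a)
      have "(\<Sum>i\<in>F. (cmod (A n i - A m i))\<^sup>2) \<le> e" if "m \<ge> N" for m
        using ell2_finite_sum_le[OF ell2_diff[OF A A], of F n m] N that \<open>n \<ge> N\<close> \<open>finite F\<close>
        by (meson less_imp_le order_trans)
      then show "\<exists>M. \<forall>m\<ge>M. (\<Sum>i\<in>F. (cmod (A n i - A m i))\<^sup>2) \<le> e" by blast
    qed
    then have "ell2 (\<lambda>i. A n i - a i) \<and> (\<Sum>\<^sub>\<infinity>i. (cmod (A n i - a i))\<^sup>2) \<le> e" if "n \<ge> N" for n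
      using ell2_bound[of "\<lambda>i. A n i - a i" e] that by blast
    then show ?thesis by blast
  qed
  obtain n where "ell2 (\<lambda>i. A n i - a i)" using key[of 1] by auto
  from ell2_diff[OF A this, of n] have "ell2 (\<lambda>i. A n i - (A n i - a i))" .
  then have "ell2 a" by simp
  moreover have "(\<lambda>n. \<Sum>\<^sub>\<infinity>i. (cmod (A n i - a i))\<^sup>2) \<longlonglongrightarrow> 0"
  proof (rule LIMSEQ_I)
    fix r :: real assume "r > 0"
    then obtain N where N: "\<forall>n\<ge>N. (\<Sum>\<^sub>\<infinity>i. (cmod (A n i - a i))\<^sup>2) \<le> r / 2" using key[of "r/2"] by auto
    have "norm ((\<Sum>\<^sub>\<infinity>i. (cmod (A n i - a i))\<^sup>2) - 0) < r" if "n \<ge> N" for n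
    proof -
      have "0 \<le> (\<Sum>\<^sub>\<infinity>i. (cmod (A n i - a i))\<^sup>2)" by (rule infsum_nonneg) simp
      moreover have "(\<Sum>\<^sub>\<infinity>i. (cmod (A n i - a i))\<^sup>2) \<le> r / 2" using N that by blast
      ultimately show ?thesis using \<open>r > 0\<close> by simp
    qed
    then show "\<exists>N. \<forall>n\<ge>N. norm ((\<Sum>\<^sub>\<infinity>i. (cmod (A n i - a i))\<^sup>2) - 0) < r" by blast
  qed
  ultimately show ?thesis by blast
qed

section \<open>Double power series and their coefficients\<close>

definition mono2 :: "nat \<times> nat \<Rightarrow> complex \<times> complex \<Rightarrow> complex"
  where "mono2 i z = fst z ^ fst i * snd z ^ snd i"

lemma power_series2_iff:
  "power_series2 a f \<longleftrightarrow> (\<forall>z\<in>bidisk. ((\<lambda>i. a i * mono2 i z) has_sum f z) UNIV)"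
  unfolding power_series2_def mono2_def by (simp add: case_prod_unfold mult.assoc)

lemma has_sum_geometric:
  fixes x :: "'a :: {real_normed_field, banach}"
  assumes "norm x < 1"
  shows "((\<lambda>n. x ^ n) has_sum 1 / (1 - x)) UNIV"
  using assms geometric_sums[of x] summable_geometric[of "norm x"]
  by (intro norm_summable_imp_has_sum) (auto simp: norm_power)

lemma has_sum_geometric2:
  fixes x y :: complex
  assumes "cmod x < 1" "cmod y < 1"
  shows "((\<lambda>i. x ^ fst i * y ^ snd i) has_sum 1 / ((1 - x) * (1 - y))) UNIV"
    and "(\<lambda>i. norm (x ^ fst i * y ^ snd i)) summable_on UNIV"
proof -
  \<comment> \<open>Polymorphic in the field: the real instance yields absolute summability, the
    complex instance the value of the sum.\<close>
  have *: "((\<lambda>n. u ^ m * v ^ n) has_sum u ^ m * (1 / (1 - v))) UNIV" if "norm v < 1"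
    for u v :: "'a :: {real_normed_field, banach}" and m :: nat
    by (intro has_sum_cmult_right has_sum_geometric that)
  have **: "((\<lambda>m. u ^ m * (1 / (1 - v))) has_sum (1 / (1 - u)) * (1 / (1 - v))) UNIV" if "norm u < 1"
    for u v :: "'a :: {real_normed_field, banach}"
    by (intro has_sum_cmult_left has_sum_geometric that)
  have "(\<lambda>i. cmod x ^ fst i * cmod y ^ snd i) summable_on Sigma UNIV (\<lambda>_. UNIV)"
  proof (rule summable_on_SigmaI)
    show "((\<lambda>n. cmod x ^ fst (m, n) * cmod y ^ snd (m, n)) has_sum cmod x ^ m * (1 / (1 - cmod y))) UNIV" for m
      using *[of "cmod y" "cmod x"] assms by simp
    show "(\<lambda>m. cmod x ^ m * (1 / (1 - cmod y))) summable_on UNIV"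
      using **[of "cmod x" "cmod y"] assms unfolding summable_on_def by auto
  qed auto
  then show abs: "(\<lambda>i. norm (x ^ fst i * y ^ snd i)) summable_on UNIV" by (simp add: norm_mult norm_power)
  have "((\<lambda>i. x ^ fst i * y ^ snd i) has_sum (1 / (1 - x)) * (1 / (1 - y))) (Sigma UNIV (\<lambda>_. UNIV))"
    using *[of y x] **[of x y] assms abs_summable_summable[OF abs] by (intro has_sum_SigmaI) auto
  then show "((\<lambda>i. x ^ fst i * y ^ snd i) has_sum 1 / ((1 - x) * (1 - y))) UNIV" by simp
qed

lemma bidisk_iff: "z \<in> bidisk \<longleftrightarrow> cmod (fst z) < 1 \<and> cmod (snd z) < 1"
  by (cases z) (simp add: dist_norm)

lemma cmod_mult_less_1: "cmod a < 1 \<Longrightarrow> cmod b < 1 \<Longrightarrow> cmod (a * b) < 1"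
  using mult_strict_mono'[of "cmod a" 1 "cmod b" 1] by (simp add: norm_mult)

lemma ell2_mono2: assumes "z \<in> bidisk" shows "ell2 (\<lambda>i. mono2 i z)"
proof -
  have "cmod ((fst z)\<^sup>2) < 1" "cmod ((snd z)\<^sup>2) < 1"
    using assms cmod_mult_less_1 by (auto simp: bidisk_iff power2_eq_square)
  from has_sum_geometric2(2)[OF this]
  have "(\<lambda>i. cmod (((fst z)\<^sup>2) ^ fst i * ((snd z)\<^sup>2) ^ snd i)) summable_on UNIV" .
  then show ?thesis unfolding ell2_def mono2_def
    by (simp add: norm_mult norm_power power_mult_distrib flip: power_mult) (simp add: mult.commute)
qed

text \<open>If some coefficient of positive order were nonzero, zeros of the sum would be isolated
  at 0, although the sum vanishes on the whole disc.\<close>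

lemma powser_zero:
  fixes d :: "nat \<Rightarrow> complex"
  assumes "\<And>x. cmod x < 1 \<Longrightarrow> ((\<lambda>n. d n * x ^ n) has_sum 0) UNIV"
  shows "d n = 0"
proof (rule ccontr)
  have s: "(\<lambda>n. d n * (x - 0) ^ n) sums 0" if "norm (x - 0) < 1" for x
    using assms[of x] that has_sum_imp_sums by simp
  assume n: "d n \<noteq> 0"
  have "d 0 = 0" using s[of 0] by simp
  then have "n > 0" using n by (cases n) auto
  obtain r where r: "r > 0" "\<And>z::complex. z \<in> cball 0 r - {0} \<Longrightarrow> (0::complex) \<noteq> 0"
    using powser_0_nonzero[of 1 0 d "\<lambda>_. 0", OF _ s _ n \<open>n > 0\<close>] by auto
  have "complex_of_real r \<in> cball 0 r - {0}" using r by simp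
  then show False using r(2) by blast
qed

text \<open>One variable uniqueness is applied twice: the sums over \<open>n\<close>, for fixed
  \<open>y\<close>, are coefficients of a vanishing series in \<open>x\<close>, and each of them is
  then a vanishing series in \<open>y\<close>.\<close>

lemma power_series2_zero:
  assumes "power_series2 c (\<lambda>_. 0)"
  shows "c = (\<lambda>_. 0)"
proof -
  have s: "((\<lambda>i. c i * mono2 i (x, y)) has_sum 0) (Sigma UNIV (\<lambda>_. UNIV))" if "cmod x < 1" "cmod y < 1" for x y
    using assms that unfolding power_series2_iff by (simp add: bidisk_iff)
  have row: "(\<lambda>n. c (m, n) * y ^ n) summable_on UNIV" if "cmod y < 1" for m y
  proof -
    \<comment> \<open>Any nonzero \<open>x\<close> in the disc would do in place of
      \<open>1/2\<close>: a row of the double series is the wanted series times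
      \<open>x ^ m\<close>, which can be divided out.\<close>
    have "(\<lambda>(k, n). c (k, n) * mono2 (k, n) (1/2, y)) summable_on Sigma UNIV (\<lambda>_. UNIV)"
      using s[of "1/2" y] that unfolding summable_on_def by (auto simp: case_prod_unfold)
    from summable_on_SigmaD1[OF this, of m]
    have "(\<lambda>n. (c (m, n) * y ^ n) * (1/2) ^ m) summable_on UNIV"
      by (simp add: mono2_def mult_ac)
    then show ?thesis by (subst (asm) summable_on_cmult_left') auto
  qed
  have col: "(\<Sum>\<^sub>\<infinity>n. c (m, n) * y ^ n) = 0" if "cmod y < 1" for m y
  proof (rule powser_zero)
    fix x :: complex assume x: "cmod x < 1"
    have "((\<lambda>n. c (m, n) * mono2 (m, n) (x, y)) has_sum (\<Sum>\<^sub>\<infinity>n. c (m, n) * y ^ n) * x ^ m) UNIV" for m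
      using has_sum_cmult_left[OF has_sum_infsum[OF row[OF that]], of m "x ^ m"]
      by (simp add: mono2_def mult_ac)
    from has_sum_SigmaD[OF s[OF x that] this]
    show "((\<lambda>m. (\<Sum>\<^sub>\<infinity>n. c (m, n) * y ^ n) * x ^ m) has_sum 0) UNIV" by simp
  qed
  have "c (m, n) = 0" for m n
  proof (rule powser_zero[of "\<lambda>n. c (m, n)"])
    fix y :: complex assume "cmod y < 1"
    then show "((\<lambda>n. c (m, n) * y ^ n) has_sum 0) UNIV"
      using has_sum_infsum[OF row] col by metis
  qed
  then show ?thesis by auto
qed

lemma power_series2_add:
  "power_series2 a f \<Longrightarrow> power_series2 b g \<Longrightarrow> power_series2 (\<lambda>i. a i + b i) (\<lambda>z. f z + g z)"
  unfolding power_series2_iff by (auto simp: distrib_right intro!: has_sum_add)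

lemma power_series2_scale:
  "power_series2 a f \<Longrightarrow> power_series2 (\<lambda>i. c * a i) (\<lambda>z. c * f z)"
  unfolding power_series2_iff by (auto simp: mult.assoc intro!: has_sum_cmult_right)

lemma power_series2_cong:
  "(\<And>z. z \<in> bidisk \<Longrightarrow> f z = g z) \<Longrightarrow> power_series2 a f \<longleftrightarrow> power_series2 a g"
  unfolding power_series2_iff by simp

lemma power_series2_unique:
  assumes "power_series2 a f" "power_series2 b f"
  shows "a = b"
proof -
  have "power_series2 (\<lambda>i. a i + (-1) * b i) (\<lambda>z. f z + (-1) * f z)"
    using assms by (intro power_series2_add power_series2_scale)
  then have "(\<lambda>i. a i - b i) = (\<lambda>_. 0)" using power_series2_zero[of "\<lambda>i. a i - b i"] by simp
  then show ?thesis by (metis eq_iff_diff_eq_0 ext)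
qed

lemma coeff2_eq: "power_series2 a f \<Longrightarrow> coeff2 f = a"
  unfolding coeff2_def using power_series2_unique by (intro the_equality) auto

lemma power_series2_coeff2:
  assumes "f \<in> H2"
  shows "power_series2 (coeff2 f) f" "ell2 (coeff2 f)" "z \<notin> bidisk \<Longrightarrow> f z = 0"
proof -
  obtain a where "power_series2 a f" "ell2 a" using assms unfolding H2_def ell2_def by blast
  then show "power_series2 (coeff2 f) f" "ell2 (coeff2 f)" using coeff2_eq by auto
  show "z \<notin> bidisk \<Longrightarrow> f z = 0" using assms unfolding H2_def by blast
qed

lemma H2_I:
  assumes "\<And>z. z \<notin> bidisk \<Longrightarrow> f z = 0" "power_series2 a f" "ell2 a"
  shows "f \<in> H2"
  using assms unfolding H2_def ell2_def by blast

lemma ell2_series: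
  assumes "ell2 a"
  defines "f \<equiv> (\<lambda>z. if z \<in> bidisk then \<Sum>\<^sub>\<infinity>i. a i * mono2 i z else 0)"
  shows "f \<in> H2" "coeff2 f = a"
proof -
  have p: "power_series2 a f"
    unfolding power_series2_iff f_def using ell2_prod_summable(1)[OF assms(1) ell2_mono2] by auto
  then show "f \<in> H2" using assms by (intro H2_I) (auto simp: f_def)
  show "coeff2 f = a" using p by (rule coeff2_eq)
qed

lemma coeff2_add: "f \<in> H2 \<Longrightarrow> g \<in> H2 \<Longrightarrow> coeff2 (\<lambda>z. f z + g z) = (\<lambda>i. coeff2 f i + coeff2 g i)"
  by (intro coeff2_eq power_series2_add power_series2_coeff2)

lemma coeff2_scale: "f \<in> H2 \<Longrightarrow> coeff2 (\<lambda>z. c * f z) = (\<lambda>i. c * coeff2 f i)"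
  by (intro coeff2_eq power_series2_scale power_series2_coeff2)

lemma fun_subspace_H2: "fun_subspace H2"
  unfolding fun_subspace_def
proof (intro conjI ballI allI)
  show "(\<lambda>_. 0) \<in> H2"
    by (rule H2_I[where a = "\<lambda>_. 0"]) (auto simp: ell2_zero power_series2_iff)
next
  fix f g assume fg: "f \<in> H2" "g \<in> H2"
  show "(\<lambda>z. f z + g z) \<in> H2"
    by (rule H2_I[OF _ power_series2_add ell2_add, of _ _ "coeff2 f" "coeff2 g"])
      (use power_series2_coeff2[OF fg(1)] power_series2_coeff2[OF fg(2)] in \<open>simp_all del: mem_Times_iff\<close>)
next
  fix c f assume f: "f \<in> H2"
  show "(\<lambda>z. c * f z) \<in> H2"
    by (rule H2_I[OF _ power_series2_scale ell2_scale, of _ _ "coeff2 f"])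
      (use power_series2_coeff2[OF f] in \<open>simp_all del: mem_Times_iff\<close>)
qed

lemma coeff2_diff:
  assumes "f \<in> H2" "g \<in> H2"
  shows "coeff2 (\<lambda>z. f z - g z) = (\<lambda>i. coeff2 f i - coeff2 g i)"
  using coeff2_add[OF assms(1) fun_subspace_scale[OF fun_subspace_H2 assms(2)], of "-1"]
    coeff2_scale[OF assms(2), of "-1"] by simp

lemma H2_inner_self: assumes "f \<in> H2" shows "H2_inner f f = of_real (\<Sum>\<^sub>\<infinity>i. (cmod (coeff2 f i))\<^sup>2)"
proof -
  have "coeff2 f i * cnj (coeff2 f i) = of_real ((cmod (coeff2 f i))\<^sup>2)" for i
    by (simp only: complex_norm_square)
  moreover have "((\<lambda>i. (cmod (coeff2 f i))\<^sup>2) has_sum (\<Sum>\<^sub>\<infinity>i. (cmod (coeff2 f i))\<^sup>2)) UNIV"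
    using power_series2_coeff2(2)[OF assms] unfolding ell2_def by (rule has_sum_infsum)
  ultimately show ?thesis unfolding H2_inner_def by (simp only: infsumI[OF has_sum_of_real])
qed

lemma H2_norm: "f \<in> H2 \<Longrightarrow> ip_norm H2_inner f = sqrt (\<Sum>\<^sub>\<infinity>i. (cmod (coeff2 f i))\<^sup>2)"
  unfolding ip_norm_def by (simp add: H2_inner_self)

section \<open>The Szego kernel and the Hilbert space structure of \<open>H2\<close>\<close>

definition szego :: "complex \<times> complex \<Rightarrow> complex \<times> complex \<Rightarrow> complex"
  where "szego z w = 1 / ((1 - fst z * cnj (fst w)) * (1 - snd z * cnj (snd w)))"

lemma power_series2_szego:
  assumes "w \<in> bidisk"
  shows "power_series2 (\<lambda>i. cnj (mono2 i w)) (\<lambda>z. if z \<in> bidisk then szego z w else 0)"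
  unfolding power_series2_iff
proof
  fix z :: "complex \<times> complex" assume z: "z \<in> bidisk"
  have "((\<lambda>i. (fst z * cnj (fst w)) ^ fst i * (snd z * cnj (snd w)) ^ snd i) has_sum szego z w) UNIV"
    unfolding szego_def using z assms
    by (intro has_sum_geometric2(1) cmod_mult_less_1) (auto simp: bidisk_iff)
  then show "((\<lambda>i. cnj (mono2 i w) * mono2 i z) has_sum (if z \<in> bidisk then szego z w else 0)) UNIV"
    using z by (simp add: mono2_def power_mult_distrib mult_ac)
qed

text \<open>Completeness is carried over from square summable families through
  \<open>coeff2\<close>, and evaluation at \<open>w\<close> is the pairing with the coefficients
  \<open>cnj (mono2 i w)\<close> of the kernel.\<close>

interpretation H2: rkhs bidisk H2 H2_inner szego
proof
  show "f x = 0" if "f \<in> H2" "x \<notin> bidisk" for f x using that power_series2_coeff2 by blast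
  show "fun_subspace H2" by (rule fun_subspace_H2)
  fix f g h :: "complex \<times> complex \<Rightarrow> complex" and c
  assume f: "f \<in> H2" and g: "g \<in> H2"
  note e = power_series2_coeff2(2)
  show "H2_inner (\<lambda>x. f x + g x) h = H2_inner f h + H2_inner g h" if "h \<in> H2"
    unfolding H2_inner_def coeff2_add[OF f g] distrib_right
    by (intro infsum_add ell2_prod_summable e f g that)
  show "H2_inner (\<lambda>x. c * f x) g = c * H2_inner f g"
    unfolding H2_inner_def coeff2_scale[OF f] mult.assoc
    by (rule infsum_cmult_right) (intro ell2_prod_summable e f g)
  show "H2_inner g f = cnj (H2_inner f g)"
    unfolding H2_inner_def by (simp add: mult.commute flip: infsum_cnj)
next
  fix f assume f: "f \<in> H2" "f \<noteq> (\<lambda>_. 0)"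
  have "coeff2 f \<noteq> (\<lambda>_. 0)"
  proof
    assume "coeff2 f = (\<lambda>_. 0)"
    then have "f z = 0" if "z \<in> bidisk" for z
      using power_series2_coeff2(1)[OF f(1)] that unfolding power_series2_iff
      by (metis (no_types, lifting) has_sum_0 has_sum_unique mult_zero_left)
    then show False using f power_series2_coeff2(3)[OF f(1)] by blast
  qed
  then obtain i where "coeff2 f i \<noteq> 0" by (meson ext)
  then have "0 < (cmod (coeff2 f i))\<^sup>2" by simp
  also have "\<dots> \<le> (\<Sum>\<^sub>\<infinity>i. (cmod (coeff2 f i))\<^sup>2)"
    using ell2_finite_sum_le[OF power_series2_coeff2(2)[OF f(1)], of "{i}"] by simp
  finally show "0 < Re (H2_inner f f)" by (simp add: H2_inner_self[OF f(1)])
next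
  fix F :: "nat \<Rightarrow> _" assume F: "\<And>n. F n \<in> H2"
    "\<And>e. 0 < e \<Longrightarrow> \<exists>N. \<forall>m\<ge>N. \<forall>n\<ge>N. ip_norm H2_inner (\<lambda>x. F m x - F n x) < e"
  have "\<exists>a. ell2 a \<and> (\<lambda>n. \<Sum>\<^sub>\<infinity>i. (cmod (coeff2 (F n) i - a i))\<^sup>2) \<longlonglongrightarrow> 0"
  proof (rule ell2_complete)
    fix e :: real assume "e > 0"
    then obtain N where "\<forall>m\<ge>N. \<forall>n\<ge>N. ip_norm H2_inner (\<lambda>x. F m x - F n x) < sqrt e"
      using F(2)[of "sqrt e"] by auto
    then show "\<exists>N. \<forall>m\<ge>N. \<forall>n\<ge>N. (\<Sum>\<^sub>\<infinity>i. (cmod (coeff2 (F m) i - coeff2 (F n) i))\<^sup>2) < e"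
      by (simp add: H2_norm fun_subspace_diff[OF fun_subspace_H2] coeff2_diff F) blast
  qed (use power_series2_coeff2 F in auto)
  then obtain a where a: "ell2 a" "(\<lambda>n. \<Sum>\<^sub>\<infinity>i. (cmod (coeff2 (F n) i - a i))\<^sup>2) \<longlonglongrightarrow> 0" by blast
  let ?f = "\<lambda>z. if z \<in> bidisk then \<Sum>\<^sub>\<infinity>i. a i * mono2 i z else 0"
  have "(\<lambda>n. sqrt (\<Sum>\<^sub>\<infinity>i. (cmod (coeff2 (F n) i - a i))\<^sup>2)) \<longlonglongrightarrow> sqrt 0"
    by (intro tendsto_real_sqrt a)
  then have "(\<lambda>n. ip_norm H2_inner (\<lambda>x. F n x - ?f x)) \<longlonglongrightarrow> 0"
    by (simp add: H2_norm[OF fun_subspace_diff[OF fun_subspace_H2 F(1) ell2_series(1)[OF a(1)]]]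
        coeff2_diff[OF F(1) ell2_series(1)[OF a(1)]] ell2_series(2)[OF a(1)] del: mem_Times_iff)
  then show "\<exists>f\<in>H2. (\<lambda>n. ip_norm H2_inner (\<lambda>x. F n x - f x)) \<longlonglongrightarrow> 0"
    by (rule bexI[OF _ ell2_series(1)[OF a(1)]])
next
  fix w :: "complex \<times> complex" assume w: "w \<in> bidisk"
  show mem: "(\<lambda>z. if z \<in> bidisk then szego z w else 0) \<in> H2"
    by (rule H2_I[OF _ power_series2_szego[OF w] ell2_cnj[OF ell2_mono2[OF w]]]) simp
  fix f assume f: "f \<in> H2"
  have "((\<lambda>i. coeff2 f i * mono2 i w) has_sum f w) UNIV"
    using power_series2_coeff2(1)[OF f] w unfolding power_series2_iff by blast
  then show "H2_inner f (\<lambda>z. if z \<in> bidisk then szego z w else 0) = f w"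
    unfolding H2_inner_def coeff2_eq[OF power_series2_szego[OF w]] by (simp add: infsumI)
qed


section \<open>Coordinate shifts\<close>

text \<open>Keeping the coordinate function as a parameter lets every shift lemma serve both
  variables, in the same encoding as \<open>comp_shift\<close>.\<close>

definition coord :: "(complex \<times> complex \<Rightarrow> complex) \<Rightarrow> bool"
  where "coord p \<longleftrightarrow> p = fst \<or> p = snd"

definition coord_zero :: "(complex \<times> complex \<Rightarrow> complex) \<Rightarrow> complex \<times> complex \<Rightarrow> complex \<times> complex"
  where "coord_zero p z = (if p = fst then (0, snd z) else (fst z, 0))"

definition coord_shift :: "(complex \<times> complex \<Rightarrow> complex) \<Rightarrow> nat \<times> nat \<Rightarrow> nat \<times> nat"
  where "coord_shift p i = (if p = fst then (Suc (fst i), snd i) else (fst i, Suc (snd i)))"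

text \<open>The backward shift in the variable \<open>p\<close>, the adjoint of multiplication by
  \<open>p\<close> on \<open>H2\<close>. Coefficients are used because the quotient
  \<open>(f z - f (coord_zero p z)) / p z\<close> has no value where \<open>p z = 0\<close>.\<close>

definition bshift ::
    "(complex \<times> complex \<Rightarrow> complex) \<Rightarrow> (complex \<times> complex \<Rightarrow> complex) \<Rightarrow> complex \<times> complex \<Rightarrow> complex"
  where "bshift p f = (\<lambda>z. if z \<in> bidisk then \<Sum>\<^sub>\<infinity>i. coeff2 f (coord_shift p i) * mono2 i z else 0)"

definition coord_indep :: "(complex \<times> complex \<Rightarrow> complex) \<Rightarrow> (complex \<times> complex \<Rightarrow> complex) \<Rightarrow> bool"
  where "coord_indep p f \<longleftrightarrow> (\<forall>z\<in>bidisk. f z = f (coord_zero p z))"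

lemma fst_neq_snd: "(fst :: complex \<times> complex \<Rightarrow> complex) \<noteq> snd"
  by (metis fst_conv snd_conv zero_neq_one)

lemma inj_coord_shift: "inj (coord_shift p)"
  by (rule injI) (auto simp: coord_shift_def split: if_splits)

lemma mono2_coord_shift: "coord p \<Longrightarrow> mono2 (coord_shift p i) z = p z * mono2 i z"
  using fst_neq_snd by (auto simp: coord_def coord_shift_def mono2_def)

lemma coord_coord_zero [simp]: "coord p \<Longrightarrow> p (coord_zero p z) = 0"
  using fst_neq_snd by (auto simp: coord_def coord_zero_def)

lemma coord_zero_bidisk [simp]: "z \<in> bidisk \<Longrightarrow> coord_zero p z \<in> bidisk"
  by (auto simp: bidisk_iff coord_zero_def)

lemma mono2_coord_zero:
  assumes "coord p" "i \<notin> range (coord_shift p)"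
  shows "mono2 i (coord_zero p z) = mono2 i z"
proof (cases "p = fst")
  case True
  have "fst i = 0"
  proof (rule ccontr)
    assume "fst i \<noteq> 0"
    then have "i = coord_shift p (fst i - 1, snd i)" using True by (simp add: coord_shift_def)
    then show False using assms by blast
  qed
  then show ?thesis using True by (simp add: mono2_def coord_zero_def)
next
  case False
  have "snd i = 0"
  proof (rule ccontr)
    assume "snd i \<noteq> 0"
    then have "i = coord_shift p (fst i, snd i - 1)" using False by (simp add: coord_shift_def)
    then show False using assms by blast
  qed
  then show ?thesis using False by (simp add: mono2_def coord_zero_def)
qed

lemma has_sum_range:
  assumes "inj e" "\<And>i. i \<notin> range e \<Longrightarrow> f i = 0"
  shows "(f has_sum s) UNIV \<longleftrightarrow> ((\<lambda>i. f (e i)) has_sum s) UNIV"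
proof -
  have "(f has_sum s) UNIV \<longleftrightarrow> (f has_sum s) (range e)"
    by (rule has_sum_cong_neutral) (use assms in auto)
  also have "\<dots> \<longleftrightarrow> ((f \<circ> e) has_sum s) UNIV" by (rule has_sum_reindex[OF assms(1)])
  finally show ?thesis by (simp add: o_def)
qed

lemma power_series2_mult_coord:
  assumes p: "coord p" and a: "power_series2 a f"
  shows "power_series2 (\<lambda>i. if i \<in> range (coord_shift p) then a (inv (coord_shift p) i) else 0) (\<lambda>z. p z * f z)"
  unfolding power_series2_iff
proof
  fix z :: "complex \<times> complex" assume z: "z \<in> bidisk"
  have "((\<lambda>i. a i * mono2 i z) has_sum f z) UNIV" using a z unfolding power_series2_iff by blast
  then have "((\<lambda>i. p z * (a i * mono2 i z)) has_sum p z * f z) UNIV" by (rule has_sum_cmult_right)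
  then show "((\<lambda>i. (if i \<in> range (coord_shift p) then a (inv (coord_shift p) i) else 0) * mono2 i z)
      has_sum p z * f z) UNIV"
    by (subst has_sum_range[OF inj_coord_shift[of p]])
      (auto simp: mono2_coord_shift[OF p] inv_f_f[OF inj_coord_shift] mult_ac)
qed

lemma ell2_range:
  assumes "inj e" "ell2 a"
  shows "ell2 (\<lambda>i. if i \<in> range e then a (inv e i) else 0)"
proof -
  have "((\<lambda>i. (cmod (a i))\<^sup>2) has_sum (\<Sum>\<^sub>\<infinity>i. (cmod (a i))\<^sup>2)) UNIV"
    using assms(2) unfolding ell2_def by (rule has_sum_infsum)
  then have "((\<lambda>i. (cmod (if i \<in> range e then a (inv e i) else 0))\<^sup>2) has_sum (\<Sum>\<^sub>\<infinity>i. (cmod (a i))\<^sup>2)) UNIV"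
    by (subst has_sum_range[OF assms(1)]) (auto simp: inv_f_f[OF assms(1)])
  then show ?thesis unfolding ell2_def summable_on_def by blast
qed

lemma ell2_reindex:
  assumes "inj e" "ell2 a"
  shows "ell2 (\<lambda>i. a (e i))"
proof -
  have "(\<lambda>i. (cmod (a i))\<^sup>2) summable_on range e"
    using assms(2) unfolding ell2_def by (rule summable_on_subset_banach) auto
  then show ?thesis unfolding ell2_def by (subst (asm) summable_on_reindex[OF assms(1)]) (simp add: o_def)
qed

lemma coeff2_mult_coord:
  assumes "coord p" "f \<in> H2"
  shows "coeff2 (\<lambda>z. p z * f z) = (\<lambda>i. if i \<in> range (coord_shift p) then coeff2 f (inv (coord_shift p) i) else 0)"
  by (rule coeff2_eq[OF power_series2_mult_coord[OF assms(1) power_series2_coeff2(1)[OF assms(2)]]])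

lemma mult_coord_mem:
  assumes "coord p" "f \<in> H2"
  shows "(\<lambda>z. p z * f z) \<in> H2"
proof (rule H2_I[OF _ power_series2_mult_coord[OF assms(1) power_series2_coeff2(1)[OF assms(2)]]])
  show "ell2 (\<lambda>i. if i \<in> range (coord_shift p) then coeff2 f (inv (coord_shift p) i) else 0)"
    by (rule ell2_range[OF inj_coord_shift power_series2_coeff2(2)[OF assms(2)]])
qed (use power_series2_coeff2(3)[OF assms(2)] in simp)

lemma bshift_mem: assumes "f \<in> H2" shows "bshift p f \<in> H2"
  unfolding bshift_def
  by (intro ell2_series ell2_reindex[OF inj_coord_shift] power_series2_coeff2 assms)

lemma coeff2_bshift: "f \<in> H2 \<Longrightarrow> coeff2 (bshift p f) = (\<lambda>i. coeff2 f (coord_shift p i))"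
  unfolding bshift_def
  by (intro ell2_series ell2_reindex[OF inj_coord_shift] power_series2_coeff2)

lemma bshift_adjoint:
  assumes p: "coord p" and f: "f \<in> H2" and g: "g \<in> H2"
  shows "H2_inner (\<lambda>z. p z * g z) f = H2_inner g (bshift p f)"
proof -
  have "((\<lambda>i. coeff2 g i * cnj (coeff2 f (coord_shift p i))) has_sum H2_inner g (bshift p f)) UNIV"
    unfolding H2_inner_def coeff2_bshift[OF f]
    by (intro has_sum_infsum ell2_prod_summable ell2_reindex[OF inj_coord_shift] power_series2_coeff2 f g)
  then have "((\<lambda>i. coeff2 (\<lambda>z. p z * g z) i * cnj (coeff2 f i)) has_sum H2_inner g (bshift p f)) UNIV"
    by (subst has_sum_range[OF inj_coord_shift[of p]])
      (auto simp: coeff2_mult_coord[OF p g] inv_f_f[OF inj_coord_shift])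
  then show ?thesis by (subst H2_inner_def) (rule infsumI)
qed

lemma mult_coord_isometry:
  assumes p: "coord p" and f: "f \<in> H2" and g: "g \<in> H2"
  shows "H2_inner (\<lambda>z. p z * f z) (\<lambda>z. p z * g z) = H2_inner f g"
proof -
  have "((\<lambda>i. coeff2 f i * cnj (coeff2 g i)) has_sum H2_inner f g) UNIV"
    unfolding H2_inner_def by (intro has_sum_infsum ell2_prod_summable power_series2_coeff2 f g)
  then have "((\<lambda>i. coeff2 (\<lambda>z. p z * f z) i * cnj (coeff2 (\<lambda>z. p z * g z) i)) has_sum H2_inner f g) UNIV"
    by (subst has_sum_range[OF inj_coord_shift[of p]])
      (auto simp: coeff2_mult_coord[OF p f] coeff2_mult_coord[OF p g] inv_f_f[OF inj_coord_shift])
  then show ?thesis by (subst H2_inner_def) (rule infsumI)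
qed

text \<open>The series splits according to whether an index lies in the range of
  \<open>coord_shift p\<close>: the indices inside carry a factor \<open>p z\<close>, those outside
  make up the slice \<open>p = 0\<close>.\<close>

lemma bshift_decomp:
  assumes p: "coord p" and f: "f \<in> H2" and z: "z \<in> bidisk"
  shows "f z = f (coord_zero p z) + p z * bshift p f z"
proof -
  let ?R = "range (coord_shift p)"
  have fs: "((\<lambda>i. coeff2 f i * mono2 i w) has_sum f w) UNIV" if "w \<in> bidisk" for w
    using power_series2_coeff2(1)[OF f] that unfolding power_series2_iff by blast
  have "((\<lambda>i. coeff2 f (coord_shift p i) * mono2 i z) has_sum bshift p f z) UNIV"
    using power_series2_coeff2(1)[OF bshift_mem[OF f]] z
    unfolding power_series2_iff coeff2_bshift[OF f] by blast
  then have "((\<lambda>i. p z * (coeff2 f (coord_shift p i) * mono2 i z)) has_sum p z * bshift p f z) UNIV"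
    by (rule has_sum_cmult_right)
  then have 1: "((\<lambda>i. if i \<in> ?R then coeff2 f i * mono2 i z else 0) has_sum p z * bshift p f z) UNIV"
    by (subst has_sum_range[OF inj_coord_shift[of p]]) (auto simp: mono2_coord_shift[OF p] mult_ac)
  have "((\<lambda>i. coeff2 f i * mono2 i (coord_zero p z) + (if i \<in> ?R then coeff2 f i * mono2 i z else 0))
      has_sum f (coord_zero p z) + p z * bshift p f z) UNIV"
    by (intro has_sum_add 1 fs coord_zero_bidisk z)
  moreover have "coeff2 f i * mono2 i (coord_zero p z) + (if i \<in> ?R then coeff2 f i * mono2 i z else 0)
      = coeff2 f i * mono2 i z" for i
    using mono2_coord_zero[OF p] by (auto simp: mono2_coord_shift[OF p] p)
  ultimately have "((\<lambda>i. coeff2 f i * mono2 i z) has_sum f (coord_zero p z) + p z * bshift p f z) UNIV" by simp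
  then show ?thesis using fs[OF z] has_sum_unique by blast
qed

lemma bshift_eq_0_iff:
  assumes p: "coord p" and f: "f \<in> H2"
  shows "bshift p f = (\<lambda>_. 0) \<longleftrightarrow> coord_indep p f"
proof
  assume "bshift p f = (\<lambda>_. 0)"
  then show "coord_indep p f" using bshift_decomp[OF p f] unfolding coord_indep_def by auto
next
  assume i: "coord_indep p f"
  have "p z * bshift p f z = 0" for z
  proof (cases "z \<in> bidisk")
    case True
    then show ?thesis using i bshift_decomp[OF p f True] unfolding coord_indep_def by fastforce
  next
    case False
    then show ?thesis unfolding bshift_def by (simp only: if_False mult_zero_right)
  qed
  then have "(\<lambda>z. p z * bshift p f z) = (\<lambda>_. 0)" by (rule ext)
  \<comment> \<open>The factor \<open>p\<close> is removed by the isometry instead of division,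
    which would fail at the zeros of \<open>p\<close>.\<close>
  then have "H2_inner (bshift p f) (bshift p f) = 0"
    using mult_coord_isometry[OF p bshift_mem bshift_mem, OF f f, of p p] H2.ip_zero[OF H2.zero_mem] by simp
  then show "bshift p f = (\<lambda>_. 0)" by (rule H2.ip_self_eq_0[OF bshift_mem[OF f]])
qed

lemma coord_indep_orth:
  assumes "coord p" "u \<in> H2" "coord_indep p u" "f \<in> H2"
  shows "H2_inner (\<lambda>z. p z * f z) u = 0"
proof -
  have "bshift p u = (\<lambda>_. 0)" using bshift_eq_0_iff assms by blast
  then show ?thesis using bshift_adjoint[OF assms(1,2,4)] H2.ip_zero_right[OF assms(4)] by simp
qed

text \<open>Multiplications by \<open>p\<close> and \<open>q\<close> commute, hence so do their
  adjoints. The norm of \<open>bshift p (bshift q f)\<close> is computed by moving both shifts to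
  the other side and exchanging them.\<close>

lemma bshift_coord_indep:
  assumes p: "coord p" and q: "coord q" and f: "f \<in> H2" "coord_indep p f"
  shows "coord_indep p (bshift q f)"
proof -
  let ?u = "bshift p (bshift q f)"
  have b: "bshift q f \<in> H2" "?u \<in> H2" using bshift_mem f by auto
  have "H2_inner ?u ?u = H2_inner (\<lambda>z. q z * (p z * ?u z)) f"
    using bshift_adjoint[OF p b(1) b(2)] bshift_adjoint[OF q f(1) mult_coord_mem[OF p b(2)]] by simp
  also have "\<dots> = H2_inner (\<lambda>z. p z * (q z * ?u z)) f" by (simp add: mult_ac)
  also have "\<dots> = 0" using coord_indep_orth[OF p f mult_coord_mem[OF q b(2)]] by simp
  finally have "?u = (\<lambda>_. 0)" by (rule H2.ip_self_eq_0[OF b(2)])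
  then show ?thesis using bshift_eq_0_iff[OF p b(1)] by blast
qed

text \<open>By \<open>bshift_decomp\<close> the slice equals \<open>f\<close> minus \<open>p\<close>
  times the backward shift, so no new series has to be summed.\<close>

lemma slice_mem:
  assumes p: "coord p" and f: "f \<in> H2"
  shows "(\<lambda>z. if z \<in> bidisk then f (coord_zero p z) else 0) \<in> H2"
proof -
  have "(\<lambda>z. f z - p z * bshift p f z) \<in> H2"
    by (intro H2.diff_mem f mult_coord_mem p bshift_mem)
  moreover have "(\<lambda>z. f z - p z * bshift p f z) = (\<lambda>z. if z \<in> bidisk then f (coord_zero p z) else 0)"
  proof
    fix z
    show "f z - p z * bshift p f z = (if z \<in> bidisk then f (coord_zero p z) else 0)"
    proof (cases "z \<in> bidisk")
      case True
      then show ?thesis using bshift_decomp[OF p f True] by auto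
    next
      case False
      then show ?thesis using power_series2_coeff2(3)[OF f False] power_series2_coeff2(3)[OF bshift_mem[OF f] False]
        by (simp only: if_False mult_zero_right diff_self)
    qed
  qed
  ultimately show ?thesis by simp
qed

lemma coeff2_eq_0:
  assumes "f \<in> H2" "\<And>i. coeff2 f i = 0"
  shows "f = (\<lambda>_. 0)"
proof -
  have "H2_inner f f = 0" unfolding H2_inner_self[OF assms(1)] by (simp add: assms(2))
  then show ?thesis by (rule H2.ip_self_eq_0[OF assms(1)])
qed

section \<open>Monomials as a total family\<close>

definition mono_fun :: "nat \<times> nat \<Rightarrow> complex \<times> complex \<Rightarrow> complex"
  where "mono_fun i = (\<lambda>z. if z \<in> bidisk then mono2 i z else 0)"

lemma mono_fun:
  shows mono_fun_mem: "mono_fun i \<in> H2"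
    and H2_inner_mono_fun: "u \<in> H2 \<Longrightarrow> H2_inner u (mono_fun i) = coeff2 u i"
proof -
  have ps: "power_series2 (\<lambda>j. if j = i then 1 else 0) (mono_fun i)"
    unfolding power_series2_iff
  proof
    fix z :: "complex \<times> complex" assume "z \<in> bidisk"
    then have "((\<lambda>j. (if j = i then 1 else 0) * mono2 j z) has_sum mono_fun i z) {i}"
      by (intro has_sum_finiteI) (auto simp: mono_fun_def)
    then show "((\<lambda>j. (if j = i then 1 else 0) * mono2 j z) has_sum mono_fun i z) UNIV"
      by (subst (asm) has_sum_cong_neutral[where T = UNIV]) auto
  qed
  have e: "ell2 (\<lambda>j. if j = i then 1 else 0)"
    unfolding ell2_def by (rule summable_on_cong_neutral[THEN iffD1, OF _ _ _ summable_on_finite[of "{i}"]]) auto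
  show "mono_fun i \<in> H2" by (rule H2_I[OF _ ps e]) (simp only: mono_fun_def if_False)
  assume "u \<in> H2"
  have "((\<lambda>j. coeff2 u j * cnj (if j = i then 1 else 0)) has_sum coeff2 u i) {i}"
    by (intro has_sum_finiteI) auto
  then have "((\<lambda>j. coeff2 u j * cnj (if j = i then 1 else 0)) has_sum coeff2 u i) UNIV"
    by (subst (asm) has_sum_cong_neutral[where T = UNIV]) auto
  then show "H2_inner u (mono_fun i) = coeff2 u i"
    unfolding H2_inner_def coeff2_eq[OF ps] by (rule infsumI)
qed

lemma mono_fun_coord_shift: "coord p \<Longrightarrow> mono_fun (coord_shift p i) = (\<lambda>z. p z * mono_fun i z)"
  by (auto simp: mono_fun_def mono2_coord_shift)

text \<open>Every monomial is reached from the constant function by coordinate multiplications, so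
  shift invariance is all that an argument about monomials needs.\<close>

lemma mono_fun_induct:
  assumes "P (mono_fun (0, 0))" "\<And>p f. coord p \<Longrightarrow> f \<in> H2 \<Longrightarrow> P f \<Longrightarrow> P (\<lambda>z. p z * f z)"
  shows "P (mono_fun i)"
proof -
  have 1: "P (mono_fun (m, 0))" for m
  proof (induction m)
    case (Suc m)
    then show ?case
      using assms(2)[OF _ mono_fun_mem Suc, of fst] mono_fun_coord_shift[of fst "(m, 0)"]
      by (simp add: coord_def coord_shift_def)
  qed (rule assms(1))
  have "P (mono_fun (m, n))" for m n
  proof (induction n)
    case (Suc n)
    then show ?case
      using assms(2)[OF _ mono_fun_mem Suc, of snd] mono_fun_coord_shift[of snd "(m, n)"] fst_neq_snd
      by (simp add: coord_def coord_shift_def)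
  qed (rule 1)
  then show ?thesis by (cases i) simp
qed

text \<open>Pairing with monomials reads off coefficients. Together with
  \<open>closed_sub_ip_eq\<close> this extends identities from monomials to all of
  \<open>H2\<close>.\<close>

lemma mono_fun_total:
  assumes "H2.closed_sub M" "\<And>i. mono_fun i \<in> M"
  shows "M = H2"
proof (rule H2.closed_sub_eq_H[OF assms(1)])
  fix u assume "u \<in> H2" "\<And>h. h \<in> M \<Longrightarrow> H2_inner u h = 0"
  then show "u = (\<lambda>_. 0)" using assms(2) H2_inner_mono_fun by (intro coeff2_eq_0) metis+
qed


section \<open>Parseval's identity and inner multipliers\<close>

text \<open>Polarization with \<open>c\<close> equal to 1, -1, \<open>\<i>\<close> and
  \<open>-\<i>\<close>. Two different spaces are allowed because an abstractly given reproducing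
  kernel space has to be compared with \<open>H2\<close>.\<close>

lemma ip_eq_of_norm_eq:
  assumes "rkhs X H ip K" "rkhs X' H' ip' K'" "f \<in> H" "g \<in> H" "f' \<in> H'" "g' \<in> H'"
    and eq: "\<And>c. ip_norm ip (\<lambda>x. f x - c * g x) = ip_norm ip' (\<lambda>x. f' x - c * g' x)"
  shows "ip f g = ip' f' g'"
proof -
  interpret A: rkhs X H ip K by fact
  interpret B: rkhs X' H' ip' K' by fact
  have e: "(ip_norm ip f)\<^sup>2 - 2 * Re (cnj c * ip f g) + (cmod c)\<^sup>2 * (ip_norm ip g)\<^sup>2
      = (ip_norm ip' f')\<^sup>2 - 2 * Re (cnj c * ip' f' g') + (cmod c)\<^sup>2 * (ip_norm ip' g')\<^sup>2" for c
    using A.nrm_diff_sq[OF assms(3,4), of c] B.nrm_diff_sq[OF assms(5,6), of c] eq[of c] by simp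
  show ?thesis using e[of 1] e[of "-1"] e[of \<i>] e[of "-\<i>"] by (auto simp: complex_eq_iff)
qed

lemma power_series2D:
  "power_series2 a f \<Longrightarrow> z \<in> bidisk \<Longrightarrow> ((\<lambda>i. a i * mono2 i z) has_sum f z) UNIV"
  unfolding power_series2_iff by (rule bspec)

section \<open>Integral means over tori and Parseval's identity\<close>

abbreviation torus_param :: "(real \<times> real) set"
  where "torus_param \<equiv> {0..2 * pi} \<times> {0..2 * pi}"

definition torus_pt :: "real \<Rightarrow> real \<times> real \<Rightarrow> complex \<times> complex"
  where "torus_pt r t = (of_real r * cis (fst t), of_real r * cis (snd t))"

text \<open>The integral is not normalized, whence the area \<open>4 * pi\<^sup>2\<close> in every
  comparison with the norm of \<open>H2\<close>.\<close>

definition torus_int :: "real \<Rightarrow> (complex \<times> complex \<Rightarrow> complex) \<Rightarrow> real"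
  where "torus_int r f = (LINT t|lebesgue_on torus_param. (cmod (f (torus_pt r t)))\<^sup>2)"

lemma torus_param_cbox: "torus_param = cbox (0, 0) (2 * pi, 2 * pi)"
  by (simp add: cbox_Pair_eq)

lemma torus_pt_bidisk: "0 \<le> r \<Longrightarrow> r < 1 \<Longrightarrow> torus_pt r t \<in> bidisk"
  by (simp add: bidisk_iff torus_pt_def norm_mult)

lemma integral_cis:
  fixes k :: int
  shows "integral {0..2 * pi} (\<lambda>x. cis (of_int k * x)) = (if k = 0 then of_real (2 * pi) else 0)"
proof (cases "k = 0")
  case False
  have "((\<lambda>x. cis (of_int k * x)) has_integral
      cis (of_int k * (2 * pi)) / (\<i> * of_int k) - cis (of_int k * 0) / (\<i> * of_int k)) {0..2 * pi}"
  proof (rule fundamental_theorem_of_calculus)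
    fix x :: real
    have "((\<lambda>x. exp (\<i> * of_int k * of_real x) / (\<i> * of_int k)) has_vector_derivative
        exp (\<i> * of_int k * of_real x)) (at x within {0..2 * pi})"
      using False by (auto intro!: derivative_eq_intros has_vector_derivative_real_field)
    then show "((\<lambda>x. cis (of_int k * x) / (\<i> * of_int k)) has_vector_derivative cis (of_int k * x))
        (at x within {0..2 * pi})"
      by (simp add: cis_conv_exp mult_ac)
  qed simp
  moreover have "cis (of_int k * (2 * pi)) = 1"
    using cis_multiple_2pi[of "of_int k"] by (simp add: mult_ac)
  ultimately show ?thesis using False by (simp add: integral_unique)
qed (simp add: scaleR_conv_of_real)

lemma lebesgue_integral_torus:
  fixes g :: "real \<times> real \<Rightarrow> complex"
  assumes "continuous_on UNIV g"
  shows "integrable (lebesgue_on torus_param) g"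
    and "integral\<^sup>L (lebesgue_on torus_param) g
      = integral {0..2 * pi} (\<lambda>x. integral {0..2 * pi} (\<lambda>y. g (x, y)))"
proof -
  have c: "continuous_on (cbox (0, 0) (2 * pi, 2 * pi)) g" using assms continuous_on_subset by blast
  show i: "integrable (lebesgue_on torus_param) g"
    unfolding torus_param_cbox by (rule continuous_imp_integrable[OF c])
  have "integral\<^sup>L (lebesgue_on torus_param) g = integral torus_param g"
    by (rule lebesgue_integral_eq_integral[OF i]) (simp add: torus_param_cbox del: cbox_Pair_eq)
  also have "\<dots> = integral {0..2 * pi} (\<lambda>x. integral {0..2 * pi} (\<lambda>y. g (x, y)))"
    unfolding torus_param_cbox using integral_prod_continuous[OF c] by simp
  finally show "integral\<^sup>L (lebesgue_on torus_param) g
      = integral {0..2 * pi} (\<lambda>x. integral {0..2 * pi} (\<lambda>y. g (x, y)))" .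
qed

definition torus_char :: "nat \<times> nat \<Rightarrow> real \<times> real \<Rightarrow> complex"
  where "torus_char i t = cis (real (fst i) * fst t) * cis (real (snd i) * snd t)"

lemma continuous_torus_char: "continuous_on UNIV (torus_char i)"
  unfolding torus_char_def by (intro continuous_intros)

lemma norm_torus_char [simp]: "cmod (torus_char i t) = 1"
  by (simp add: torus_char_def norm_mult)

lemma mono2_torus_pt: "mono2 i (torus_pt r t) = of_real (r ^ (fst i + snd i)) * torus_char i t"
proof -
  have "(of_real r * cis a) ^ n = of_real (r ^ n) * cis (real n * a)" for a n
    unfolding power_mult_distrib of_real_power Complex.DeMoivre ..
  note * = this
  show ?thesis
    unfolding mono2_def torus_pt_def torus_char_def fst_conv snd_conv * by (simp only: power_add of_real_mult mult_ac)
qed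

lemma torus_char_orth:
  "integral\<^sup>L (lebesgue_on torus_param) (\<lambda>t. torus_char i t * cnj (torus_char j t))
    = (if i = j then of_real (4 * pi\<^sup>2) else 0)"
proof -
  let ?k = "int (fst i) - int (fst j)" and ?l = "int (snd i) - int (snd j)"
  have e: "torus_char i t * cnj (torus_char j t) = cis (of_int ?k * fst t) * cis (of_int ?l * snd t)" for t
    by (simp add: torus_char_def cis_cnj cis_mult algebra_simps)
  have "integral\<^sup>L (lebesgue_on torus_param) (\<lambda>t. cis (of_int ?k * fst t) * cis (of_int ?l * snd t))
      = integral {0..2 * pi} (\<lambda>x. integral {0..2 * pi} (\<lambda>y. cis (of_int ?k * x) * cis (of_int ?l * y)))"
    by (subst lebesgue_integral_torus(2)) (auto intro!: continuous_intros)
  also have "\<dots> = integral {0..2 * pi} (\<lambda>x. cis (of_int ?k * x)) * integral {0..2 * pi} (\<lambda>y. cis (of_int ?l * y))"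
    by (simp del: of_int_diff)
  also have "\<dots> = (if i = j then of_real (4 * pi\<^sup>2) else 0)"
    unfolding integral_cis by (auto simp: prod_eq_iff power2_eq_square)
  finally show ?thesis unfolding e .
qed

lemma parseval_finite:
  assumes "finite F"
  shows "(LINT t|lebesgue_on torus_param. (cmod (\<Sum>i\<in>F. b i * torus_char i t))\<^sup>2)
    = 4 * pi\<^sup>2 * (\<Sum>i\<in>F. (cmod (b i))\<^sup>2)"
proof -
  let ?M = "lebesgue_on torus_param"
  have int: "integrable ?M (\<lambda>t. torus_char i t * cnj (torus_char j t))" for i j
    by (intro lebesgue_integral_torus(1) continuous_intros continuous_torus_char)
  have "complex_of_real (LINT t|?M. (cmod (\<Sum>i\<in>F. b i * torus_char i t))\<^sup>2)
      = (LINT t|?M. of_real ((cmod (\<Sum>i\<in>F. b i * torus_char i t))\<^sup>2))"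
    by (simp only: integral_complex_of_real)
  also have "\<dots> = (LINT t|?M. (\<Sum>i\<in>F. \<Sum>j\<in>F. b i * cnj (b j) * (torus_char i t * cnj (torus_char j t))))"
    by (simp only: complex_norm_square cnj_sum sum_product complex_cnj_mult mult_ac)
  also have "\<dots> = (\<Sum>i\<in>F. \<Sum>j\<in>F. b i * cnj (b j) * (LINT t|?M. torus_char i t * cnj (torus_char j t)))"
    by (simp only: Bochner_Integration.integral_sum integral_mult_right_zero Bochner_Integration.integrable_sum integrable_mult_right int)
  also have "\<dots> = (\<Sum>i\<in>F. b i * cnj (b i) * of_real (4 * pi\<^sup>2))"
    unfolding torus_char_orth using assms by (simp add: if_distrib cong: if_cong)
  also have "\<dots> = of_real (4 * pi\<^sup>2 * (\<Sum>i\<in>F. (cmod (b i))\<^sup>2))"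
    by (simp only: complex_norm_square[symmetric] of_real_mult[symmetric] of_real_sum[symmetric] sum_distrib_right[symmetric] mult.commute)
  finally show ?thesis by (simp only: of_real_eq_iff)
qed

text \<open>Growing squares absorb every finite set of indices, so an unordered sum becomes the
  limit of a sequence, the form that dominated convergence asks for.\<close>

lemma filterlim_squares: "filterlim (\<lambda>n::nat. {..n} \<times> {..n}) (finite_subsets_at_top (UNIV :: (nat \<times> nat) set)) sequentially"
  unfolding filterlim_iff eventually_finite_subsets_at_top
proof (intro allI impI)
  fix P :: "(nat \<times> nat) set \<Rightarrow> bool"
  assume "\<exists>X. finite X \<and> X \<subseteq> UNIV \<and> (\<forall>Y. finite Y \<and> X \<subseteq> Y \<and> Y \<subseteq> UNIV \<longrightarrow> P Y)"
  then obtain X where X: "finite X" "\<And>Y. finite Y \<Longrightarrow> X \<subseteq> Y \<Longrightarrow> P Y" by auto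
  define N where "N = Max (insert 0 (fst ` X \<union> snd ` X))"
  have "X \<subseteq> {..n} \<times> {..n}" if "n \<ge> N" for n
  proof
    fix x assume "x \<in> X"
    then have "fst x \<le> N" "snd x \<le> N" unfolding N_def using X(1) by (auto intro!: Max_ge)
    then show "x \<in> {..n} \<times> {..n}" using that by (cases x) auto
  qed
  then show "\<forall>\<^sub>F n in sequentially. P ({..n} \<times> {..n})"
    using X(2) by (auto simp: eventually_sequentially intro!: exI[of _ N])
qed

lemma has_sum_squares: "(f has_sum s) (UNIV :: (nat \<times> nat) set) \<Longrightarrow> (\<lambda>n. \<Sum>i\<in>{..n}\<times>{..n}. f i) \<longlonglongrightarrow> s"
  unfolding has_sum_def by (rule filterlim_compose[OF _ filterlim_squares])

text \<open>On a torus of radius below 1 the series converges absolutely with a bound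
  \<open>B\<close> independent of the angles, so dominated convergence carries the finite identity
  to the limit. Membership in \<open>H2\<close> is not assumed, since the identity serves to prove
  it.\<close>

lemma parseval:
  assumes a: "power_series2 a f" and r: "0 \<le> r" "r < 1"
  shows "(\<lambda>t. f (torus_pt r t)) \<in> borel_measurable (lebesgue_on torus_param)"
    and "((\<lambda>i. (cmod (a i))\<^sup>2 * r ^ (2 * (fst i + snd i))) has_sum (torus_int r f / (4 * pi\<^sup>2))) UNIV"
    and "integrable (lebesgue_on torus_param) (\<lambda>t. (cmod (f (torus_pt r t)))\<^sup>2)"
proof -
  let ?M = "lebesgue_on torus_param"
  define b where "b i = a i * of_real (r ^ (fst i + snd i))" for i
  define P where "P n t = (\<Sum>i\<in>{..n}\<times>{..n}. b i * torus_char i t)" for n t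
  have hs: "((\<lambda>i. b i * torus_char i t) has_sum f (torus_pt r t)) UNIV" for t
  proof -
    have "((\<lambda>i. a i * mono2 i (torus_pt r t)) has_sum f (torus_pt r t)) UNIV"
      by (rule power_series2D[OF a torus_pt_bidisk[OF r]])
    then show ?thesis by (simp only: b_def mono2_torus_pt mult.assoc)
  qed
  have "(\<lambda>i. norm (b i * torus_char i 0)) summable_on UNIV"
    by (rule iffD1[OF summable_on_iff_abs_summable_on_complex has_sum_imp_summable[OF hs]])
  then have bs: "(\<lambda>i. cmod (b i)) summable_on UNIV" by (simp add: norm_mult)
  define B where "B = (\<Sum>\<^sub>\<infinity>i. cmod (b i))"
  have Pb: "cmod (P n t) \<le> B" for n t
  proof -
    have "cmod (P n t) \<le> (\<Sum>i\<in>{..n}\<times>{..n}. cmod (b i * torus_char i t))" unfolding P_def by (rule norm_sum)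
    also have "\<dots> = (\<Sum>i\<in>{..n}\<times>{..n}. cmod (b i))" by (simp add: norm_mult)
    also have "\<dots> \<le> B" unfolding B_def by (rule finite_sum_le_infsum[OF bs]) auto
    finally show ?thesis .
  qed
  have B0: "0 \<le> B" unfolding B_def by (rule infsum_nonneg) simp
  have lim: "(\<lambda>n. P n t) \<longlonglongrightarrow> f (torus_pt r t)" for t
    unfolding P_def by (rule has_sum_squares[OF hs])
  have Pm: "P n \<in> borel_measurable ?M" for n
  proof -
    have "continuous_on UNIV (P n)" unfolding P_def by (intro continuous_intros continuous_torus_char)
    then show ?thesis by (intro borel_measurable_integrable lebesgue_integral_torus(1))
  qed
  show fm: "(\<lambda>t. f (torus_pt r t)) \<in> borel_measurable ?M"
    by (rule borel_measurable_LIMSEQ_metric[OF Pm lim])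
  have fin: "integrable ?M (\<lambda>t. B\<^sup>2)"
    unfolding torus_param_cbox by (rule continuous_imp_integrable) (intro continuous_intros)
  have ae: "AE t in ?M. (\<lambda>n. (cmod (P n t))\<^sup>2) \<longlonglongrightarrow> (cmod (f (torus_pt r t)))\<^sup>2"
    using lim by (intro always_eventually allI tendsto_intros)
  have le: "AE t in ?M. norm ((cmod (P n t))\<^sup>2) \<le> B\<^sup>2" for n
    using Pb B0 by (intro always_eventually allI) (simp add: power_mono)
  have meas: "(\<lambda>t. (cmod (f (torus_pt r t)))\<^sup>2) \<in> borel_measurable ?M" "(\<lambda>t. (cmod (P n t))\<^sup>2) \<in> borel_measurable ?M" for n
    using fm Pm[of n] by measurable
  note dc = integrable_dominated_convergence[OF meas fin ae le] integral_dominated_convergence[OF meas fin ae le]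
  show "integrable ?M (\<lambda>t. (cmod (f (torus_pt r t)))\<^sup>2)" by (rule dc(1))
  have "(\<lambda>n. (LINT t|?M. (cmod (P n t))\<^sup>2) / (4 * pi\<^sup>2)) \<longlonglongrightarrow> torus_int r f / (4 * pi\<^sup>2)"
    unfolding torus_int_def by (intro tendsto_intros dc) simp
  moreover have "(LINT t|?M. (cmod (P n t))\<^sup>2) / (4 * pi\<^sup>2) = (\<Sum>i\<in>{..n}\<times>{..n}. (cmod (b i))\<^sup>2)" for n
    unfolding P_def by (subst parseval_finite) auto
  ultimately have 1: "(\<lambda>n. \<Sum>i\<in>{..n}\<times>{..n}. (cmod (b i))\<^sup>2) \<longlonglongrightarrow> torus_int r f / (4 * pi\<^sup>2)" by simp
  \<comment> \<open>The entries are absolutely summable and bounded by \<open>B\<close>, hence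
    square summable; an unordered sum therefore exists, and the limit along squares gives its
    value.\<close>
  have "ell2 b"
    unfolding ell2_def
  proof (rule summable_on_comparison_test)
    show "(\<lambda>i. B * cmod (b i)) summable_on UNIV" by (intro summable_on_cmult_right bs)
    fix i
    have "cmod (b i) \<le> B" unfolding B_def using finite_sum_le_infsum[OF bs, of "{i}"] by simp
    then show "(cmod (b i))\<^sup>2 \<le> B * cmod (b i)" by (simp add: power2_eq_square mult_right_mono)
  qed simp
  then obtain s where s: "((\<lambda>i. (cmod (b i))\<^sup>2) has_sum s) UNIV"
    unfolding ell2_def summable_on_def by blast
  then have "s = torus_int r f / (4 * pi\<^sup>2)" using has_sum_squares[OF s] 1 LIMSEQ_unique by blast
  moreover have "(cmod (b i))\<^sup>2 = (cmod (a i))\<^sup>2 * r ^ (2 * (fst i + snd i))" for i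
    unfolding b_def using r by (simp add: norm_mult norm_power power_mult_distrib flip: power_mult) (simp add: mult.commute)
  ultimately show "((\<lambda>i. (cmod (a i))\<^sup>2 * r ^ (2 * (fst i + snd i))) has_sum (torus_int r f / (4 * pi\<^sup>2))) UNIV"
    using s by simp
qed

text \<open>One fixed sequence of radii tending to 1. It starts with \<open>rad 0 = 0\<close>, so
  whenever a radius is divided by, the index starts at 1.\<close>

definition rad :: "nat \<Rightarrow> real"
  where "rad n = 1 - inverse (real (Suc n))"

lemma rad: "0 \<le> rad n" "rad n < 1" "rad \<longlonglongrightarrow> 1"
proof -
  show "0 \<le> rad n" "rad n < 1" by (simp_all add: rad_def field_simps)
  show "rad \<longlonglongrightarrow> 1" unfolding rad_def
    using tendsto_diff[OF tendsto_const LIMSEQ_inverse_real_of_nat, of 1] by simp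
qed

lemma torus_int_le_norm:
  assumes "f \<in> H2"
  shows "torus_int (rad n) f \<le> 4 * pi\<^sup>2 * (H2.nrm f)\<^sup>2"
proof -
  note c = power_series2_coeff2[OF assms]
  have "torus_int (rad n) f / (4 * pi\<^sup>2) \<le> (\<Sum>\<^sub>\<infinity>i. (cmod (coeff2 f i))\<^sup>2)"
  proof (rule has_sum_mono[OF parseval(2)[OF c(1) rad(1,2)[of n]]])
    show "((\<lambda>i. (cmod (coeff2 f i))\<^sup>2) has_sum (\<Sum>\<^sub>\<infinity>i. (cmod (coeff2 f i))\<^sup>2)) UNIV"
      using c(2) unfolding ell2_def by (rule has_sum_infsum)
    show "(cmod (coeff2 f i))\<^sup>2 * rad n ^ (2 * (fst i + snd i)) \<le> (cmod (coeff2 f i))\<^sup>2" for i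
      using rad(1,2)[of n] by (intro mult_left_le power_le_one) auto
  qed
  then show ?thesis unfolding H2_norm[OF assms] by (simp add: infsum_nonneg field_simps)
qed

text \<open>For a finite set of indices the damping factors tend to 1, so a bound on the means
  bounds all finite sums. The error \<open>e\<close> allows a comparison of means that holds only
  asymptotically.\<close>

lemma ell2_of_torus_int:
  assumes a: "power_series2 a f" and le: "\<And>n. torus_int (rad n) f \<le> 4 * pi\<^sup>2 * D + e n" and e: "e \<longlonglongrightarrow> 0"
  shows "ell2 a" "(\<Sum>\<^sub>\<infinity>i. (cmod (a i))\<^sup>2) \<le> D"
proof -
  have "(\<Sum>i\<in>F. (cmod (a i))\<^sup>2) \<le> D" if F: "finite F" for F
  proof (rule LIMSEQ_le)
    show "(\<lambda>n. \<Sum>i\<in>F. (cmod (a i))\<^sup>2 * rad n ^ (2 * (fst i + snd i))) \<longlonglongrightarrow> (\<Sum>i\<in>F. (cmod (a i))\<^sup>2)"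
    proof (rule tendsto_sum)
      fix i
      have "(\<lambda>n. (cmod (a i))\<^sup>2 * rad n ^ (2 * (fst i + snd i))) \<longlonglongrightarrow> (cmod (a i))\<^sup>2 * 1 ^ (2 * (fst i + snd i))"
        by (intro tendsto_intros rad)
      then show "(\<lambda>n. (cmod (a i))\<^sup>2 * rad n ^ (2 * (fst i + snd i))) \<longlonglongrightarrow> (cmod (a i))\<^sup>2" by simp
    qed
    have "(\<lambda>n. D + e n / (4 * pi\<^sup>2)) \<longlonglongrightarrow> D + 0 / (4 * pi\<^sup>2)" by (intro tendsto_intros e) simp
    then show "(\<lambda>n. D + e n / (4 * pi\<^sup>2)) \<longlonglongrightarrow> D" by simp
    have "(\<Sum>i\<in>F. (cmod (a i))\<^sup>2 * rad n ^ (2 * (fst i + snd i))) \<le> D + e n / (4 * pi\<^sup>2)" for n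
    proof -
      have "(\<Sum>i\<in>F. (cmod (a i))\<^sup>2 * rad n ^ (2 * (fst i + snd i))) \<le> torus_int (rad n) f / (4 * pi\<^sup>2)"
        using rad(1)[of n] by (intro finite_sum_le_has_sum[OF parseval(2)[OF a rad(1,2)] F]) auto
      also have "\<dots> \<le> D + e n / (4 * pi\<^sup>2)" using le[of n] by (simp add: field_simps)
      finally show ?thesis .
    qed
    then show "\<exists>N. \<forall>n\<ge>N. (\<Sum>i\<in>F. (cmod (a i))\<^sup>2 * rad n ^ (2 * (fst i + snd i))) \<le> D + e n / (4 * pi\<^sup>2)" by blast
  qed
  then show "ell2 a" "(\<Sum>\<^sub>\<infinity>i. (cmod (a i))\<^sup>2) \<le> D" using ell2_bound by blast+
qed

lemma norm_le_of_torus_int: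
  assumes f: "f \<in> H2" and le: "\<And>n. torus_int (rad n) f \<le> 4 * pi\<^sup>2 * D\<^sup>2 + e n" and e: "e \<longlonglongrightarrow> 0" and D: "0 \<le> D"
  shows "H2.nrm f \<le> D"
  using ell2_of_torus_int(2)[OF power_series2_coeff2(1)[OF f] le e] D
  unfolding H2_norm[OF f] by (simp add: real_le_lsqrt)

text \<open>Elements of \<open>H2\<close> vanish off the bidisk, whereas \<open>\<theta>\<close> and
  kernels are unconstrained there; this cut-off reconciles the two conventions.\<close>

definition on_bidisk :: "(complex \<times> complex \<Rightarrow> complex) \<Rightarrow> complex \<times> complex \<Rightarrow> complex"
  where "on_bidisk f = (\<lambda>z. if z \<in> bidisk then f z else 0)"

lemma torus_int_mono:
  assumes "power_series2 a f" "power_series2 b g" "\<And>z. z \<in> bidisk \<Longrightarrow> cmod (f z) \<le> C * cmod (g z)"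
  shows "torus_int (rad n) f \<le> C\<^sup>2 * torus_int (rad n) g"
proof -
  have "torus_int (rad n) f \<le> (LINT t|lebesgue_on torus_param. C\<^sup>2 * (cmod (g (torus_pt (rad n) t)))\<^sup>2)"
    unfolding torus_int_def
  proof (rule integral_mono)
    fix t
    have "cmod (f (torus_pt (rad n) t)) \<le> C * cmod (g (torus_pt (rad n) t))"
      by (intro assms torus_pt_bidisk rad)
    then have "(cmod (f (torus_pt (rad n) t)))\<^sup>2 \<le> (C * cmod (g (torus_pt (rad n) t)))\<^sup>2"
      by (intro power_mono) auto
    then show "(cmod (f (torus_pt (rad n) t)))\<^sup>2 \<le> C\<^sup>2 * (cmod (g (torus_pt (rad n) t)))\<^sup>2"
      by (simp add: power_mult_distrib)
  next
    show "integrable (lebesgue_on torus_param) (\<lambda>t. (cmod (f (torus_pt (rad n) t)))\<^sup>2)"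
      by (rule parseval(3)[OF assms(1) rad(1,2)])
    show "integrable (lebesgue_on torus_param) (\<lambda>t. C\<^sup>2 * (cmod (g (torus_pt (rad n) t)))\<^sup>2)"
      by (intro integrable_mult_right parseval(3)[OF assms(2) rad(1,2)])
  qed
  then show ?thesis unfolding torus_int_def by simp
qed

section \<open>Bounded multipliers of \<open>H2\<close>\<close>

lemma norm_bounded_mult:
  assumes "f \<in> H2" "g \<in> H2" "\<And>z. z \<in> bidisk \<Longrightarrow> cmod (f z) \<le> C * cmod (g z)" "0 \<le> C"
  shows "H2.nrm f \<le> C * H2.nrm g"
proof (rule norm_le_of_torus_int[OF assms(1), where e = "\<lambda>_. 0"])
  fix n
  have "torus_int (rad n) f \<le> C\<^sup>2 * torus_int (rad n) g"
    by (intro torus_int_mono[OF power_series2_coeff2(1) power_series2_coeff2(1)] assms)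
  also have "\<dots> \<le> C\<^sup>2 * (4 * pi\<^sup>2 * (H2.nrm g)\<^sup>2)"
    by (intro mult_left_mono torus_int_le_norm assms) simp
  finally show "torus_int (rad n) f \<le> 4 * pi\<^sup>2 * (C * H2.nrm g)\<^sup>2 + 0"
    by (simp add: power_mult_distrib mult_ac)
qed (use assms H2.nrm_nonneg in auto)

text \<open>The norm bound presupposes that the product is in \<open>H2\<close>. Membership is
  therefore checked on monomials, where it follows from shift invariance, and passed to limits: by
  the bound, products with a convergent sequence form a Cauchy sequence.\<close>

theorem bounded_mult_mem:
  assumes b: "on_bidisk b \<in> H2" and C: "\<And>z. z \<in> bidisk \<Longrightarrow> cmod (b z) \<le> C" and h: "h \<in> H2"
  shows "(\<lambda>z. b z * h z) \<in> H2"
proof -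
  have "(0, 0) \<in> bidisk" by simp
  from order_trans[OF norm_ge_zero C[OF this]] have C0: "0 \<le> C" .
  define M where "M = {h\<in>H2. (\<lambda>z. b z * h z) \<in> H2}"
  have "H2.closed_sub M"
  proof (rule H2.closed_subI)
    show "M \<subseteq> H2" unfolding M_def by auto
    show "fun_subspace M"
      unfolding fun_subspace_def
    proof (intro conjI ballI allI)
      show "(\<lambda>_. 0) \<in> M" using H2.zero_mem unfolding M_def by simp
      show "(\<lambda>x. f x + g x) \<in> M" if "f \<in> M" "g \<in> M" for f g
        using that H2.add_mem[of f g] H2.add_mem[of "\<lambda>z. b z * f z" "\<lambda>z. b z * g z"]
        unfolding M_def by (simp add: distrib_left)
      show "(\<lambda>x. c * f x) \<in> M" if "f \<in> M" for c f
        using that H2.scale_mem[of f c] H2.scale_mem[of "\<lambda>z. b z * f z" c]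
        unfolding M_def by (simp add: mult.left_commute)
    qed
    fix F :: "nat \<Rightarrow> _" and f
    assume f: "f \<in> H2" and F: "\<And>n. F n \<in> M" and lim: "(\<lambda>n. H2.nrm (\<lambda>x. F n x - f x)) \<longlonglongrightarrow> 0"
    have FH: "F n \<in> H2" "(\<lambda>z. b z * F n z) \<in> H2" for n using F[of n] unfolding M_def by auto
    have le: "H2.nrm (\<lambda>z. b z * F m z - b z * F n z) \<le> C * H2.nrm (\<lambda>z. F m z - F n z)" for m n
    proof (rule norm_bounded_mult[OF H2.diff_mem[OF FH(2) FH(2)] H2.diff_mem[OF FH(1) FH(1)] _ C0])
      fix z :: "complex \<times> complex" assume "z \<in> bidisk"
      then show "cmod (b z * F m z - b z * F n z) \<le> C * cmod (F m z - F n z)"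
        unfolding right_diff_distrib[symmetric] norm_mult by (intro mult_right_mono C) auto
    qed
    have "\<exists>g\<in>H2. (\<lambda>n. H2.nrm (\<lambda>x. b x * F n x - g x)) \<longlonglongrightarrow> 0"
    proof (rule H2.complete[OF FH(2)])
      fix e :: real assume e: "e > 0"
      \<comment> \<open>\<open>C + 1\<close> keeps the denominator positive when
        \<open>C = 0\<close>.\<close>
      then have "e / (2 * (C + 1)) > 0" using C0 by simp
      from order_tendstoD(2)[OF lim this]
      obtain N where N: "\<And>n. n \<ge> N \<Longrightarrow> H2.nrm (\<lambda>x. F n x - f x) < e / (2 * (C + 1))"
        unfolding eventually_sequentially by blast
      have "H2.nrm (\<lambda>x. b x * F m x - b x * F n x) < e" if "m \<ge> N" "n \<ge> N" for m n
      proof -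
        have "H2.nrm (\<lambda>x. F m x - F n x) \<le> H2.nrm (\<lambda>x. F m x - f x) + H2.nrm (\<lambda>x. F n x - f x)"
          using H2.nrm_triangle_diff[OF FH(1)[of m] f FH(1)[of n]] H2.nrm_minus[OF f FH(1)[of n]] by simp
        also have "\<dots> < e / (2 * (C + 1)) + e / (2 * (C + 1))" using N[OF that(1)] N[OF that(2)] by (rule add_strict_mono)
        also have "\<dots> = e / (C + 1)" by (simp only: divide_divide_eq_left[symmetric] field_sum_of_halves mult.commute[of 2])
        finally have *: "H2.nrm (\<lambda>x. F m x - F n x) * (C + 1) < e" using C0 by (simp add: pos_less_divide_eq)
        have "0 \<le> H2.nrm (\<lambda>x. F m x - F n x)" by (intro H2.nrm_nonneg H2.diff_mem FH)
        then have "C * H2.nrm (\<lambda>x. F m x - F n x) < e" using * by (simp add: algebra_simps)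
        then show ?thesis using le[of m n] by simp
      qed
      then show "\<exists>N. \<forall>m\<ge>N. \<forall>n\<ge>N. H2.nrm (\<lambda>x. b x * F m x - b x * F n x) < e" by blast
    qed
    then obtain g where g: "g \<in> H2" "(\<lambda>n. H2.nrm (\<lambda>x. b x * F n x - g x)) \<longlonglongrightarrow> 0" by blast
    \<comment> \<open>Norm convergence implies pointwise convergence, which identifies the abstract
      limit \<open>g\<close> with the product.\<close>
    have "g z = b z * f z" for z
    proof -
      have "(\<lambda>n. b z * F n z) \<longlonglongrightarrow> g z" by (rule H2.pointwise_tendsto[OF FH(2) g])
      moreover have "(\<lambda>n. b z * F n z) \<longlonglongrightarrow> b z * f z"
        by (intro tendsto_intros H2.pointwise_tendsto[OF FH(1) f lim])
      ultimately show ?thesis using LIMSEQ_unique by blast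
    qed
    then have "g = (\<lambda>z. b z * f z)" by (rule ext)
    then show "f \<in> M" unfolding M_def using f g(1) by simp
  qed
  moreover have "mono_fun i \<in> M" for i
  proof (rule mono_fun_induct)
    have "(\<lambda>z. b z * mono_fun (0, 0) z) = on_bidisk b" by (auto simp: mono_fun_def mono2_def on_bidisk_def)
    then show "mono_fun (0, 0) \<in> M" unfolding M_def using b mono_fun_mem by simp
    show "(\<lambda>z. p z * f z) \<in> M" if "coord p" "f \<in> H2" "f \<in> M" for p f
      using mult_coord_mem[OF that(1), of f] mult_coord_mem[OF that(1), of "\<lambda>z. b z * f z"] that
      unfolding M_def by (simp add: mult.left_commute)
  qed
  ultimately have "M = H2" by (rule mono_fun_total)
  then show ?thesis using h unfolding M_def by blast
qed

lemma rad_at_left: "filterlim rad (at_left 1) sequentially"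
  unfolding filterlim_at using rad rad(2)[THEN less_imp_neq] by (auto intro!: always_eventually)

text \<open>The means of \<open>\<theta> h\<close> and of \<open>h\<close> differ by an integral
  containing the factor \<open>|\<theta>|^2 - 1\<close>, which tends to 0 almost everywhere. The
  bound \<open>D\<close> on \<open>h\<close> supplies the dominating constant, so radial limits are
  taken of \<open>\<theta>\<close> only.\<close>

lemma inner2_norm:
  assumes \<theta>: "inner2 \<theta>" "on_bidisk \<theta> \<in> H2" and h: "h \<in> H2" and D: "\<And>z. z \<in> bidisk \<Longrightarrow> cmod (h z) \<le> D"
  shows "H2.nrm (\<lambda>z. \<theta> z * h z) = H2.nrm h"
proof -
  let ?M = "lebesgue_on torus_param"
  let ?u = "\<lambda>z. \<theta> z * h z"
  obtain C where C: "\<And>z. z \<in> bidisk \<Longrightarrow> cmod (\<theta> z) \<le> C"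
    using \<theta>(1) unfolding inner2_def bounded_iff by blast
  have u: "?u \<in> H2" by (rule bounded_mult_mem[OF \<theta>(2) C h])
  note pu = parseval[OF power_series2_coeff2(1)[OF u] rad(1,2)]
  note ph = parseval[OF power_series2_coeff2(1)[OF h] rad(1,2)]
  define s where "s n t = (cmod (?u (torus_pt (rad n) t)))\<^sup>2 - (cmod (h (torus_pt (rad n) t)))\<^sup>2" for n t
  have s_eq: "s n t = ((cmod (\<theta> (torus_pt (rad n) t)))\<^sup>2 - 1) * (cmod (h (torus_pt (rad n) t)))\<^sup>2" for n t
    unfolding s_def by (simp add: norm_mult power_mult_distrib algebra_simps)
  have hD: "(cmod (h (torus_pt (rad n) t)))\<^sup>2 \<le> D\<^sup>2" for n t
    by (intro power_mono D torus_pt_bidisk rad) simp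
  have tC: "(cmod (\<theta> (torus_pt (rad n) t)))\<^sup>2 \<le> C\<^sup>2" for n t
    by (intro power_mono C torus_pt_bidisk rad) simp
  have "(\<lambda>n. integral\<^sup>L ?M (s n)) \<longlonglongrightarrow> integral\<^sup>L ?M (\<lambda>_. 0)"
  proof (rule integral_dominated_convergence)
    show "integrable ?M (\<lambda>_. (C\<^sup>2 + 1) * D\<^sup>2)"
      unfolding torus_param_cbox by (rule continuous_imp_integrable) (intro continuous_intros)
    show "s n \<in> borel_measurable ?M" for n unfolding s_def using pu(3) ph(3)
      by (intro borel_measurable_integrable Bochner_Integration.integrable_diff)
    show "AE t in ?M. norm (s n t) \<le> (C\<^sup>2 + 1) * D\<^sup>2" for n
    proof (intro always_eventually allI)
      fix t
      have "\<bar>(cmod (\<theta> (torus_pt (rad n) t)))\<^sup>2 - 1\<bar> \<le> C\<^sup>2 + 1"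
        using tC[of n t] zero_le_power2[of "cmod (\<theta> (torus_pt (rad n) t))"] by linarith
      then show "norm (s n t) \<le> (C\<^sup>2 + 1) * D\<^sup>2"
        unfolding s_eq real_norm_def abs_mult using hD[of n t] by (intro mult_mono) auto
    qed
    have "AE t in ?M. \<exists>l. cmod l = 1 \<and>
        ((\<lambda>r. \<theta> (of_real r * cis (fst t), of_real r * cis (snd t))) \<longlongrightarrow> l) (at_left 1)"
      using \<theta>(1) unfolding inner2_def by blast
    then show "AE t in ?M. (\<lambda>n. s n t) \<longlonglongrightarrow> 0"
    proof eventually_elim
      case (elim t)
      then obtain l where l: "cmod l = 1" "((\<lambda>r. \<theta> (torus_pt r t)) \<longlongrightarrow> l) (at_left 1)"
        unfolding torus_pt_def by blast
      have "(\<lambda>n. \<theta> (torus_pt (rad n) t)) \<longlonglongrightarrow> l" by (rule filterlim_compose[OF l(2) rad_at_left])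
      then have "(\<lambda>n. \<bar>(cmod (\<theta> (torus_pt (rad n) t)))\<^sup>2 - 1\<bar> * D\<^sup>2) \<longlonglongrightarrow> \<bar>(cmod l)\<^sup>2 - 1\<bar> * D\<^sup>2"
        by (intro tendsto_intros)
      then have "(\<lambda>n. \<bar>(cmod (\<theta> (torus_pt (rad n) t)))\<^sup>2 - 1\<bar> * D\<^sup>2) \<longlonglongrightarrow> 0" using l(1) by simp
      then show ?case
      proof (rule Lim_null_comparison[rotated], intro always_eventually allI)
        fix n
        show "norm (s n t) \<le> \<bar>(cmod (\<theta> (torus_pt (rad n) t)))\<^sup>2 - 1\<bar> * D\<^sup>2"
          unfolding s_eq real_norm_def abs_mult using hD[of n t] by (intro mult_left_mono) auto
      qed
    qed
  qed simp
  then have lim: "(\<lambda>n. torus_int (rad n) ?u - torus_int (rad n) h) \<longlonglongrightarrow> 0"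
    unfolding s_def torus_int_def
    by (simp only: Bochner_Integration.integral_diff[OF pu(3) ph(3)] Bochner_Integration.integral_zero)
  have "H2.nrm ?u \<le> H2.nrm h"
    by (rule norm_le_of_torus_int[OF u _ lim H2.nrm_nonneg[OF h]]) (use torus_int_le_norm[OF h] in simp)
  \<comment> \<open>The same limit with its sign reversed serves as the error term for the opposite
    inequality.\<close>
  moreover have "H2.nrm h \<le> H2.nrm ?u"
    by (rule norm_le_of_torus_int[OF h _ tendsto_minus_cancel[of _ 0] H2.nrm_nonneg[OF u],
          where e = "\<lambda>n. torus_int (rad n) h - torus_int (rad n) ?u"])
      (use torus_int_le_norm[OF u] lim in simp_all)
  ultimately show ?thesis by simp
qed

text \<open>Multiplication by a bounded \<open>b\<close> is continuous, so an adjoint type identity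
  is a closed linear condition on \<open>h\<close> and may be tested on monomials.\<close>

lemma closed_sub_ip_eq:
  assumes b: "on_bidisk b \<in> H2" "\<And>z. z \<in> bidisk \<Longrightarrow> cmod (b z) \<le> C" and uv: "u \<in> H2" "v \<in> H2"
  shows "H2.closed_sub {h \<in> H2. H2_inner (\<lambda>z. b z * h z) u = H2_inner h v}" (is "H2.closed_sub ?M")
proof (rule H2.closed_subI)
  have bm: "(\<lambda>z. b z * h z) \<in> H2" if "h \<in> H2" for h by (rule bounded_mult_mem[OF b that])
  have "(0, 0) \<in> bidisk" by simp
  from order_trans[OF norm_ge_zero b(2)[OF this]] have C0: "0 \<le> C" .
  show "fun_subspace ?M"
    unfolding fun_subspace_def
  proof (intro conjI ballI allI)
    show "(\<lambda>_. 0) \<in> ?M" using H2.zero_mem H2.ip_zero uv by simp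
    show "(\<lambda>x. f x + g x) \<in> ?M" if "f \<in> ?M" "g \<in> ?M" for f g
      using that uv H2.add_mem[of f g] bm H2.ip_add[of f g v]
        H2.ip_add[of "\<lambda>z. b z * f z" "\<lambda>z. b z * g z" u]
      by (simp add: distrib_left)
    show "(\<lambda>x. c * f x) \<in> ?M" if "f \<in> ?M" for c f
      using that uv H2.scale_mem[of f c] bm H2.ip_scale[of f v c]
        H2.ip_scale[of "\<lambda>z. b z * f z" u c]
      by (simp add: mult.left_commute)
  qed
  fix F :: "nat \<Rightarrow> _" and f
  assume f: "f \<in> H2" and F: "\<And>n. F n \<in> ?M" and lim: "(\<lambda>n. H2.nrm (\<lambda>x. F n x - f x)) \<longlonglongrightarrow> 0"
  have FH: "F n \<in> H2" "H2_inner (\<lambda>z. b z * F n z) u = H2_inner (F n) v" for n using F[of n] by auto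
  have limb: "(\<lambda>n. H2.nrm (\<lambda>x. b x * F n x - b x * f x)) \<longlonglongrightarrow> 0"
  proof (rule Lim_null_comparison, intro always_eventually allI)
    fix n
    show "norm (H2.nrm (\<lambda>x. b x * F n x - b x * f x)) \<le> C * H2.nrm (\<lambda>x. F n x - f x)"
    proof -
      have d: "(\<lambda>x. b x * F n x - b x * f x) \<in> H2" by (intro H2.diff_mem bm FH f)
      have "H2.nrm (\<lambda>x. b x * F n x - b x * f x) \<le> C * H2.nrm (\<lambda>x. F n x - f x)"
      proof (rule norm_bounded_mult[OF d H2.diff_mem[OF FH(1) f] _ C0])
        fix z :: "complex \<times> complex" assume "z \<in> bidisk"
        then show "cmod (b z * F n z - b z * f z) \<le> C * cmod (F n z - f z)"
          unfolding right_diff_distrib[symmetric] norm_mult by (intro mult_right_mono b) auto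
      qed
      then show ?thesis using H2.nrm_nonneg[OF d] by simp
    qed
    show "(\<lambda>n. C * H2.nrm (\<lambda>x. F n x - f x)) \<longlonglongrightarrow> 0"
      using tendsto_mult_right_zero[OF lim] .
  qed
  have "(\<lambda>n. H2_inner (F n) v) \<longlonglongrightarrow> H2_inner (\<lambda>z. b z * f z) u"
    using H2.ip_tendsto[OF bm[OF FH(1)] bm[OF f] uv(1) limb] FH(2) by simp
  moreover have "(\<lambda>n. H2_inner (F n) v) \<longlonglongrightarrow> H2_inner f v" by (rule H2.ip_tendsto[OF FH(1) f uv(2) lim])
  ultimately show "f \<in> ?M" using LIMSEQ_unique f by blast
qed auto

text \<open>Polarizing \<open>inner2_norm\<close> requires bounded functions, so it is done for
  monomials; each of the two arguments is then extended to \<open>H2\<close> in turn.\<close>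

theorem inner2_isometry:
  assumes \<theta>: "inner2 \<theta>" "on_bidisk \<theta> \<in> H2" and f: "f \<in> H2" and g: "g \<in> H2"
  shows "H2_inner (\<lambda>z. \<theta> z * f z) (\<lambda>z. \<theta> z * g z) = H2_inner f g"
proof -
  obtain C where C: "\<And>z. z \<in> bidisk \<Longrightarrow> cmod (\<theta> z) \<le> C"
    using \<theta>(1) unfolding inner2_def bounded_iff by blast
  have m: "(\<lambda>z. \<theta> z * h z) \<in> H2" if "h \<in> H2" for h by (rule bounded_mult_mem[OF \<theta>(2) C that])
  have mono_le: "cmod (mono_fun i z) \<le> 1" if "z \<in> bidisk" for i z
    using that by (auto simp: mono_fun_def mono2_def norm_mult norm_power bidisk_iff intro!: mult_le_one power_le_one)
  have 1: "H2_inner (\<lambda>z. \<theta> z * mono_fun i z) (\<lambda>z. \<theta> z * mono_fun j z) = H2_inner (mono_fun i) (mono_fun j)" for i j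
  proof (rule ip_eq_of_norm_eq[OF H2.rkhs_axioms H2.rkhs_axioms m[OF mono_fun_mem] m[OF mono_fun_mem]
        mono_fun_mem mono_fun_mem])
    fix c
    have "cmod (mono_fun i z - c * mono_fun j z) \<le> 1 + cmod c" if "z \<in> bidisk" for z
    proof -
      have "cmod (mono_fun i z - c * mono_fun j z) \<le> cmod (mono_fun i z) + cmod c * cmod (mono_fun j z)"
        using norm_triangle_ineq4 by (metis norm_mult)
      also have "\<dots> \<le> 1 + cmod c * 1" by (intro add_mono mult_left_mono mono_le that) simp
      finally show ?thesis by simp
    qed
    from inner2_norm[OF \<theta> H2.diff_mem[OF mono_fun_mem H2.scale_mem[OF mono_fun_mem]] this]
    have "H2.nrm (\<lambda>z. \<theta> z * (mono_fun i z - c * mono_fun j z))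
      = H2.nrm (\<lambda>z. mono_fun i z - c * mono_fun j z)" .
    then show "H2.nrm (\<lambda>z. \<theta> z * mono_fun i z - c * (\<theta> z * mono_fun j z))
      = H2.nrm (\<lambda>z. mono_fun i z - c * mono_fun j z)"
      by (simp only: right_diff_distrib mult.left_commute)
  qed
  have 2: "H2_inner (\<lambda>z. \<theta> z * f z) (\<lambda>z. \<theta> z * mono_fun j z) = H2_inner f (mono_fun j)" if f: "f \<in> H2" for f j
  proof -
    have "{h \<in> H2. H2_inner (\<lambda>z. \<theta> z * h z) (\<lambda>z. \<theta> z * mono_fun j z) = H2_inner h (mono_fun j)} = H2"
    proof (rule mono_fun_total[OF closed_sub_ip_eq[OF \<theta>(2) C m[OF mono_fun_mem[of j]] mono_fun_mem[of j]]])
      show "mono_fun i \<in> {h \<in> H2. H2_inner (\<lambda>z. \<theta> z * h z) (\<lambda>z. \<theta> z * mono_fun j z) = H2_inner h (mono_fun j)}" for i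
        using 1[of i j] mono_fun_mem by simp
    qed
    then show ?thesis using f by blast
  qed
  have "{h \<in> H2. H2_inner (\<lambda>z. \<theta> z * h z) (\<lambda>z. \<theta> z * f z) = H2_inner h f} = H2"
  proof (rule mono_fun_total[OF closed_sub_ip_eq[OF \<theta>(2) C m[OF f] f]])
    fix i
    have "H2_inner (\<lambda>z. \<theta> z * mono_fun i z) (\<lambda>z. \<theta> z * f z) = H2_inner (mono_fun i) f"
      using 2[OF f, of i] H2.ip_cnj[OF m[OF f] m[OF mono_fun_mem], of i] H2.ip_cnj[OF f mono_fun_mem, of i] by simp
    then show "mono_fun i \<in> {h \<in> H2. H2_inner (\<lambda>z. \<theta> z * h z) (\<lambda>z. \<theta> z * f z) = H2_inner h f}"
      using mono_fun_mem by simp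
  qed
  then have "H2_inner (\<lambda>z. \<theta> z * g z) (\<lambda>z. \<theta> z * f z) = H2_inner g f" using g by blast
  then show ?thesis using H2.ip_cnj[OF m[OF g] m[OF f]] H2.ip_cnj[OF g f] by simp
qed


section \<open>Power series of bounded holomorphic functions\<close>

text \<open>Cauchy's inequality on circles of radius \<open>rad k\<close>, with \<open>k\<close>
  tending to infinity, bounds every coefficient by \<open>C\<close> itself; this bound makes the
  series absolutely summable.\<close>

lemma bounded_holomorphic_coeffs:
  assumes hol: "f holomorphic_on ball 0 1" and C: "\<And>x. x \<in> ball 0 1 \<Longrightarrow> cmod (f x) \<le> C"
  shows "\<exists>a. (\<forall>n. cmod (a n) \<le> C) \<and> (\<forall>x\<in>ball 0 1. ((\<lambda>n. a n * x ^ n) has_sum f x) UNIV)"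
proof -
  define a where "a n = (deriv ^^ n) f 0 / fact n" for n
  have bd: "cmod (a n) \<le> C" for n
  proof (rule LIMSEQ_le_const)
    have "(\<lambda>k. C / rad k ^ n) \<longlonglongrightarrow> C / 1 ^ n" by (intro tendsto_intros rad) simp
    then show "(\<lambda>k. C / rad k ^ n) \<longlonglongrightarrow> C" by simp
    \<comment> \<open>The circle degenerates for \<open>k = 0\<close>.\<close>
    have "cmod (a n) \<le> C / rad k ^ n" if "k \<ge> 1" for k
    proof -
      have r: "rad k > 0" using that by (simp add: rad_def field_simps)
      have sub: "cball 0 (rad k) \<subseteq> ball (0::complex) 1" using rad(2)[of k] by auto
      have "cmod ((deriv ^^ n) f 0) \<le> fact n * C / rad k ^ n"
      proof (rule Cauchy_inequality)
        show "f holomorphic_on ball 0 (rad k)"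
          by (rule holomorphic_on_subset[OF hol]) (use sub ball_subset_cball in blast)
        show "continuous_on (cball 0 (rad k)) f"
          by (rule continuous_on_subset[OF holomorphic_on_imp_continuous_on[OF hol] sub])
        show "cmod (f x) \<le> C" if "cmod (0 - x) = rad k" for x using that rad(2)[of k] by (intro C) simp
      qed (rule r)
      then show ?thesis unfolding a_def by (simp add: norm_divide field_simps)
    qed
    then show "\<exists>N. \<forall>k\<ge>N. cmod (a n) \<le> C / rad k ^ n" by blast
  qed
  have "((\<lambda>n. a n * x ^ n) has_sum f x) UNIV" if x: "x \<in> ball 0 1" for x
  proof (rule norm_summable_imp_has_sum)
    show "(\<lambda>n. a n * x ^ n) sums f x"
      using holomorphic_power_series[OF hol x] unfolding a_def by simp
    show "summable (\<lambda>n. norm (a n * x ^ n))"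
    proof (rule summable_comparison_test')
      show "summable (\<lambda>n. C * cmod x ^ n)" using x by (intro summable_mult summable_geometric) simp
      show "norm (norm (a n * x ^ n)) \<le> C * cmod x ^ n" for n
        using bd[of n] by (simp add: norm_mult norm_power mult_right_mono)
    qed
  qed
  then show ?thesis using bd by blast
qed

lemma holomorphic2_slices:
  assumes "holomorphic2 f"
  shows "cmod y < 1 \<Longrightarrow> (\<lambda>x. f (x, y)) holomorphic_on ball 0 1"
    and "cmod x < 1 \<Longrightarrow> (\<lambda>y. f (x, y)) holomorphic_on ball 0 1"
proof -
  have d: "\<exists>a b. (f has_derivative (\<lambda>h. a * fst h + b * snd h)) (at (x, y))" if "cmod x < 1" "cmod y < 1" for x y
    using assms that unfolding holomorphic2_def by (metis bidisk_iff fst_conv snd_conv)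
  have 1: "\<exists>a. ((\<lambda>x. f (x, y)) has_field_derivative a) (at x)" if "cmod x < 1" "cmod y < 1" for x y
  proof -
    obtain a b where ab: "(f has_derivative (\<lambda>h. a * fst h + b * snd h)) (at (x, y))" using d \<open>cmod x < 1\<close> \<open>cmod y < 1\<close> by blast
    have "((\<lambda>x. (x, y)) has_derivative (\<lambda>h. (h, 0))) (at x)" by (auto intro!: derivative_eq_intros)
    from has_derivative_compose[OF this ab]
    have "((\<lambda>x. f (x, y)) has_derivative (\<lambda>h. a * h)) (at x)" by simp
    then show ?thesis unfolding has_field_derivative_def by blast
  qed
  have 2: "\<exists>b. ((\<lambda>y. f (x, y)) has_field_derivative b) (at y)" if "cmod x < 1" "cmod y < 1" for x y
  proof -
    obtain a b where ab: "(f has_derivative (\<lambda>h. a * fst h + b * snd h)) (at (x, y))" using d \<open>cmod x < 1\<close> \<open>cmod y < 1\<close> by blast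
    have "((\<lambda>y. (x, y)) has_derivative (\<lambda>h. (0, h))) (at y)" by (auto intro!: derivative_eq_intros)
    from has_derivative_compose[OF this ab]
    have "((\<lambda>y. f (x, y)) has_derivative (\<lambda>h. b * h)) (at y)" by simp
    then show ?thesis unfolding has_field_derivative_def by blast
  qed
  show "cmod y < 1 \<Longrightarrow> (\<lambda>x. f (x, y)) holomorphic_on ball 0 1"
    using 1 by (auto simp: holomorphic_on_open dist_norm)
  show "cmod x < 1 \<Longrightarrow> (\<lambda>y. f (x, y)) holomorphic_on ball 0 1"
    using 2 by (auto simp: holomorphic_on_open dist_norm)
qed

text \<open>The remainder divided by \<open>x ^ n\<close> is dominated by a geometric series. The
  bound depends on the coefficients only through \<open>C\<close>, so it is uniform in any parameter
  they contain.\<close>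

lemma power_series_tail_bound:
  fixes a :: "nat \<Rightarrow> complex"
  assumes a: "\<And>n. cmod (a n) \<le> C" and s: "((\<lambda>n. a n * x ^ n) has_sum s) UNIV" and x: "x \<noteq> 0" "cmod x < 1"
  shows "cmod ((s - (\<Sum>j<n. a j * x ^ j)) / x ^ n - a n) \<le> C * (cmod x / (1 - cmod x))"
proof -
  have "(\<lambda>j. a j * x ^ j) sums s" using s by (rule has_sum_imp_sums)
  then have "(\<lambda>j. a (j + Suc n) * x ^ (j + Suc n)) sums (s - (\<Sum>j<Suc n. a j * x ^ j))"
    by (rule sums_split_initial_segment)
  from sums_divide[OF this, of "x ^ n"]
  have "(\<lambda>j. a (j + Suc n) * x ^ Suc j) sums ((s - (\<Sum>j<Suc n. a j * x ^ j)) / x ^ n)"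
    using x by (simp add: power_add mult_ac)
  moreover have "(s - (\<Sum>j<Suc n. a j * x ^ j)) / x ^ n = (s - (\<Sum>j<n. a j * x ^ j)) / x ^ n - a n"
    using x by (simp add: diff_divide_distrib add_divide_distrib)
  ultimately have sm: "(\<lambda>j. a (j + Suc n) * x ^ Suc j) sums ((s - (\<Sum>j<n. a j * x ^ j)) / x ^ n - a n)" by simp
  have g: "(\<lambda>j. C * (cmod x * cmod x ^ j)) sums (C * (cmod x * (1 / (1 - cmod x))))"
    using x by (intro sums_mult geometric_sums) simp
  have le: "norm (a (j + Suc n) * x ^ Suc j) \<le> C * (cmod x * cmod x ^ j)" for j
    using a[of "j + Suc n"] by (simp add: norm_mult norm_power mult_right_mono)
  have "norm (\<Sum>j. a (j + Suc n) * x ^ Suc j) \<le> (\<Sum>j. C * (cmod x * cmod x ^ j))"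
    by (rule norm_suminf_le[OF le sums_summable[OF g]])
  then show ?thesis using sums_unique[OF sm] sums_unique[OF g] by simp
qed

text \<open>Expanding in the first variable for fixed \<open>y\<close> leaves coefficients
  \<open>A y n\<close>. These are holomorphic in \<open>y\<close>, as uniform limits of the
  quotients in \<open>power_series_tail_bound\<close>, and are expanded in turn. All coefficients
  stay bounded by \<open>C\<close>, which makes the double series absolutely summable.\<close>

theorem bounded_holomorphic2_power_series:
  assumes hol: "holomorphic2 f" and C: "\<And>z. z \<in> bidisk \<Longrightarrow> cmod (f z) \<le> C"
  shows "\<exists>a. power_series2 a f"
proof -
  have "(0, 0) \<in> bidisk" by simp
  from order_trans[OF norm_ge_zero C[OF this]] have C0: "0 \<le> C" .
  have fC: "cmod (f (x, y)) \<le> C" if "x \<in> ball 0 1" "y \<in> ball 0 1" for x y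
    by (rule C) (use that in \<open>simp add: bidisk_iff\<close>)
  have "\<exists>a. (\<forall>n. cmod (a n) \<le> C) \<and> (\<forall>x\<in>ball 0 1. ((\<lambda>n. a n * x ^ n) has_sum f (x, y)) UNIV)"
    if "y \<in> ball 0 1" for y
    by (rule bounded_holomorphic_coeffs[OF holomorphic2_slices(1)[OF hol]]) (use that fC in auto)
  then have "\<forall>y\<in>ball 0 1. \<exists>a. (\<forall>n. cmod (a n) \<le> C) \<and> (\<forall>x\<in>ball 0 1. ((\<lambda>n. a n * x ^ n) has_sum f (x, y)) UNIV)"
    by blast
  from bchoice[OF this] obtain A where A:
    "\<And>y n. y \<in> ball 0 1 \<Longrightarrow> cmod (A y n) \<le> C"
    "\<And>y x. y \<in> ball 0 1 \<Longrightarrow> x \<in> ball 0 1 \<Longrightarrow> ((\<lambda>n. A y n * x ^ n) has_sum f (x, y)) UNIV"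
    by blast
  \<comment> \<open>Nonzero points of the disc tending to 0; the second \<open>Suc\<close> excludes
    the boundary point 1.\<close>
  define x where "x k = complex_of_real (inverse (real (Suc (Suc k))))" for k
  have cx: "cmod (x k) = inverse (real (Suc (Suc k)))" for k by (simp only: x_def norm_of_real abs_of_nonneg) simp
  have x: "x k \<noteq> 0" "cmod (x k) < 1" "x k \<in> ball 0 1" for k
  proof -
    show 1: "cmod (x k) < 1" unfolding cx by (simp add: field_simps)
    show "x k \<noteq> 0" by (simp add: x_def del: of_nat_Suc)
    show "x k \<in> ball 0 1" using 1 by simp
  qed
  have xl: "(\<lambda>k. cmod (x k)) \<longlonglongrightarrow> 0"
    unfolding cx using LIMSEQ_inverse_real_of_nat by (subst (asm) filterlim_sequentially_Suc[symmetric]) simp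
  have holA: "(\<lambda>y. A y n) holomorphic_on ball 0 1" for n
  proof (induction n rule: less_induct)
    case (less n)
    \<comment> \<open>Removing the terms below \<open>n\<close>, holomorphic by the induction
      hypothesis, and dividing by \<open>x k ^ n\<close> isolates \<open>A y n\<close> up to an
      error that tends to 0 with \<open>x k\<close>.\<close>
    let ?g = "\<lambda>k y. (f (x k, y) - (\<Sum>j<n. A y j * x k ^ j)) / x k ^ n"
    show ?case
    proof (rule holomorphic_uniform_sequence)
      show "?g k holomorphic_on ball 0 1" for k
        using x by (intro holomorphic_intros holomorphic2_slices(2)[OF hol] less.IH) auto
      have u: "uniform_limit (ball 0 1) ?g (\<lambda>y. A y n) sequentially"
      proof (rule uniform_limitI)
        fix e :: real assume e: "e > 0"
        have "(\<lambda>k. C * (cmod (x k) / (1 - cmod (x k)))) \<longlonglongrightarrow> C * (0 / (1 - 0))"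
          by (intro tendsto_intros xl) simp
        then have "(\<lambda>k. C * (cmod (x k) / (1 - cmod (x k)))) \<longlonglongrightarrow> 0" by simp
        then have "\<forall>\<^sub>F k in sequentially. C * (cmod (x k) / (1 - cmod (x k))) < e"
          using e by (rule order_tendstoD)
        then show "\<forall>\<^sub>F k in sequentially. \<forall>y\<in>ball 0 1. dist (?g k y) (A y n) < e"
        proof eventually_elim
          case (elim k)
          show ?case
          proof
            fix y :: complex assume y: "y \<in> ball 0 1"
            have "dist (?g k y) (A y n) \<le> C * (cmod (x k) / (1 - cmod (x k)))"
              unfolding dist_norm by (rule power_series_tail_bound[OF A(1)[OF y] A(2)[OF y x(3)] x(1,2)])
            then show "dist (?g k y) (A y n) < e" using elim by linarith
          qed
        qed
      qed
      show "\<exists>d>0. cball y d \<subseteq> ball 0 1 \<and> uniform_limit (cball y d) ?g (\<lambda>y. A y n) sequentially"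
        if "y \<in> ball 0 1" for y
        using that open_contains_cball[of "ball (0::complex) 1"] uniform_limit_on_subset[OF u] open_ball by blast
    qed simp
  qed
  have "\<forall>n. \<exists>a. (\<forall>m. cmod (a m) \<le> C) \<and> (\<forall>y\<in>ball 0 1. ((\<lambda>m. a m * y ^ m) has_sum A y n) UNIV)"
    using bounded_holomorphic_coeffs[OF holA A(1)] by blast
  from choice[OF this] obtain a where a:
    "\<And>n m. cmod (a n m) \<le> C" "\<And>n y. y \<in> ball 0 1 \<Longrightarrow> ((\<lambda>m. a n m * y ^ m) has_sum A y n) UNIV"
    by blast
  have "power_series2 (\<lambda>i. a (fst i) (snd i)) f"
    unfolding power_series2_iff
  proof
    fix z :: "complex \<times> complex" assume z: "z \<in> bidisk"
    then have z': "fst z \<in> ball 0 1" "snd z \<in> ball 0 1" by (auto simp: mem_Times_iff)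
    have "((\<lambda>i. a (fst i) (snd i) * mono2 i z) has_sum f z) (Sigma UNIV (\<lambda>_. UNIV))"
    proof (rule has_sum_SigmaI)
      show "((\<lambda>m. a (fst (n, m)) (snd (n, m)) * mono2 (n, m) z) has_sum A (snd z) n * fst z ^ n) UNIV" for n
        using has_sum_cmult_left[OF a(2)[OF z'(2)], of n "fst z ^ n"] by (simp add: mono2_def mult_ac)
      show "((\<lambda>n. A (snd z) n * fst z ^ n) has_sum f z) UNIV" using A(2)[OF z'(2,1)] by simp
      have "(\<lambda>i. norm (a (fst i) (snd i) * mono2 i z)) summable_on UNIV"
      proof (rule summable_on_comparison_test)
        show "(\<lambda>i. C * norm (fst z ^ fst i * snd z ^ snd i)) summable_on UNIV"
          using z' by (intro summable_on_cmult_right has_sum_geometric2(2)) simp_all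
        show "norm (a (fst i) (snd i) * mono2 i z) \<le> C * norm (fst z ^ fst i * snd z ^ snd i)" for i
          unfolding norm_mult[of "a (fst i) (snd i)"] mono2_def by (intro mult_right_mono a) simp
      qed simp
      then show "(\<lambda>i. a (fst i) (snd i) * mono2 i z) summable_on Sigma UNIV (\<lambda>_. UNIV)"
        by (simp add: abs_summable_summable)
    qed
    then show "((\<lambda>i. a (fst i) (snd i) * mono2 i z) has_sum f z) UNIV" by simp
  qed
  then show ?thesis by blast
qed

text \<open>The means of \<open>f\<close> are compared with those of the constant function 1, which
  in \<open>H2\<close> is \<open>mono_fun (0, 0)\<close>.\<close>

theorem on_bidisk_mem:
  assumes hol: "holomorphic2 f" and C: "\<And>z. z \<in> bidisk \<Longrightarrow> cmod (f z) \<le> C"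
  shows "on_bidisk f \<in> H2"
proof -
  obtain a where a: "power_series2 a f" using bounded_holomorphic2_power_series[OF hol C] by blast
  have one: "power_series2 (coeff2 (mono_fun (0, 0))) (mono_fun (0, 0))"
    by (rule power_series2_coeff2(1)[OF mono_fun_mem])
  have le: "torus_int (rad n) f \<le> 4 * pi\<^sup>2 * (C\<^sup>2 * (H2.nrm (mono_fun (0, 0)))\<^sup>2) + 0" for n
  proof -
    have "torus_int (rad n) f \<le> C\<^sup>2 * torus_int (rad n) (mono_fun (0, 0))"
      by (rule torus_int_mono[OF a one]) (use C in \<open>simp add: mono_fun_def mono2_def\<close>)
    also have "\<dots> \<le> C\<^sup>2 * (4 * pi\<^sup>2 * (H2.nrm (mono_fun (0, 0)))\<^sup>2)"
      by (intro mult_left_mono torus_int_le_norm mono_fun_mem) simp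
    finally show ?thesis by (simp add: mult_ac)
  qed
  have "ell2 a" by (rule ell2_of_torus_int(1)[OF a le]) simp
  moreover have "power_series2 a (on_bidisk f)"
    using a power_series2_cong[of "on_bidisk f" f] by (simp add: on_bidisk_def)
  ultimately show ?thesis by (intro H2_I[where a = a]) (simp_all only: on_bidisk_def if_False)
qed


section \<open>The model space\<close>

lemma bidisk_not: "z \<notin> bidisk \<Longrightarrow> f \<in> H2 \<Longrightarrow> f z = 0"
  by (rule power_series2_coeff2(3))

lemma H2_eq_zeroI: "f \<in> H2 \<Longrightarrow> (\<And>z. z \<in> bidisk \<Longrightarrow> f z = 0) \<Longrightarrow> f = (\<lambda>_. 0)"
  using bidisk_not by blast

locale inner_bidisk =
  fixes \<theta> :: "complex \<times> complex \<Rightarrow> complex"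
  assumes inner: "inner2 \<theta>"
begin

lemma bounded: "\<exists>C. \<forall>z\<in>bidisk. cmod (\<theta> z) \<le> C"
  using inner unfolding inner2_def bounded_iff by blast

lemma on_mem: "on_bidisk \<theta> \<in> H2"
proof -
  obtain C where "\<forall>z\<in>bidisk. cmod (\<theta> z) \<le> C" using bounded by blast
  then show ?thesis using inner unfolding inner2_def by (intro on_bidisk_mem[of _ C]) auto
qed

lemma mult_mem: assumes "h \<in> H2" shows "(\<lambda>z. \<theta> z * h z) \<in> H2"
proof -
  obtain C where C: "\<forall>z\<in>bidisk. cmod (\<theta> z) \<le> C" using bounded by blast
  show ?thesis by (rule bounded_mult_mem[OF on_mem bspec[OF C] assms])
qed

lemma isometry: "f \<in> H2 \<Longrightarrow> g \<in> H2 \<Longrightarrow> H2_inner (\<lambda>z. \<theta> z * f z) (\<lambda>z. \<theta> z * g z) = H2_inner f g"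
  by (rule inner2_isometry[OF inner on_mem])

lemma model_space_eq: "model_space \<theta> = H2.orth ((\<lambda>g z. \<theta> z * g z) ` H2)"
  unfolding model_space_def H2.orth_def by auto

lemma model_closed: "H2.closed_sub (model_space \<theta>)"
  unfolding model_space_eq by (rule H2.closed_sub_orth) (auto intro: mult_mem)

lemma model_iff: "f \<in> model_space \<theta> \<longleftrightarrow> f \<in> H2 \<and> (\<forall>g\<in>H2. H2_inner f (\<lambda>z. \<theta> z * g z) = 0)"
  unfolding model_space_def by simp

lemma model_H2: "f \<in> model_space \<theta> \<Longrightarrow> f \<in> H2"
  by (simp add: model_iff)

lemmas model_diff = fun_subspace_diff[OF H2.closed_subD(2)[OF model_closed]]

text \<open>Limits tested inside the model space agree with limits tested in \<open>H2\<close>,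
  because the model space is itself closed.\<close>

lemma closed_model_subspace_iff:
  "closed_model_subspace \<theta> M \<longleftrightarrow> H2.closed_sub M \<and> M \<subseteq> model_space \<theta>"
proof
  assume M: "closed_model_subspace \<theta> M"
  then have MK: "M \<subseteq> model_space \<theta>" and sub: "fun_subspace M" unfolding closed_model_subspace_def by auto
  have "H2.closed_sub M"
  proof (rule H2.closed_subI[OF _ sub])
    show "M \<subseteq> H2" using MK model_H2 by blast
    fix F :: "nat \<Rightarrow> _" and f
    assume f: "f \<in> H2" and F: "\<And>n. F n \<in> M" and lim: "(\<lambda>n. H2.nrm (\<lambda>x. F n x - f x)) \<longlonglongrightarrow> 0"
    have "f \<in> model_space \<theta>"
      by (rule H2.closed_subD(3)[OF model_closed f _ lim]) (use F MK in auto)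
    then show "f \<in> M" using M F lim unfolding closed_model_subspace_def
      by (elim conjE allE[of _ F]) simp
  qed
  then show "H2.closed_sub M \<and> M \<subseteq> model_space \<theta>" using MK by simp
next
  assume M: "H2.closed_sub M \<and> M \<subseteq> model_space \<theta>"
  show "closed_model_subspace \<theta> M"
    unfolding closed_model_subspace_def
  proof (intro conjI allI ballI impI)
    fix F :: "nat \<Rightarrow> _" and f
    assume f: "f \<in> model_space \<theta>" and F: "\<forall>n. F n \<in> M" and lim: "(\<lambda>n. H2.nrm (\<lambda>x. F n x - f x)) \<longlonglongrightarrow> 0"
    show "f \<in> M" by (rule H2.closed_subD(3)[OF conjunct1[OF M] model_H2[OF f] _ lim]) (use F in simp)
  qed (use M H2.closed_subD(2) in auto)
qed

lemma model_proj_unique: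
  assumes f: "f \<in> H2" and g: "g \<in> model_space \<theta>" "\<forall>h\<in>model_space \<theta>. H2_inner (\<lambda>z. f z - g z) h = 0"
  shows "model_proj \<theta> f = g"
  unfolding model_proj_def
proof (rule the_equality)
  show "g \<in> model_space \<theta> \<and> (\<forall>h\<in>model_space \<theta>. H2_inner (\<lambda>z. f z - g z) h = 0)" using g by simp
  fix g' assume g': "g' \<in> model_space \<theta> \<and> (\<forall>h\<in>model_space \<theta>. H2_inner (\<lambda>z. f z - g' z) h = 0)"
  let ?d = "\<lambda>z. g' z - g z"
  have d: "?d \<in> model_space \<theta>" using g' g(1) by (intro model_diff) auto
  have H: "g \<in> H2" "g' \<in> H2" "?d \<in> H2" using g(1) g' d model_H2 by auto
  have "H2_inner (\<lambda>z. (f z - g z) - (f z - g' z)) ?d = 0"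
    using g(2) g' d H2.ip_diff[OF H2.diff_mem[OF f H(1)] H2.diff_mem[OF f H(2)] H(3)] by simp
  then have "H2_inner ?d ?d = 0" by simp
  then have "?d = (\<lambda>_. 0)" by (rule H2.ip_self_eq_0[OF H(3)])
  then show "g' = g" by (metis eq_iff_diff_eq_0 ext)
qed

lemma model_proj:
  assumes f: "f \<in> H2"
  shows model_proj_mem: "model_proj \<theta> f \<in> model_space \<theta>"
    and model_proj_orth: "h \<in> model_space \<theta> \<Longrightarrow> H2_inner (\<lambda>z. f z - model_proj \<theta> f z) h = 0"
proof -
  obtain g where g: "g \<in> model_space \<theta>" "\<forall>h\<in>model_space \<theta>. H2_inner (\<lambda>z. f z - g z) h = 0"
    using H2.projection[OF model_closed f] by blast
  then have "model_proj \<theta> f = g" by (rule model_proj_unique[OF f])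
  then show "model_proj \<theta> f \<in> model_space \<theta>"
    and "h \<in> model_space \<theta> \<Longrightarrow> H2_inner (\<lambda>z. f z - model_proj \<theta> f z) h = 0" using g by auto
qed

lemma model_proj_ip:
  assumes "f \<in> H2" "h \<in> model_space \<theta>"
  shows "H2_inner (model_proj \<theta> f) h = H2_inner f h"
  using model_proj_orth[OF assms] H2.ip_diff[OF assms(1) model_H2[OF model_proj_mem[OF assms(1)]] model_H2[OF assms(2)]]
  by simp

text \<open>The subspace \<open>\<theta> H2\<close> is invariant under multiplication by
  \<open>p\<close>, so its orthogonal complement is invariant under the adjoint.\<close>

lemma bshift_model:
  assumes p: "coord p" and f: "f \<in> model_space \<theta>"
  shows "bshift p f \<in> model_space \<theta>"
  unfolding model_iff
proof (intro conjI ballI)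
  have fH: "f \<in> H2" by (rule model_H2[OF f])
  then show b: "bshift p f \<in> H2" by (rule bshift_mem)
  fix g assume g: "g \<in> H2"
  have m: "(\<lambda>z. \<theta> z * g z) \<in> H2" by (rule mult_mem[OF g])
  have "H2_inner (\<lambda>z. \<theta> z * g z) (bshift p f) = H2_inner (\<lambda>z. \<theta> z * (p z * g z)) f"
    using bshift_adjoint[OF p fH m] by (simp add: mult.left_commute)
  also have "\<dots> = cnj (H2_inner f (\<lambda>z. \<theta> z * (p z * g z)))"
    by (rule H2.ip_cnj[OF fH mult_mem[OF mult_coord_mem[OF p g]]])
  also have "\<dots> = 0" using f mult_coord_mem[OF p g] unfolding model_iff by simp
  finally show "H2_inner (bshift p f) (\<lambda>z. \<theta> z * g z) = 0" using H2.ip_cnj[OF m b] by simp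
qed

lemma comp_shift:
  assumes p: "coord p" and f: "f \<in> model_space \<theta>"
  shows comp_shift_mem: "comp_shift \<theta> p f \<in> model_space \<theta>"
    and comp_shift_ip: "h \<in> model_space \<theta> \<Longrightarrow> H2_inner (comp_shift \<theta> p f) h = H2_inner (\<lambda>z. p z * f z) h"
  unfolding comp_shift_def mult_coord_def
  using model_proj_mem[OF mult_coord_mem[OF p model_H2[OF f]]] model_proj_ip[OF mult_coord_mem[OF p model_H2[OF f]]]
  by auto

text \<open>Against elements of the model space the projection inside \<open>comp_shift\<close>
  disappears, leaving the adjoint of multiplication by \<open>p\<close>, which by
  \<open>bshift_model\<close> never leaves the model space.\<close>

lemma comp_shift_adj_eq:
  assumes p: "coord p" and f: "f \<in> model_space \<theta>"
  shows "comp_shift_adj \<theta> p f = bshift p f"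
  unfolding comp_shift_adj_def
proof (rule the_equality)
  have e: "H2_inner (comp_shift \<theta> p h) f = H2_inner h (bshift p f)" if "h \<in> model_space \<theta>" for h
    using comp_shift_ip[OF p that f] bshift_adjoint[OF p model_H2[OF f] model_H2[OF that]] by simp
  then show "bshift p f \<in> model_space \<theta> \<and>
      (\<forall>h\<in>model_space \<theta>. H2_inner (comp_shift \<theta> p h) f = H2_inner h (bshift p f))"
    using bshift_model[OF p f] by simp
  fix g assume g: "g \<in> model_space \<theta> \<and> (\<forall>h\<in>model_space \<theta>. H2_inner (comp_shift \<theta> p h) f = H2_inner h g)"
  let ?d = "\<lambda>z. g z - bshift p f z"
  have d: "?d \<in> model_space \<theta>" using g bshift_model[OF p f] by (intro model_diff) auto
  have "H2_inner ?d ?d = H2_inner ?d g - H2_inner ?d (bshift p f)"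
    using g d bshift_model[OF p f] by (intro H2.ip_diff_right model_H2) auto
  also have "\<dots> = 0" using g e[OF d] d by simp
  finally have "?d = (\<lambda>_. 0)" by (rule H2.ip_self_eq_0[OF model_H2[OF d]])
  then show "g = bshift p f" by (metis eq_iff_diff_eq_0 ext)
qed

definition model_kernel :: "complex \<times> complex \<Rightarrow> complex \<times> complex \<Rightarrow> complex"
  where "model_kernel z w = (1 - \<theta> z * cnj (\<theta> w)) * szego z w"

lemma on_bidisk_model_kernel:
  "on_bidisk (\<lambda>z. model_kernel z w)
    = (\<lambda>z. H2.kernel_fun w z - cnj (\<theta> w) * (\<theta> z * H2.kernel_fun w z))"
  by (auto simp: on_bidisk_def model_kernel_def H2.kernel_fun_def algebra_simps)

text \<open>The kernel is the Szego kernel at \<open>w\<close> minus its projection to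
  \<open>\<theta> H2\<close>; by the isometry that projection is
  \<open>cnj (\<theta> w) \<theta>\<close> times the Szego kernel.\<close>

lemma model_kernel:
  assumes w: "w \<in> bidisk"
  shows model_kernel_mem: "on_bidisk (\<lambda>z. model_kernel z w) \<in> model_space \<theta>"
    and model_kernel_ip: "f \<in> model_space \<theta> \<Longrightarrow> H2_inner f (on_bidisk (\<lambda>z. model_kernel z w)) = f w"
proof -
  let ?s = "H2.kernel_fun w"
  have s: "?s \<in> H2" by (rule H2.kernel_fun_mem[OF w])
  have ts: "(\<lambda>z. \<theta> z * ?s z) \<in> H2" by (rule mult_mem[OF s])
  have cts: "(\<lambda>z. cnj (\<theta> w) * (\<theta> z * ?s z)) \<in> H2" by (rule H2.scale_mem[OF ts])
  have sg: "H2_inner ?s g = cnj (g w)" if "g \<in> H2" for g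
    using H2.ip_cnj[OF that s] H2.ip_kernel_fun[OF that w] by simp
  show "on_bidisk (\<lambda>z. model_kernel z w) \<in> model_space \<theta>"
    unfolding model_iff on_bidisk_model_kernel
  proof (intro conjI ballI)
    show "(\<lambda>z. ?s z - cnj (\<theta> w) * (\<theta> z * ?s z)) \<in> H2" by (rule H2.diff_mem[OF s cts])
    fix g assume g: "g \<in> H2"
    have "H2_inner (\<lambda>z. ?s z - cnj (\<theta> w) * (\<theta> z * ?s z)) (\<lambda>z. \<theta> z * g z)
        = cnj (\<theta> w * g w) - cnj (\<theta> w) * H2_inner (\<lambda>z. \<theta> z * ?s z) (\<lambda>z. \<theta> z * g z)"
      by (simp add: H2.ip_diff[OF s cts mult_mem[OF g]] H2.ip_scale[OF ts mult_mem[OF g]] sg[OF mult_mem[OF g]])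
    also have "\<dots> = 0" by (simp add: isometry[OF s g] sg[OF g])
    finally show "H2_inner (\<lambda>z. ?s z - cnj (\<theta> w) * (\<theta> z * ?s z)) (\<lambda>z. \<theta> z * g z) = 0" .
  qed
  assume f: "f \<in> model_space \<theta>"
  have "H2_inner f (\<lambda>z. ?s z - cnj (\<theta> w) * (\<theta> z * ?s z)) = f w - \<theta> w * H2_inner f (\<lambda>z. \<theta> z * ?s z)"
    by (simp add: H2.ip_diff_right[OF s cts model_H2[OF f]] H2.ip_scale_right[OF ts model_H2[OF f]]
        H2.ip_kernel_fun[OF model_H2[OF f] w])
  then show "H2_inner f (on_bidisk (\<lambda>z. model_kernel z w)) = f w"
    unfolding on_bidisk_model_kernel using f s unfolding model_iff by simp
qed

lemma rkhs_model_space: "rkhs bidisk (model_space \<theta>) H2_inner model_kernel"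
  by (rule H2.rkhs_closed_sub[OF model_closed])
    (use model_kernel_mem model_kernel_ip in \<open>simp_all only: on_bidisk_def\<close>)

lemma rkhs_reducingI:
  assumes p: "coord p" and S: "H2.closed_sub S" "S \<subseteq> model_space \<theta>"
    and L: "\<And>w. w \<in> bidisk \<Longrightarrow> on_bidisk (\<lambda>z. L z w) \<in> S"
      "\<And>f w. f \<in> S \<Longrightarrow> w \<in> bidisk \<Longrightarrow> H2_inner f (on_bidisk (\<lambda>z. L z w)) = f w"
    and red: "\<And>f. f \<in> S \<Longrightarrow> comp_shift \<theta> p f \<in> S" "\<And>f. f \<in> S \<Longrightarrow> bshift p f \<in> S"
  shows "rkhs_reducing \<theta> p L"
  unfolding rkhs_reducing_def
proof (intro exI conjI)
  show "rkhs bidisk S H2_inner L"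
    by (rule H2.rkhs_closed_sub[OF S(1)]) (use L in \<open>simp_all only: on_bidisk_def\<close>)
  show "closed_model_subspace \<theta> S" unfolding closed_model_subspace_iff using S by simp
  show "comp_shift \<theta> p ` S \<subseteq> S" using red by auto
  show "comp_shift_adj \<theta> p ` S \<subseteq> S" using red S(2) comp_shift_adj_eq[OF p] by auto
qed simp

text \<open>Equality of norms gives equality of inner products by polarization, so the abstract
  space can be treated as a closed subspace of \<open>H2\<close> with its own reproducing
  functions.\<close>

lemma rkhs_reducingD:
  assumes p: "coord p" and "rkhs_reducing \<theta> p L"
  shows "\<exists>S. H2.closed_sub S \<and> S \<subseteq> model_space \<theta> \<and>
    (\<forall>w\<in>bidisk. on_bidisk (\<lambda>z. L z w) \<in> S) \<and>
    (\<forall>f\<in>S. \<forall>w\<in>bidisk. H2_inner f (on_bidisk (\<lambda>z. L z w)) = f w) \<and>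
    (\<forall>f\<in>S. bshift p f \<in> S)"
proof -
  from assms(2) obtain S ip where S: "rkhs bidisk S ip L" "closed_model_subspace \<theta> S"
    "\<forall>f\<in>S. ip_norm ip f = H2.nrm f" "comp_shift_adj \<theta> p ` S \<subseteq> S"
    unfolding rkhs_reducing_def by blast
  interpret S: rkhs bidisk S ip L by (rule S(1))
  have cl: "H2.closed_sub S" "S \<subseteq> model_space \<theta>" using S(2) unfolding closed_model_subspace_iff by auto
  have SH: "f \<in> H2" if "f \<in> S" for f using that cl(2) model_H2 by blast
  have eq: "ip f g = H2_inner f g" if "f \<in> S" "g \<in> S" for f g
    by (rule ip_eq_of_norm_eq[OF S(1) H2.rkhs_axioms that SH[OF that(1)] SH[OF that(2)]])
      (rule bspec[OF S(3)], rule S.diff_mem[OF that(1) S.scale_mem[OF that(2)]])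
  have mem: "on_bidisk (\<lambda>z. L z w) \<in> S" if "w \<in> bidisk" for w
    using S.kernel_mem[OF that] unfolding on_bidisk_def .
  show ?thesis
  proof (intro exI[of _ S] conjI ballI cl mem)
    show "H2_inner f (on_bidisk (\<lambda>z. L z w)) = f w" if "f \<in> S" "w \<in> bidisk" for f w
      using S.reproducing[OF that] eq[OF that(1) mem[OF that(2)]] unfolding on_bidisk_def by simp
    show "bshift p f \<in> S" if "f \<in> S" for f
    proof -
      have "comp_shift_adj \<theta> p f \<in> S" using S(4) that by blast
      then show ?thesis using comp_shift_adj_eq[OF p] cl(2) that by auto
    qed
  qed
qed

end


section \<open>Wandering subspaces\<close>

text \<open>An ordered pair of distinct coordinates. Exchanging the two turns each result about
  \<open>S\<^sub>z\<^sub>1\<close> into the one about \<open>S\<^sub>z\<^sub>2\<close>.\<close>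

definition coords :: "(complex \<times> complex \<Rightarrow> complex) \<Rightarrow> (complex \<times> complex \<Rightarrow> complex) \<Rightarrow> bool"
  where "coords p q \<longleftrightarrow> p = fst \<and> q = snd \<or> p = snd \<and> q = fst"

lemma coords:
  assumes "coords p q"
  shows coords_left: "coord p" and coords_right: "coord q"
    and coords_zero_left: "p (coord_zero p z) = 0" and coords_zero_left': "q (coord_zero p z) = q z"
    and coords_zero_right: "q (coord_zero q z) = 0" and coords_zero_right': "p (coord_zero q z) = p z"
    and coords_zero_eq: "q z = q w \<Longrightarrow> coord_zero p z = coord_zero p w"
    and coords_zero_zero: "coord_zero p (coord_zero q z) = (0, 0)"
    and coords_szego: "szego z w = 1 / ((1 - p z * cnj (p w)) * (1 - q z * cnj (q w)))"
    and coords_less: "z \<in> bidisk \<Longrightarrow> cmod (p z) < 1" "z \<in> bidisk \<Longrightarrow> cmod (q z) < 1"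
  using assms fst_neq_snd
  by (auto simp: coords_def coord_def coord_zero_def szego_def bidisk_iff mult.commute split: if_splits)

lemma one_minus_neq_0: "cmod a < 1 \<Longrightarrow> cmod b < 1 \<Longrightarrow> 1 - a * cnj b \<noteq> 0"
  using cmod_mult_less_1[of a "cnj b"] by auto

lemma bshift_norm_le:
  assumes "coord p" "f \<in> H2"
  shows "H2.nrm (bshift p f) \<le> H2.nrm f"
proof -
  have b: "bshift p f \<in> H2" "(\<lambda>z. p z * bshift p f z) \<in> H2" using assms bshift_mem mult_coord_mem by auto
  have e: "H2_inner (bshift p f) (bshift p f) = H2_inner (\<lambda>z. p z * bshift p f z) f"
    using bshift_adjoint[OF assms b(1)] by simp
  have n: "H2.nrm (\<lambda>z. p z * bshift p f z) = H2.nrm (bshift p f)"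
    unfolding ip_norm_def mult_coord_isometry[OF assms(1) b(1) b(1)] ..
  have "(H2.nrm (bshift p f))\<^sup>2 = Re (H2_inner (\<lambda>z. p z * bshift p f z) f)"
    using H2.nrm_sq[OF b(1)] e by simp
  also have "\<dots> \<le> cmod (H2_inner (\<lambda>z. p z * bshift p f z) f)" by (rule complex_Re_le_cmod)
  also have "\<dots> \<le> H2.nrm (bshift p f) * H2.nrm f"
    using H2.cauchy_schwarz[OF b(2) assms(2)] n by simp
  finally show ?thesis using H2.nrm_nonneg[OF b(1)] H2.nrm_nonneg[OF assms(2)]
    by (cases "H2.nrm (bshift p f) = 0") (auto simp: power2_eq_square)
qed

text \<open>A function independent of \<open>p\<close> is a power series in \<open>q\<close>; its
  iterated backward shifts are the successive remainders, and \<open>F k (0, 0)\<close> is the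
  coefficient of order \<open>k\<close>.\<close>

lemma bshift_powers:
  assumes pq: "coords p q" and f: "f \<in> H2" "coord_indep p f"
  defines "F \<equiv> \<lambda>k. (bshift q ^^ k) f"
  shows "F k \<in> H2" "coord_indep p (F k)" "H2.nrm (F k) \<le> H2.nrm f"
    and "z \<in> bidisk \<Longrightarrow> F k z = F k (0, 0) + q z * F (Suc k) z"
    and "(\<And>j. j < k \<Longrightarrow> F j (0, 0) = 0) \<Longrightarrow> z \<in> bidisk \<Longrightarrow> f z = q z ^ k * F k z"
proof -
  have c: "coord p" "coord q" using coords_left[OF pq] coords_right[OF pq] .
  have *: "F k \<in> H2 \<and> coord_indep p (F k) \<and> H2.nrm (F k) \<le> H2.nrm f" for k
  proof (induction k)
    case (Suc k)
    then show ?case using bshift_mem bshift_coord_indep[OF c] bshift_norm_le[OF c(2), of "F k"]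
      unfolding F_def by (auto intro: order_trans)
  qed (simp add: F_def f)
  then show "F k \<in> H2" "coord_indep p (F k)" "H2.nrm (F k) \<le> H2.nrm f" by auto
  have dec: "F k z = F k (0, 0) + q z * F (Suc k) z" if z: "z \<in> bidisk" for z k
  proof -
    have "F k z = F k (coord_zero q z) + q z * F (Suc k) z"
      using bshift_decomp[OF c(2) conjunct1[OF *[of k]] z] unfolding F_def by simp
    also have "F k (coord_zero q z) = F k (coord_zero p (coord_zero q z))"
      using * z coord_zero_bidisk unfolding coord_indep_def by blast
    finally show ?thesis by (simp only: coords_zero_zero[OF pq])
  qed
  then show "z \<in> bidisk \<Longrightarrow> F k z = F k (0, 0) + q z * F (Suc k) z" .
  show "(\<And>j. j < k \<Longrightarrow> F j (0, 0) = 0) \<Longrightarrow> z \<in> bidisk \<Longrightarrow> f z = q z ^ k * F k z"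
  proof (induction k)
    case (Suc k)
    then have "f z = q z ^ k * F k z" by simp
    also have "F k z = q z * F (Suc k) z" using dec[OF Suc.prems(2), of k] Suc.prems(1)[of k] by simp
    finally show ?case by (simp add: mult_ac)
  qed (simp add: F_def)
qed

text \<open>If all coefficients vanished, \<open>f z\<close> would be \<open>q z ^ k\<close> times
  the \<open>k\<close>-th remainder for every \<open>k\<close>. Remainders do not grow in norm,
  hence not at the point \<open>z\<close>, and \<open>|q z| < 1\<close>.\<close>

lemma bshift_powers_nonzero:
  assumes pq: "coords p q" and f: "f \<in> H2" "coord_indep p f" "f \<noteq> (\<lambda>_. 0)"
  shows "\<exists>k. (bshift q ^^ k) f (0, 0) \<noteq> 0"
proof (rule ccontr)
  assume "\<not> ?thesis"
  then have 0: "(bshift q ^^ k) f (0, 0) = 0" for k by blast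
  have "f z = 0" if z: "z \<in> bidisk" for z
  proof -
    have le: "cmod (f z) \<le> cmod (q z) ^ k * (H2.nrm f * H2.nrm (H2.kernel_fun z))" for k
    proof -
      let ?F = "(bshift q ^^ k) f"
      note b = bshift_powers[OF pq f(1,2), where k = k]
      have "cmod (?F z) \<le> H2.nrm ?F * H2.nrm (H2.kernel_fun z)"
        using H2.cauchy_schwarz[OF b(1) H2.kernel_fun_mem[OF z]] H2.ip_kernel_fun[OF b(1) z] by simp
      also have "\<dots> \<le> H2.nrm f * H2.nrm (H2.kernel_fun z)"
        by (intro mult_right_mono b(3) H2.nrm_nonneg H2.kernel_fun_mem[OF z])
      finally show ?thesis using b(5)[OF _ z] 0 by (simp add: norm_mult norm_power mult_left_mono)
    qed
    have "(\<lambda>k. cmod (q z) ^ k * (H2.nrm f * H2.nrm (H2.kernel_fun z))) \<longlonglongrightarrow> 0"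
      using coords_less(2)[OF pq z] by (intro tendsto_mult_left_zero LIMSEQ_realpow_zero) auto
    then have "cmod (f z) \<le> 0" by (rule LIMSEQ_le_const) (use le in blast)
    then show ?thesis by simp
  qed
  then show False using H2_eq_zeroI[OF f(1)] f(3) by blast
qed

lemma on_bidisk_H2:
  assumes f: "f \<in> H2"
  shows "on_bidisk f = f"
proof
  fix z
  show "on_bidisk f z = f z"
    unfolding on_bidisk_def using bidisk_not[OF _ f, of z] by (cases "z \<in> bidisk") (simp_all del: mem_Times_iff)
qed

text \<open>Shift invariance puts \<open>f\<close> times any monomial into the complement.
  Orthogonality to a fixed \<open>u\<close> is a closed condition on the other factor since
  \<open>f\<close> is bounded, so every \<open>h\<close> in \<open>H2\<close> is reached.\<close>

lemma bounded_mult_orth: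
  assumes S: "S \<subseteq> H2"
    and inv: "\<And>p h. coord p \<Longrightarrow> h \<in> H2.orth S \<Longrightarrow> (\<lambda>z. p z * h z) \<in> H2.orth S"
    and f: "f \<in> H2.orth S" "\<And>z. z \<in> bidisk \<Longrightarrow> cmod (f z) \<le> C" and h: "h \<in> H2"
  shows "(\<lambda>z. f z * h z) \<in> H2.orth S"
proof -
  have fH: "f \<in> H2" using f(1) unfolding H2.orth_def by simp
  then have fb: "on_bidisk f \<in> H2" using on_bidisk_H2 by simp
  have mono: "(\<lambda>z. f z * mono_fun i z) \<in> H2.orth S" for i
  proof (rule mono_fun_induct)
    have "(\<lambda>z. f z * mono_fun (0, 0) z) = f"
    proof
      fix z show "f z * mono_fun (0, 0) z = f z"
        using bidisk_not[OF _ fH, of z] by (cases "z \<in> bidisk") (simp_all only: mono_fun_def mono2_def if_True if_False, simp_all)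
    qed
    then show "(\<lambda>z. f z * mono_fun (0, 0) z) \<in> H2.orth S" using f(1) by simp
    show "(\<lambda>z. f z * (p z * h z)) \<in> H2.orth S" if "coord p" "(\<lambda>z. f z * h z) \<in> H2.orth S" for p h
      using inv[OF that] by (simp add: mult.left_commute)
  qed
  have "H2_inner (\<lambda>z. f z * h z) u = 0" if u: "u \<in> S" for u
  proof -
    have uH: "u \<in> H2" using u S by blast
    have "{h \<in> H2. H2_inner (\<lambda>z. f z * h z) u = H2_inner h (\<lambda>_. 0)} = H2"
    proof (rule mono_fun_total[OF closed_sub_ip_eq[OF fb f(2) uH H2.zero_mem]])
      show "mono_fun i \<in> {h \<in> H2. H2_inner (\<lambda>z. f z * h z) u = H2_inner h (\<lambda>_. 0)}" for i
        using mono[of i] u mono_fun_mem[of i] H2.ip_zero_right[OF mono_fun_mem] unfolding H2.orth_def by simp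
    qed
    then have "h \<in> {h \<in> H2. H2_inner (\<lambda>z. f z * h z) u = H2_inner h (\<lambda>_. 0)}" using h by simp
    then show ?thesis using H2.ip_zero_right[OF h] by simp
  qed
  then show ?thesis unfolding H2.orth_def using bounded_mult_mem[OF fb f(2) h] by simp
qed

text \<open>The wandering subspace of a shift invariant subspace of the one variable Hardy space is at
  most one-dimensional. If \<open>f = q\<^sup>k (c + q u)\<close> and \<open>g = q\<^sup>k (d + q v)\<close> are bounded, then
  \<open>c g - d f = q (f v - g u)\<close> lies both in \<open>q N\<close> and in its orthogonal complement.\<close>

lemma wandering_dependent:
  assumes pq: "coords p q" and S: "S \<subseteq> H2"
    and inv: "\<And>p h. coord p \<Longrightarrow> h \<in> H2.orth S \<Longrightarrow> (\<lambda>z. p z * h z) \<in> H2.orth S"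
    and f: "f \<in> H2.orth S" "coord_indep p f" "\<And>z. z \<in> bidisk \<Longrightarrow> cmod (f z) \<le> C"
    and fo: "\<And>h. h \<in> H2.orth S \<Longrightarrow> H2_inner (\<lambda>z. q z * h z) f = 0"
    and g: "g \<in> H2.orth S" "coord_indep p g" "\<And>z. z \<in> bidisk \<Longrightarrow> cmod (g z) \<le> D"
    and go: "\<And>h. h \<in> H2.orth S \<Longrightarrow> H2_inner (\<lambda>z. q z * h z) g = 0"
    and k: "(bshift q ^^ k) f (0, 0) \<noteq> 0"
      "\<And>j. j < k \<Longrightarrow> (bshift q ^^ j) f (0, 0) = 0" "\<And>j. j < k \<Longrightarrow> (bshift q ^^ j) g (0, 0) = 0"
  shows "\<exists>a b. b \<noteq> 0 \<and> (\<forall>z. b * g z = a * f z)"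
proof -
  have N: "fun_subspace (H2.orth S)" by (rule H2.closed_subD(2)[OF H2.closed_sub_orth[OF S]])
  have fH: "f \<in> H2" and gH: "g \<in> H2" using f(1) g(1) unfolding H2.orth_def by auto
  define c where "c = (bshift q ^^ k) f (0, 0)"
  define d where "d = (bshift q ^^ k) g (0, 0)"
  define u where "u = (bshift q ^^ Suc k) f"
  define v where "v = (bshift q ^^ Suc k) g"
  have uv: "u \<in> H2" "v \<in> H2" unfolding u_def v_def
    using bshift_powers(1)[OF pq fH f(2)] bshift_powers(1)[OF pq gH g(2)] by blast+
  define h where "h = (\<lambda>z. f z * v z - g z * u z)"
  have hN: "h \<in> H2.orth S"
    unfolding h_def
    by (rule fun_subspace_diff[OF N bounded_mult_orth[OF S inv f(1,3) uv(2)] bounded_mult_orth[OF S inv g(1,3) uv(1)]])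
  define x where "x = (\<lambda>z. c * g z - d * f z)"
  have xN: "x \<in> H2.orth S"
    unfolding x_def by (intro fun_subspace_diff[OF N] fun_subspace_scale[OF N] f g)
  then have xH: "x \<in> H2" unfolding H2.orth_def by simp
  have hH: "h \<in> H2" using hN unfolding H2.orth_def by simp
  have "x z = q z * h z" for z
  proof (cases "z \<in> bidisk")
    case True
    have "f z = q z ^ k * (c + q z * u z)"
      using bshift_powers(5)[OF pq fH f(2) k(2) True] bshift_powers(4)[OF pq fH f(2) True, of k]
      unfolding c_def u_def by simp
    moreover have "g z = q z ^ k * (d + q z * v z)"
      using bshift_powers(5)[OF pq gH g(2) k(3) True] bshift_powers(4)[OF pq gH g(2) True, of k]
      unfolding d_def v_def by simp
    ultimately show ?thesis unfolding x_def h_def by (simp add: algebra_simps)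
  next
    case False
    then show ?thesis using bidisk_not[OF False xH] bidisk_not[OF False hH] by simp
  qed
  then have xq: "x = (\<lambda>z. q z * h z)" by (rule ext)
  have qh: "(\<lambda>z. q z * h z) \<in> H2" using xq xH by simp
  have "H2_inner (\<lambda>z. q z * h z) x = cnj c * 0 - cnj d * 0"
    unfolding x_def
    using H2.ip_diff_right[OF H2.scale_mem[OF gH] H2.scale_mem[OF fH] qh, of c d]
      H2.ip_scale_right[OF gH qh, of c] H2.ip_scale_right[OF fH qh, of d] fo[OF hN] go[OF hN] by simp
  then have "H2_inner x x = 0" using xq by simp
  then have "x = (\<lambda>_. 0)" by (rule H2.ip_self_eq_0[OF xH])
  then have "c * g z = d * f z" for z unfolding x_def by (metis eq_iff_diff_eq_0)
  then show ?thesis using k(1) unfolding c_def by blast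
qed

text \<open>\<open>k\<close> and \<open>l\<close> are the orders of vanishing at the origin in the
  variable \<open>q\<close>. In \<open>wandering_dependent\<close> the function of smaller order has
  to be the first one, which makes the two cases.\<close>

lemma wandering_rank_one:
  assumes pq: "coords p q" and S: "S \<subseteq> H2"
    and inv: "\<And>p h. coord p \<Longrightarrow> h \<in> H2.orth S \<Longrightarrow> (\<lambda>z. p z * h z) \<in> H2.orth S"
    and f: "f \<in> H2.orth S" "coord_indep p f" "\<And>z. z \<in> bidisk \<Longrightarrow> cmod (f z) \<le> C"
    and fo: "\<And>h. h \<in> H2.orth S \<Longrightarrow> H2_inner (\<lambda>z. q z * h z) f = 0"
    and g: "g \<in> H2.orth S" "coord_indep p g" "\<And>z. z \<in> bidisk \<Longrightarrow> cmod (g z) \<le> D"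
    and go: "\<And>h. h \<in> H2.orth S \<Longrightarrow> H2_inner (\<lambda>z. q z * h z) g = 0"
  shows "f z * g w = f w * g z"
proof (cases "f = (\<lambda>_. 0) \<or> g = (\<lambda>_. 0)")
  case False
  have fH: "f \<in> H2" and gH: "g \<in> H2" using f(1) g(1) unfolding H2.orth_def by auto
  define k where "k = (LEAST k. (bshift q ^^ k) f (0, 0) \<noteq> 0)"
  define l where "l = (LEAST k. (bshift q ^^ k) g (0, 0) \<noteq> 0)"
  have k: "(bshift q ^^ k) f (0, 0) \<noteq> 0"
    unfolding k_def by (rule LeastI_ex) (use False bshift_powers_nonzero[OF pq fH f(2)] in blast)
  have l: "(bshift q ^^ l) g (0, 0) \<noteq> 0"
    unfolding l_def by (rule LeastI_ex) (use False bshift_powers_nonzero[OF pq gH g(2)] in blast)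
  have kj: "(bshift q ^^ j) f (0, 0) = 0" if "j < k" for j using not_less_Least that unfolding k_def by blast
  have lj: "(bshift q ^^ j) g (0, 0) = 0" if "j < l" for j using not_less_Least that unfolding l_def by blast
  show ?thesis
  proof (cases "k \<le> l")
    case True
    have "\<exists>a b. b \<noteq> 0 \<and> (\<forall>z. b * g z = a * f z)"
      by (rule wandering_dependent[OF pq S inv f fo g go k]) (use kj lj True in auto)
    then obtain a b where ab: "b \<noteq> 0" "\<And>z. b * g z = a * f z" by blast
    have "f z * (b * g w) = f w * (b * g z)" unfolding ab(2) by (simp add: mult_ac)
    then have "b * (f z * g w) = b * (f w * g z)" by (simp only: mult.left_commute)
    then show ?thesis using ab(1) by simp
  next
    case False
    have "\<exists>a b. b \<noteq> 0 \<and> (\<forall>z. b * f z = a * g z)"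
      by (rule wandering_dependent[OF pq S inv g go f fo l]) (use kj lj False in auto)
    then obtain a b where ab: "b \<noteq> 0" "\<And>z. b * f z = a * g z" by blast
    have "g z * (b * f w) = g w * (b * f z)" unfolding ab(2) by (simp add: mult_ac)
    then have "b * (g z * f w) = b * (g w * f z)" by (simp only: mult.left_commute)
    then show ?thesis using ab(1) by (simp add: mult.commute)
  qed
qed auto

section \<open>Two point consequences of positivity\<close>

lemma positive_kernel_cong:
  "(\<And>x y. x \<in> X \<Longrightarrow> y \<in> X \<Longrightarrow> K x y = L x y) \<Longrightarrow> positive_kernel X K \<longleftrightarrow> positive_kernel X L"
  unfolding positive_kernel_def by (simp add: subset_iff cong: sum.cong)

lemma positive_kernel_pair:
  assumes "positive_kernel X K" "x \<in> X" "y \<in> X" "x \<noteq> y"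
  shows "cnj a * a * K x x + cnj a * b * K x y + (cnj b * a * K y x + cnj b * b * K y y) \<in> \<real>\<^sub>\<ge>\<^sub>0"
proof -
  have "(\<Sum>u\<in>{x, y}. \<Sum>v\<in>{x, y}. cnj (if u = x then a else b) * (if v = x then a else b) * K u v) \<in> \<real>\<^sub>\<ge>\<^sub>0"
    using assms(1) unfolding positive_kernel_def
    by (elim allE[of _ "{x, y}"] allE[of _ "\<lambda>u. if u = x then a else b"]) (use assms in auto)
  then show ?thesis using assms(4) by simp
qed

lemma positive_kernel_diag: "positive_kernel X K \<Longrightarrow> x \<in> X \<Longrightarrow> K x x \<in> \<real>\<^sub>\<ge>\<^sub>0"
  unfolding positive_kernel_def by (elim allE[of _ "{x}"] allE[of _ "\<lambda>_. 1"]) simp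

text \<open>The form is tested at \<open>(a, 1)\<close>, where the unimodular \<open>a\<close> turns
  both off-diagonal terms into \<open>- |K x y|\<close>, so that twice the modulus is at most the
  sum of the diagonal values.\<close>

lemma positive_kernel_bound:
  assumes K: "positive_kernel X K" and xy: "x \<in> X" "y \<in> X" and h: "K y x = cnj (K x y)"
    and le: "Re (K x x) \<le> c" "Re (K y y) \<le> c"
  shows "cmod (K x y) \<le> c"
proof (cases "x = y \<or> K x y = 0")
  case True
  have "K x x \<in> \<real>\<^sub>\<ge>\<^sub>0" by (rule positive_kernel_diag[OF K xy(1)])
  then have "cmod (K x x) = Re (K x x)" "0 \<le> Re (K x x)"
    by (auto simp: complex_nonneg_Reals_iff cmod_eq_Re)
  then show ?thesis using True le by auto
next
  case False
  define a where "a = - (K x y / of_real (cmod (K x y)))"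
  have 1: "cnj a * a = 1" unfolding a_def using False
    by (simp add: complex_norm_square[symmetric] mult.commute[of "cnj _"] power2_eq_square del: of_real_power)
  have 2: "cnj a * K x y = - of_real (cmod (K x y))" unfolding a_def using False
    by (simp add: complex_norm_square[symmetric] mult.commute[of "cnj _"] power2_eq_square del: of_real_power)
  then have "cnj (cnj a * K x y) = cnj (- of_real (cmod (K x y)))" by simp
  then have 3: "a * K y x = - of_real (cmod (K x y))" using h by simp
  have "cnj a * a * K x x + cnj a * 1 * K x y + (cnj 1 * a * K y x + cnj 1 * 1 * K y y) \<in> \<real>\<^sub>\<ge>\<^sub>0"
    by (rule positive_kernel_pair[OF K xy]) (use False in simp)
  then have "K x x - of_real (cmod (K x y)) + (- of_real (cmod (K x y)) + K y y) \<in> \<real>\<^sub>\<ge>\<^sub>0"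
    using 1 2 3 by simp
  then show ?thesis using le by (simp add: complex_nonneg_Reals_iff)
qed


section \<open>From reducing Agler spaces to a functional equation\<close>

context inner_bidisk
begin

text \<open>\<open>z'\<close> and \<open>w'\<close> arise from \<open>z\<close> and \<open>w\<close>
  by exchanging the \<open>q\<close> coordinates. Describing them by equations instead of pairs lets
  either coordinate play the role of \<open>p\<close>.\<close>

theorem mixed_product:
  assumes pq: "coords p q"
    and Kp: "positive_kernel bidisk Kp" and Kq: "positive_kernel bidisk Kq"
    and agler: "\<And>z w. z \<in> bidisk \<Longrightarrow> w \<in> bidisk \<Longrightarrow>
      1 - \<theta> z * cnj (\<theta> w) = (1 - p z * cnj (p w)) * Kq z w + (1 - q z * cnj (q w)) * Kp z w"
    and red_p: "rkhs_reducing \<theta> p (agler_space_kernel p Kp)"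
    and red_q: "rkhs_reducing \<theta> p (agler_space_kernel q Kq)"
    and z: "z \<in> bidisk" and w: "w \<in> bidisk" and z': "z' \<in> bidisk" and w': "w' \<in> bidisk"
    and mix: "p z' = p z" "q z' = q w" "p w' = p w" "q w' = q z"
  shows "\<theta> z * \<theta> w = \<theta> z' * \<theta> w'"
proof -
  note p = coords_left[OF pq] and q = coords_right[OF pq]
  define k1 where "k1 w = on_bidisk (\<lambda>z. Kp z w / (1 - p z * cnj (p w)))" for w
  define k2 where "k2 w = on_bidisk (\<lambda>z. Kq z w / (1 - q z * cnj (q w)))" for w
  obtain S1 where S1': "H2.closed_sub S1 \<and> S1 \<subseteq> model_space \<theta> \<and> (\<forall>w\<in>bidisk. k1 w \<in> S1) \<and>
      (\<forall>f\<in>S1. \<forall>w\<in>bidisk. H2_inner f (k1 w) = f w) \<and> (\<forall>f\<in>S1. bshift p f \<in> S1)"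
    using rkhs_reducingD[OF p red_p] unfolding agler_space_kernel_def k1_def by (elim exE)
  note S1 = S1'[THEN conjunct1] S1'[THEN conjunct2, THEN conjunct1]
    S1'[THEN conjunct2, THEN conjunct2, THEN conjunct1, THEN bspec]
    S1'[THEN conjunct2, THEN conjunct2, THEN conjunct2, THEN conjunct1, THEN bspec, THEN bspec]
    S1'[THEN conjunct2, THEN conjunct2, THEN conjunct2, THEN conjunct2, THEN bspec]
  obtain S2 where S2': "H2.closed_sub S2 \<and> S2 \<subseteq> model_space \<theta> \<and> (\<forall>w\<in>bidisk. k2 w \<in> S2) \<and>
      (\<forall>f\<in>S2. \<forall>w\<in>bidisk. H2_inner f (k2 w) = f w) \<and> (\<forall>f\<in>S2. bshift p f \<in> S2)"
    using rkhs_reducingD[OF p red_q] unfolding agler_space_kernel_def k2_def by (elim exE)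
  note S2 = S2'[THEN conjunct1] S2'[THEN conjunct2, THEN conjunct1]
    S2'[THEN conjunct2, THEN conjunct2, THEN conjunct1, THEN bspec]
    S2'[THEN conjunct2, THEN conjunct2, THEN conjunct2, THEN conjunct1, THEN bspec, THEN bspec]
    S2'[THEN conjunct2, THEN conjunct2, THEN conjunct2, THEN conjunct2, THEN bspec]
  have S1H: "f \<in> H2" if "f \<in> S1" for f using that S1(2) model_H2 by blast
  have S2H: "f \<in> H2" if "f \<in> S2" for f using that S2(2) model_H2 by blast
  have S1H': "S1 \<subseteq> H2" using S1H by blast
  have nzp: "1 - p z * cnj (p w) \<noteq> 0" and nzq: "1 - q z * cnj (q w) \<noteq> 0" if "z \<in> bidisk" "w \<in> bidisk" for z w
    using one_minus_neq_0 coords_less[OF pq] that by auto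
  have k1k2: "on_bidisk (\<lambda>z. model_kernel z w) = (\<lambda>z. k1 w z + k2 w z)" if w: "w \<in> bidisk" for w
  proof
    fix z
    show "on_bidisk (\<lambda>z. model_kernel z w) z = k1 w z + k2 w z"
    proof (cases "z \<in> bidisk")
      case True
      then show ?thesis using nzp[OF True w] nzq[OF True w] agler[OF True w]
        by (simp add: on_bidisk_def k1_def k2_def model_kernel_def coords_szego[OF pq] field_simps del: mem_Times_iff)
    next
      case False
      then show ?thesis unfolding on_bidisk_def k1_def k2_def by (simp only: if_False add_0)
    qed
  qed
  have model_eval: "f w = H2_inner f (k1 w) + H2_inner f (k2 w)" if f: "f \<in> model_space \<theta>" and w: "w \<in> bidisk" for f w
    using model_kernel_ip[OF w f] H2.ip_add_right[OF S1H[OF S1(3)[OF w]] S2H[OF S2(3)[OF w]] model_H2[OF f]]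
    unfolding k1k2[OF w] by simp
  \<comment> \<open>For \<open>f\<close> in \<open>S1\<close>, evaluation at \<open>w\<close> is
    already the pairing with \<open>k1 w\<close>, so the pairing with \<open>k2 w\<close> is 0. The
    projection of \<open>f\<close> to \<open>S2\<close> thus vanishes at every point.\<close>
  have S12: "H2_inner f g = 0" if f: "f \<in> S1" and g: "g \<in> S2" for f g
  proof -
    obtain f' where f': "f' \<in> S2" "\<forall>h\<in>S2. H2_inner (\<lambda>z. f z - f' z) h = 0"
      using H2.projection[OF S2(1) S1H[OF f]] by blast
    have "f' w = 0" if w: "w \<in> bidisk" for w
    proof -
      have "H2_inner f (k2 w) = 0" using model_eval[of f w] f S1 w by auto
      moreover have "H2_inner f (k2 w) = H2_inner f' (k2 w)"
        using f'(2) S2(3)[OF w] H2.ip_diff[OF S1H[OF f] S2H[OF f'(1)] S2H[OF S2(3)[OF w]]] by auto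
      ultimately show ?thesis using S2(4)[OF f'(1) w] by simp
    qed
    then have "f' = (\<lambda>_. 0)" using H2_eq_zeroI[OF S2H[OF f'(1)]] by blast
    then show ?thesis using f'(2) g by simp
  qed
  have pS1: "(\<lambda>z. p z * f z) \<in> S1" if f: "f \<in> S1" for f
  proof (rule H2.multiplier_closed_sub[OF S1(1) S1(3,4) _ f mult_coord_mem[OF p S1H[OF f]]])
    have "positive_kernel bidisk (\<lambda>z w. (1 - p z * cnj (p w)) * k1 w z) \<longleftrightarrow> positive_kernel bidisk Kp"
      using nzp by (intro positive_kernel_cong) (simp add: k1_def on_bidisk_def del: mem_Times_iff)
    then show "positive_kernel bidisk (\<lambda>z w. (1 - p z * cnj (p w)) * k1 w z)" using Kp by simp
  qed
  have qS2: "(\<lambda>z. q z * f z) \<in> S2" if f: "f \<in> S2" for f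
  proof (rule H2.multiplier_closed_sub[OF S2(1) S2(3,4) _ f mult_coord_mem[OF q S2H[OF f]]])
    have "positive_kernel bidisk (\<lambda>z w. (1 - q z * cnj (q w)) * k2 w z) \<longleftrightarrow> positive_kernel bidisk Kq"
      using nzq by (intro positive_kernel_cong) (simp add: k2_def on_bidisk_def del: mem_Times_iff)
    then show "positive_kernel bidisk (\<lambda>z w. (1 - q z * cnj (q w)) * k2 w z)" using Kq by simp
  qed
  have orth_iff: "h \<in> H2.orth S1 \<longleftrightarrow> h \<in> H2 \<and> (\<forall>f\<in>S1. H2_inner h f = 0)" for h
    unfolding H2.orth_def by simp
  \<comment> \<open>Dual to the invariance of \<open>S1\<close> under \<open>bshift p\<close>, which
    the reducing hypothesis supplies.\<close>
  have pN: "(\<lambda>z. p z * h z) \<in> H2.orth S1" if h: "h \<in> H2.orth S1" for h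
    using h mult_coord_mem[OF p] bshift_adjoint[OF p S1H] S1(5) unfolding orth_iff by simp
  \<comment> \<open>Write \<open>h = g + (h - g)\<close> with \<open>g\<close> its projection to the
    model space. Then \<open>g\<close> lies in \<open>S2\<close>, so \<open>q g\<close> does too and
    is orthogonal to \<open>S1\<close>; and \<open>q (h - g)\<close> is orthogonal to the model
    space because the latter is invariant under \<open>bshift q\<close>.\<close>
  have qN: "(\<lambda>z. q z * h z) \<in> H2.orth S1" if h: "h \<in> H2.orth S1" for h
    unfolding orth_iff
  proof (intro conjI ballI)
    have hH: "h \<in> H2" using h unfolding orth_iff by simp
    then show qh: "(\<lambda>z. q z * h z) \<in> H2" by (rule mult_coord_mem[OF q])
    fix f assume f: "f \<in> S1"
    have fK: "f \<in> model_space \<theta>" using f S1(2) by blast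
    define g where "g = model_proj \<theta> h"
    have g: "g \<in> model_space \<theta>" and gH: "g \<in> H2"
      unfolding g_def using model_proj_mem[OF hH] model_H2 by auto
    have hg: "H2_inner (\<lambda>z. h z - g z) u = 0" if "u \<in> model_space \<theta>" for u
      unfolding g_def by (rule model_proj_orth[OF hH that])
    have gS1: "H2_inner g u = 0" if "u \<in> S1" for u
      using model_proj_ip[OF hH, of u] S1(2) that h unfolding g_def orth_iff by auto
    obtain g' where g': "g' \<in> S2" "\<forall>u\<in>S2. H2_inner (\<lambda>z. g z - g' z) u = 0"
      using H2.projection[OF S2(1) gH] by blast
    have g'K: "g' \<in> model_space \<theta>" using g'(1) S2(2) by blast
    have "(\<lambda>z. g z - g' z) = (\<lambda>_. 0)"
    proof (rule H2_eq_zeroI[OF H2.diff_mem[OF gH S2H[OF g'(1)]]])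
      fix w :: "complex \<times> complex" assume w: "w \<in> bidisk"
      have "H2_inner (\<lambda>z. g z - g' z) (k1 w) = 0"
        using H2.ip_diff[OF gH S2H[OF g'(1)] S1H[OF S1(3)[OF w]]] gS1[OF S1(3)[OF w]]
          S12[OF S1(3)[OF w] g'(1)] H2.ip_cnj[OF S1H[OF S1(3)[OF w]] S2H[OF g'(1)]] by simp
      then show "g w - g' w = 0"
        using model_eval[OF model_diff[OF g g'K] w] g'(2) S2(3)[OF w] by simp
    qed
    then have "g = g'" by (metis eq_iff_diff_eq_0 ext)
    then have qg: "(\<lambda>z. q z * g z) \<in> S2" using qS2 g'(1) by simp
    have 1: "H2_inner (\<lambda>z. q z * g z) f = 0"
      using S12[OF f qg] H2.ip_cnj[OF S1H[OF f] S2H[OF qg]] by simp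
    have "H2_inner (\<lambda>z. q z * (h z - g z)) f = H2_inner (\<lambda>z. h z - g z) (bshift q f)"
      by (rule bshift_adjoint[OF q S1H[OF f] H2.diff_mem[OF hH gH]])
    also have "\<dots> = 0" by (rule hg[OF bshift_model[OF q fK]])
    finally have 2: "H2_inner (\<lambda>z. q z * (h z - g z)) f = 0" .
    have "H2_inner (\<lambda>z. q z * h z - q z * g z) f = H2_inner (\<lambda>z. q z * h z) f - H2_inner (\<lambda>z. q z * g z) f"
      by (rule H2.ip_diff[OF qh S2H[OF qg] S1H[OF f]])
    then show "H2_inner (\<lambda>z. q z * h z) f = 0" using 1 2 by (simp add: right_diff_distrib)
  qed
  have inv: "(\<lambda>z. r z * h z) \<in> H2.orth S1" if "coord r" "h \<in> H2.orth S1" for r h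
  proof -
    have "r = p \<or> r = q" using that(1) pq unfolding coord_def coords_def by auto
    then show ?thesis using pN qN that(2) by blast
  qed

  have Kp_indep: "Kp z w = Kp (coord_zero p z) w" if z: "z \<in> bidisk" and w: "w \<in> bidisk" for z w
  proof -
    \<comment> \<open>\<open>?G\<close> is \<open>z \<mapsto> Kp z w\<close>. Both terms of
      \<open>H2_inner (p ?b) ?G\<close> evaluate to \<open>p w * ?b w\<close> and cancel, so the
      backward shift \<open>?b\<close> of \<open>?G\<close> has norm 0.\<close>
    let ?G = "\<lambda>z. k1 w z - cnj (p w) * (p z * k1 w z)"
    note k = S1(3)[OF w] and pk = pS1[OF S1(3)[OF w]]
    have GS: "?G \<in> S1"
      using fun_subspace_diff[OF H2.closed_subD(2)[OF S1(1)] k fun_subspace_scale[OF H2.closed_subD(2)[OF S1(1)] pk]] .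
    have GH: "?G \<in> H2" by (rule S1H[OF GS])
    have G: "?G z = Kp z w" if z: "z \<in> bidisk" for z
    proof -
      have "?G z = (1 - p z * cnj (p w)) * k1 w z" by (simp add: algebra_simps)
      then show ?thesis using z nzp[OF z w] by (simp add: k1_def on_bidisk_def del: mem_Times_iff)
    qed
    let ?b = "bshift p ?G"
    have b: "?b \<in> S1" by (rule S1(5)[OF GS])
    have bH: "?b \<in> H2" by (rule S1H[OF b])
    have "H2_inner ?b ?b = H2_inner (\<lambda>z. p z * ?b z) ?G" using bshift_adjoint[OF p GH bH] by simp
    also have "\<dots> = H2_inner (\<lambda>z. p z * ?b z) (k1 w) - p w * H2_inner (\<lambda>z. p z * ?b z) (\<lambda>z. p z * k1 w z)"
      using H2.ip_diff_right[OF S1H[OF k] H2.scale_mem[OF S1H[OF pk]] S1H[OF pS1[OF b]]]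
        H2.ip_scale_right[OF S1H[OF pk] S1H[OF pS1[OF b]]] by simp
    also have "\<dots> = 0"
      using S1(4)[OF pS1[OF b] w] S1(4)[OF b w] mult_coord_isometry[OF p bH S1H[OF k]] by simp
    finally have "?b = (\<lambda>_. 0)" by (rule H2.ip_self_eq_0[OF bH])
    then have "coord_indep p ?G" using bshift_eq_0_iff[OF p GH] by blast
    from bspec[OF this[unfolded coord_indep_def] z] have "?G z = ?G (coord_zero p z)" .
    then show ?thesis unfolding G[OF z] G[OF coord_zero_bidisk[OF z]] .
  qed
  have k1_herm: "k1 w z = cnj (k1 z w)" if "z \<in> bidisk" "w \<in> bidisk" for z w
    using S1(4)[OF S1(3)] that H2.ip_cnj[OF S1H[OF S1(3)] S1H[OF S1(3)]] by metis
  have k2_herm: "k2 w z = cnj (k2 z w)" if "z \<in> bidisk" "w \<in> bidisk" for z w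
    using S2(4)[OF S2(3)] that H2.ip_cnj[OF S2H[OF S2(3)] S2H[OF S2(3)]] by metis
  have Kp_herm: "Kp z w = cnj (Kp w z)" if z: "z \<in> bidisk" and w: "w \<in> bidisk" for z w
  proof -
    have "Kp z w = (1 - p z * cnj (p w)) * k1 w z" "Kp w z = (1 - p w * cnj (p z)) * k1 z w"
      using nzp z w by (simp_all add: k1_def on_bidisk_def del: mem_Times_iff)
    then show ?thesis using k1_herm[OF z w] by (simp add: mult.commute)
  qed
  have Kq_herm: "Kq z w = cnj (Kq w z)" if z: "z \<in> bidisk" and w: "w \<in> bidisk" for z w
  proof -
    have "Kq z w = (1 - q z * cnj (q w)) * k2 w z" "Kq w z = (1 - q w * cnj (q z)) * k2 z w"
      using nzq z w by (simp_all add: k2_def on_bidisk_def del: mem_Times_iff)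
    then show ?thesis using k2_herm[OF z w] by (simp add: mult.commute)
  qed
  \<comment> \<open>Two readings of \<open>B\<close> are combined: by its definition it depends on
    the \<open>q\<close> coordinates only, and by the Agler identity
    \<open>B - \<theta> cnj \<theta>\<close> is positive wherever \<open>p\<close> is
    constant.\<close>
  define B where "B z w = 1 - (1 - q z * cnj (q w)) * Kp z w" for z w
  have B_eq: "B z w = \<theta> z * cnj (\<theta> w) + (1 - p z * cnj (p w)) * Kq z w" if "z \<in> bidisk" "w \<in> bidisk" for z w
    unfolding B_def using agler[OF that] by (simp add: algebra_simps)
  have B_herm: "B z w = cnj (B w z)" if "z \<in> bidisk" "w \<in> bidisk" for z w
    unfolding B_def using Kp_herm[OF that] by (simp add: mult.commute)
  have Kp_red: "Kp z w = Kp (coord_zero p z) (coord_zero p w)" if "z \<in> bidisk" "w \<in> bidisk" for z w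
    using Kp_indep Kp_herm that coord_zero_bidisk by metis
  have B_red: "B z w = B (coord_zero p z) (coord_zero p w)" if "z \<in> bidisk" "w \<in> bidisk" for z w
    unfolding B_def coords_zero_left'[OF pq] using Kp_red[OF that] by simp
  have B_q: "B z w = B z' w'" if "z \<in> bidisk" "w \<in> bidisk" "z' \<in> bidisk" "w' \<in> bidisk" "q z = q z'" "q w = q w'" for z w z' w'
    using B_red[OF that(1,2)] B_red[OF that(3,4)] coords_zero_eq[OF pq that(5)] coords_zero_eq[OF pq that(6)] by simp
  obtain C where C: "\<forall>z\<in>bidisk. cmod (\<theta> z) \<le> C" using bounded by blast
  \<comment> \<open>Where \<open>p z = 0\<close> the Agler identity on the diagonal expresses
    \<open>Kq z z\<close> as 1 minus two nonnegative terms.\<close>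
  have Kq_le: "Re (Kq z z) \<le> 1" if z: "z \<in> bidisk" "p z = 0" for z
  proof -
    have "Kq z z = 1 - of_real ((cmod (\<theta> z))\<^sup>2) - of_real (1 - (cmod (q z))\<^sup>2) * Kp z z"
      unfolding of_real_diff of_real_1 complex_norm_square
      using agler[OF z(1) z(1)] z(2) by (simp add: algebra_simps)
    then have "Re (Kq z z) = 1 - (cmod (\<theta> z))\<^sup>2 - (1 - (cmod (q z))\<^sup>2) * Re (Kp z z)" by simp
    moreover have "0 \<le> (1 - (cmod (q z))\<^sup>2) * Re (Kp z z)"
      using positive_kernel_diag[OF Kp z(1)] coords_less(2)[OF pq z(1)]
      by (intro mult_nonneg_nonneg) (auto simp: complex_nonneg_Reals_iff power_le_one abs_square_le_1)
    ultimately show ?thesis using zero_le_power2[of "cmod (\<theta> z)"] by linarith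
  qed
  \<comment> \<open>Moving both points to \<open>p = 0\<close> does not change \<open>B\<close> and
    makes it \<open>\<theta> cnj \<theta> + Kq\<close>, where \<open>Kq\<close> is controlled by its
    diagonal.\<close>
  have B_bound: "cmod (B z w) \<le> C\<^sup>2 + 1" if zw: "z \<in> bidisk" "w \<in> bidisk" for z w
  proof -
    let ?z = "coord_zero p z" and ?w = "coord_zero p w"
    have b: "?z \<in> bidisk" "?w \<in> bidisk" using zw by auto
    have p0: "p ?z = 0" "p ?w = 0" using coords_zero_left[OF pq] by auto
    have "cmod (B ?z ?w) \<le> cmod (\<theta> ?z * cnj (\<theta> ?w)) + cmod (Kq ?z ?w)"
      unfolding B_eq[OF b] using norm_triangle_ineq p0 by simp
    also have "\<dots> \<le> C * C + 1"
    proof (rule add_mono)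
      have "0 \<le> C" using C b(1) norm_ge_zero order_trans by metis
      then show "cmod (\<theta> ?z * cnj (\<theta> ?w)) \<le> C * C"
        unfolding norm_mult complex_mod_cnj using C b by (intro mult_mono) auto
      show "cmod (Kq ?z ?w) \<le> 1"
        by (rule positive_kernel_bound[OF Kq b Kq_herm[OF b(2,1)]]) (use Kq_le b p0 in auto)
    qed
    finally show ?thesis using B_red[OF zw] by (simp add: power2_eq_square)
  qed

  define \<beta> where "\<beta> w = on_bidisk (\<lambda>z. B z w)" for w
  have \<beta>: "\<beta> w \<in> H2.orth S1 \<and> (\<forall>h\<in>H2.orth S1. H2_inner (\<lambda>z. q z * h z) (\<beta> w) = 0)" if w: "w \<in> bidisk" for w
  proof -
    let ?w = "coord_zero p w"
    have wb: "?w \<in> bidisk" using w by simp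
    have w0: "p ?w = 0" "q ?w = q w" using coords_zero_left[OF pq] coords_zero_left'[OF pq] by auto
    \<comment> \<open>\<open>n\<close> is the reproducing function at \<open>?w\<close> of the
      complement \<open>N\<close> of \<open>S1\<close>, and \<open>n - cnj (q w) q n\<close>, which
      is \<open>\<beta> w\<close>, is that of the part of \<open>N\<close> orthogonal to
      \<open>q N\<close>. With \<open>p ?w = 0\<close> the Szego kernel retains only its factor in
      \<open>q\<close>.\<close>
    define n where "n = (\<lambda>z. H2.kernel_fun ?w z - k1 ?w z)"
    note sH = H2.kernel_fun_mem[OF wb] and kH = S1H[OF S1(3)[OF wb]]
    have nH: "n \<in> H2" unfolding n_def by (rule H2.diff_mem[OF sH kH])
    have hn: "H2_inner h n = h ?w - H2_inner h (k1 ?w)" if "h \<in> H2" for h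
      unfolding n_def using H2.ip_diff_right[OF sH kH that] H2.ip_kernel_fun[OF that wb] by simp
    have nN: "n \<in> H2.orth S1"
      unfolding orth_iff
    proof (intro conjI ballI nH)
      fix f assume f: "f \<in> S1"
      have "H2_inner f n = 0" using hn[OF S1H[OF f]] S1(4)[OF f wb] by simp
      then show "H2_inner n f = 0" using H2.ip_cnj[OF S1H[OF f] nH] by simp
    qed
    have nv: "n z * (1 - q z * cnj (q w)) = B z w" if z: "z \<in> bidisk" for z
    proof -
      have "Kp z ?w = Kp z w" using Kp_red[OF z w] Kp_red[OF z wb] coords_zero_eq[OF pq w0(2)] by simp
      moreover have "H2.kernel_fun ?w z = 1 / (1 - q z * cnj (q w))" "k1 ?w z = Kp z ?w"
        using z wb w0 by (simp_all add: H2.kernel_fun_def coords_szego[OF pq] k1_def on_bidisk_def del: mem_Times_iff)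
      ultimately show ?thesis unfolding n_def B_def using nzq[OF z w] by (simp add: field_simps)
    qed
    have qn: "(\<lambda>z. q z * n z) \<in> H2.orth S1" by (rule qN[OF nN])
    have qnH: "(\<lambda>z. q z * n z) \<in> H2" by (rule mult_coord_mem[OF q nH])
    have eq: "\<beta> w = (\<lambda>z. n z - cnj (q w) * (q z * n z))"
    proof
      fix z show "\<beta> w z = n z - cnj (q w) * (q z * n z)"
      proof (cases "z \<in> bidisk")
        case True
        then show ?thesis using nv[OF True] unfolding \<beta>_def on_bidisk_def by (simp add: algebra_simps del: mem_Times_iff)
      next
        case False
        then show ?thesis using bidisk_not[OF False nH]
          unfolding \<beta>_def on_bidisk_def by (simp only: if_False mult_zero_right diff_self)
      qed
    qed
    have N: "fun_subspace (H2.orth S1)" by (rule H2.closed_subD(2)[OF H2.closed_sub_orth[OF S1H']])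
    have "\<beta> w \<in> H2.orth S1" unfolding eq using fun_subspace_diff[OF N nN fun_subspace_scale[OF N qn]] .
    moreover have "H2_inner (\<lambda>z. q z * h z) (\<beta> w) = 0" if h: "h \<in> H2.orth S1" for h
    proof -
      have hH: "h \<in> H2" and qh: "(\<lambda>z. q z * h z) \<in> H2.orth S1" using h qN[OF h] unfolding orth_iff by auto
      have qhH: "(\<lambda>z. q z * h z) \<in> H2" using qh unfolding orth_iff by simp
      have "H2_inner (\<lambda>z. q z * h z) (\<beta> w)
          = H2_inner (\<lambda>z. q z * h z) n - q w * H2_inner (\<lambda>z. q z * h z) (\<lambda>z. q z * n z)"
        unfolding eq using H2.ip_diff_right[OF nH H2.scale_mem[OF qnH] qhH] H2.ip_scale_right[OF qnH qhH] by simp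
      also have "H2_inner (\<lambda>z. q z * h z) n = q ?w * h ?w"
        using hn[OF qhH] qh S1(3)[OF wb] unfolding orth_iff by simp
      also have "H2_inner (\<lambda>z. q z * h z) (\<lambda>z. q z * n z) = h ?w"
        using mult_coord_isometry[OF q hH nH] hn[OF hH] h S1(3)[OF wb] unfolding orth_iff by simp
      finally show ?thesis by (simp add: w0)
    qed
    ultimately show ?thesis by blast
  qed
  have rank: "B z v * B x y = B x v * B z y" if "z \<in> bidisk" "x \<in> bidisk" "v \<in> bidisk" "y \<in> bidisk" for z x v y
  proof -
    have ind: "coord_indep p (\<beta> w)" if w: "w \<in> bidisk" for w
      unfolding coord_indep_def
    proof
      fix z :: "complex \<times> complex" assume z: "z \<in> bidisk"
      have "B z w = B (coord_zero p z) w"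
        by (rule B_q[OF z w coord_zero_bidisk[OF z] w coords_zero_left'[OF pq, symmetric] refl])
      then show "\<beta> w z = \<beta> w (coord_zero p z)"
        unfolding \<beta>_def on_bidisk_def using z coord_zero_bidisk[OF z, of p] by (simp only: if_True)
    qed
    have bd: "cmod (\<beta> w z) \<le> C\<^sup>2 + 1" if "w \<in> bidisk" "z \<in> bidisk" for w z
      unfolding \<beta>_def on_bidisk_def using B_bound[OF that(2,1)] that by (simp only: if_True)
    have "\<beta> v z * \<beta> y x = \<beta> v x * \<beta> y z"
      by (rule wandering_rank_one[OF pq S1H' inv conjunct1[OF \<beta>] ind bd _ conjunct1[OF \<beta>] ind bd])
        (use that \<beta> in blast)+
    then show ?thesis unfolding \<beta>_def on_bidisk_def using that by (simp only: if_True)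
  qed
  \<comment> \<open>Where \<open>p\<close> is constant, \<open>(1 - |p z|^2) Kq\<close> is
    \<open>B - \<theta> cnj \<theta>\<close>. At a vector killed by \<open>B\<close> its quadratic
    form is \<open>- |?t|^2\<close>, so positivity gives \<open>?t = 0\<close>, the claimed
    proportionality.\<close>
  have slice: "B x v * \<theta> z = B z v * \<theta> x" if zx: "z \<in> bidisk" "x \<in> bidisk" "p z = p x" and v: "v \<in> bidisk" for z x v
  proof (cases "z = x")
    case False
    \<comment> \<open>By \<open>rank\<close> the rows of \<open>B\<close> over \<open>z\<close> and
      \<open>x\<close> are proportional to \<open>(B v z, B v x)\<close>, and \<open>(a, b)\<close>
      is the vector that annihilates this row.\<close>
    define a where "a = B v x"
    define b where "b = - B v z"
    let ?s = "complex_of_real (1 - (cmod (p z))\<^sup>2)"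
    have s: "?s = 1 - p z * cnj (p z)" by (simp only: of_real_diff of_real_1 complex_norm_square)
    let ?Q = "cnj a * a * Kq z z + cnj a * b * Kq z x + (cnj b * a * Kq x z + cnj b * b * Kq x x)"
    have Q: "?Q \<in> \<real>\<^sub>\<ge>\<^sub>0" by (rule positive_kernel_pair[OF Kq zx(1,2) False])
    have K: "?s * Kq u y = B u y - \<theta> u * cnj (\<theta> y)" if "u \<in> {z, x}" "y \<in> {z, x}" for u y
    proof -
      have "p u = p z" "p y = p z" "u \<in> bidisk" "y \<in> bidisk" using that zx by auto
      then show ?thesis using B_eq[of u y] s by simp
    qed
    have K4: "?s * Kq z z = B z z - \<theta> z * cnj (\<theta> z)" "?s * Kq z x = B z x - \<theta> z * cnj (\<theta> x)"
      "?s * Kq x z = B x z - \<theta> x * cnj (\<theta> z)" "?s * Kq x x = B x x - \<theta> x * cnj (\<theta> x)"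
      by (rule K; simp)+
    have r: "a * B u z + b * B u x = 0" if "u \<in> bidisk" for u
      unfolding a_def b_def using rank[OF v that zx(2) zx(1)] by (simp add: mult_ac)
    let ?t = "a * cnj (\<theta> z) + b * cnj (\<theta> x)"
    have "?s * ?Q = cnj a * (a * (?s * Kq z z) + b * (?s * Kq z x)) + cnj b * (a * (?s * Kq x z) + b * (?s * Kq x x))"
      by (simp add: algebra_simps)
    also have "\<dots> = cnj a * ((a * B z z + b * B z x) - \<theta> z * ?t) + cnj b * ((a * B x z + b * B x x) - \<theta> x * ?t)"
      unfolding K4 by (simp add: algebra_simps)
    also have "\<dots> = - (cnj ?t * ?t)" unfolding r[OF zx(1)] r[OF zx(2)] by (simp add: algebra_simps)
    also have "\<dots> = of_real (- (cmod ?t)\<^sup>2)" by (simp only: of_real_minus complex_norm_square mult.commute)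
    finally have "Re (?s * ?Q) = - (cmod ?t)\<^sup>2" by (simp only: Re_complex_of_real)
    moreover have "0 \<le> Re (?s * ?Q)"
    proof -
      have "(cmod (p z))\<^sup>2 \<le> 1" using coords_less(1)[OF pq zx(1)] by (simp add: power_le_one)
      moreover have "Re (of_real a * y) = a * Re y" for a y by simp
      ultimately show ?thesis using Q unfolding complex_nonneg_Reals_iff by (simp only: mult_nonneg_nonneg diff_ge_0_iff_ge)
    qed
    ultimately have "(cmod ?t)\<^sup>2 \<le> 0" by simp
    then have "?t = 0" by simp
    then have "B v x * cnj (\<theta> z) = B v z * cnj (\<theta> x)" unfolding a_def b_def by (simp add: algebra_simps)
    then have "cnj (B v x * cnj (\<theta> z)) = cnj (B v z * cnj (\<theta> x))" by simp
    then show ?thesis using B_herm[OF zx(2) v] B_herm[OF zx(1) v] by simp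
  qed simp
  \<comment> \<open>On the diagonal \<open>B\<close> dominates \<open>|\<theta>|^2\<close>. This
    settles the case in which the cancellation at the end is impossible.\<close>
  have B_diag: "\<theta> u = 0" if u: "u \<in> bidisk" "B u u = 0" for u
  proof -
    have "Re (B u u) = (cmod (\<theta> u))\<^sup>2 + (1 - (cmod (p u))\<^sup>2) * Re (Kq u u)"
    proof -
      have "B u u = of_real ((cmod (\<theta> u))\<^sup>2) + of_real (1 - (cmod (p u))\<^sup>2) * Kq u u"
        unfolding of_real_diff of_real_1 complex_norm_square using B_eq[OF u(1) u(1)] by simp
      then show ?thesis by simp
    qed
    moreover have "0 \<le> (1 - (cmod (p u))\<^sup>2) * Re (Kq u u)"
      using positive_kernel_diag[OF Kq u(1)] coords_less(1)[OF pq u(1)]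
      by (intro mult_nonneg_nonneg) (auto simp: complex_nonneg_Reals_iff power_le_one)
    moreover have "Re (B u u) = 0" using u(2) by simp
    ultimately have "(cmod (\<theta> u))\<^sup>2 \<le> 0" by linarith
    then show ?thesis by simp
  qed
  have zz: "B w' w' = B z z" "B z' z' = B w w" by (rule B_q; use z w z' w' mix in simp)+
  show ?thesis
  proof (cases "B z z = 0 \<or> B w w = 0")
    case True
    then show ?thesis using B_diag z w z' w' zz by auto
  next
    case False
    have 1: "B z' z * \<theta> z = B z z * \<theta> z'" by (rule slice[OF z z' mix(1)[symmetric] z])
    have 2: "B w z * \<theta> w' = B w' z * \<theta> w" by (rule slice[OF w' w mix(3) z])
    have 3: "B z' z = B w z" "B w' z = B z z" by (rule B_q; use z w z' w' mix in simp)+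
    \<comment> \<open>Rank one expresses a product of diagonal values through \<open>B w z\<close>,
      which is therefore nonzero and can be cancelled.\<close>
    have "B w z * B z w = B z z * B w w" using rank[OF w z z w] by (simp add: mult.commute)
    then have nz: "B w z \<noteq> 0" using False by auto
    have "(B w z * B z z) * (\<theta> z * \<theta> w) = (B w z * \<theta> z) * (B z z * \<theta> w)" by simp
    also have "\<dots> = (B z z * \<theta> z') * (B w z * \<theta> w')" using 1 2 3 by simp
    also have "\<dots> = (B w z * B z z) * (\<theta> z' * \<theta> w')" by simp
    finally show ?thesis using nz False by simp
  qed
qed

end


section \<open>Factorization into one variable inner functions\<close>

lemma AE_lebesgue_on_iff:
  fixes S :: "'a :: euclidean_space set"
  assumes "S \<in> sets borel"
  shows "(AE x in lebesgue_on S. P x) \<longleftrightarrow> (AE x in lborel. x \<in> S \<longrightarrow> P x)"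
proof -
  have "S \<in> sets lebesgue" using assms by (simp add: sets_completionI_sets)
  then have "(AE x in lebesgue_on S. P x) \<longleftrightarrow> (AE x in lebesgue. x \<in> S \<longrightarrow> P x)"
    by (intro AE_restrict_space_iff) simp
  then show ?thesis by (simp add: AE_completion_iff)
qed

lemma torus_param_borel: "torus_param \<in> sets borel"
  by (simp add: torus_param_cbox del: cbox_Pair_eq)

text \<open>Fubini for null sets. The product of two copies of \<open>lborel\<close> is
  \<open>lborel\<close> on the plane, which fails for the completed measures, so the statements are
  moved there first; the second order of the variables comes from the swap map.\<close>

lemma AE_torus:
  assumes "AE t in lebesgue_on torus_param. P t"
  shows "AE s in lebesgue_on {0..2 * pi}. AE t in lebesgue_on {0..2 * pi}. P (s, t)"
    and "AE t in lebesgue_on {0..2 * pi}. AE s in lebesgue_on {0..2 * pi}. P (s, t)"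
proof -
  have 1: "AE t in lborel \<Otimes>\<^sub>M lborel. t \<in> torus_param \<longrightarrow> P t"
    using assms unfolding AE_lebesgue_on_iff[OF torus_param_borel] lborel_prod .
  have *: "AE s in lebesgue_on {0..2 * pi}. AE t in lebesgue_on {0..2 * pi}. Q (s, t)"
    if "AE t in (lborel :: real measure) \<Otimes>\<^sub>M (lborel :: real measure). t \<in> torus_param \<longrightarrow> Q t" for Q
  proof -
    have "AE s in lborel. AE t in lborel. (s, t) \<in> torus_param \<longrightarrow> Q (s, t)" by (rule lborel_pair.AE_pair[OF that])
    then have "AE s in lborel. s \<in> {0..2 * pi} \<longrightarrow> (AE t in lborel. t \<in> {0..2 * pi} \<longrightarrow> Q (s, t))"
    proof eventually_elim
      case (elim s)
      show ?case
      proof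
        assume s: "s \<in> {0..2 * pi}"
        show "AE t in lborel. t \<in> {0..2 * pi} \<longrightarrow> Q (s, t)" using elim by eventually_elim (use s in simp)
      qed
    qed
    then show ?thesis by (simp add: AE_lebesgue_on_iff)
  qed
  show "AE s in lebesgue_on {0..2 * pi}. AE t in lebesgue_on {0..2 * pi}. P (s, t)" by (rule *[OF 1])
  have m: "(\<lambda>(x, y). (y, x)) \<in> measurable ((lborel :: real measure) \<Otimes>\<^sub>M (lborel :: real measure)) (lborel \<Otimes>\<^sub>M lborel)"
    by (rule measurable_pair_swap')
  have "AE t in (lborel :: real measure) \<Otimes>\<^sub>M (lborel :: real measure).
      (case t of (x, y) \<Rightarrow> (y, x)) \<in> torus_param \<longrightarrow> P (case t of (x, y) \<Rightarrow> (y, x))"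
    by (rule AE_distrD[OF m]) (use 1 in \<open>simp only: lborel_pair.distr_pair_swap[symmetric]\<close>)
  then have "AE t in (lborel :: real measure) \<Otimes>\<^sub>M (lborel :: real measure).
      t \<in> torus_param \<longrightarrow> P (case t of (x, y) \<Rightarrow> (y, x))"
    by eventually_elim auto
  from *[OF this] show "AE t in lebesgue_on {0..2 * pi}. AE s in lebesgue_on {0..2 * pi}. P (s, t)" by simp
qed

text \<open>The preimage of a null set under a coordinate map is a null cylinder. This transfers
  unimodular limits of a one variable inner function to the torus.\<close>

lemma AE_torus_coord:
  assumes "AE t in lebesgue_on {0..2 * pi}. P t" and c: "c = fst \<or> c = snd"
  shows "AE t in lebesgue_on torus_param. P (c t)"
proof -
  have "AE t in lborel. t \<in> {0..2 * pi} \<longrightarrow> P t" using assms by (simp add: AE_lebesgue_on_iff)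
  then obtain N where N: "N \<in> null_sets lborel" "{t. \<not> (t \<in> {0..2 * pi} \<longrightarrow> P t)} \<subseteq> N"
    unfolding eventually_ae_filter by auto
  have "c -` N \<in> null_sets (lborel :: (real \<times> real) measure)"
    using c
  proof
    assume "c = fst"
    then have "c -` N = N \<times> UNIV" by auto
    then show ?thesis using lborel.times_in_null_sets1[OF N(1), of UNIV] by (simp add: lborel_prod)
  next
    assume "c = snd"
    then have "c -` N = UNIV \<times> N" by auto
    then show ?thesis using lborel.times_in_null_sets2[OF _ N(1), of UNIV lborel] by (simp add: lborel_prod)
  qed
  then have "AE t in lborel. t \<in> torus_param \<longrightarrow> P (c t)"
    by (rule AE_I'[where N = "c -` N"]) (use N(2) c in auto)
  then show ?thesis unfolding AE_lebesgue_on_iff[OF torus_param_borel] .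
qed

lemma AE_interval_ex:
  assumes "AE t in lebesgue_on {0..2 * pi}. P t"
  shows "\<exists>t. P t"
proof (rule ccontr)
  assume "\<not> ?thesis"
  then have "AE t in lebesgue_on {0..2 * pi}. False" using assms by simp
  then have "AE t in lborel. t \<notin> {0..2 * pi}" by (simp add: AE_lebesgue_on_iff)
  then have "{0..2 * pi} \<in> null_sets lborel" by (subst AE_iff_null_sets) auto
  then show False by (auto simp: null_sets_def)
qed

section \<open>Radial limits of the factors\<close>

lemma fourier_coefficient:
  assumes f: "f holomorphic_on ball 0 1" and r: "0 < r" "r < 1"
  shows "((\<lambda>t. f (of_real r * cis t) / (of_real r * cis t) ^ k)
    has_integral of_real (2 * pi) / fact k * (deriv ^^ k) f 0) {0..2 * pi}"
proof -
  have sub: "cball 0 r \<subseteq> ball (0::complex) 1" using r by auto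
  have "((\<lambda>u. f u / (u - 0) ^ Suc k) has_contour_integral ((2 * pi * \<i>) / fact k * (deriv ^^ k) f 0)) (circlepath 0 r)"
  proof (rule Cauchy_has_contour_integral_higher_derivative_circlepath)
    show "continuous_on (cball 0 r) f"
      by (rule continuous_on_subset[OF holomorphic_on_imp_continuous_on[OF f] sub])
    show "f holomorphic_on ball 0 r" by (rule holomorphic_on_subset[OF f]) (use r in auto)
  qed (use r in simp)
  \<comment> \<open>The line element contributes \<open>r * \<i> * cis t\<close>, which lowers the
    exponent from \<open>Suc k\<close> to \<open>k\<close>; the multiplication by
    \<open>- \<i>\<close> below removes the remaining constant.\<close>
  then have "((\<lambda>t. f (of_real r * cis t) / (of_real r * cis t) ^ Suc k * r * \<i> * cis t)
      has_integral ((2 * pi * \<i>) / fact k * (deriv ^^ k) f 0)) {0..2 * pi}"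
    unfolding circlepath_def by (subst (asm) has_contour_integral_part_circlepath_iff) simp_all
  from has_integral_mult_right[OF this, of "- \<i>"]
  have "((\<lambda>t. - \<i> * (f (of_real r * cis t) / (of_real r * cis t) ^ Suc k * r * \<i> * cis t))
      has_integral (of_real (2 * pi) / fact k * (deriv ^^ k) f 0)) {0..2 * pi}"
    by (simp add: field_simps)
  moreover have "- \<i> * (f (of_real r * cis t) / (of_real r * cis t) ^ Suc k * r * \<i> * cis t)
      = f (of_real r * cis t) / (of_real r * cis t) ^ k" for t
    using r by (simp add: field_simps)
  ultimately show ?thesis by simp
qed

lemma holomorphic_deriv_nonzero:
  assumes f: "f holomorphic_on ball 0 1" and x: "x \<in> ball 0 1" "f x \<noteq> 0"
  shows "\<exists>k. (deriv ^^ k) f 0 \<noteq> 0"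
proof (rule ccontr)
  assume "\<not> ?thesis"
  then have "(\<lambda>n. 0) sums f x" using holomorphic_power_series[OF f x(1)] by simp
  then show False using x(2) sums_unique2 sums_zero by blast
qed

text \<open>The Fourier coefficient of order \<open>k\<close> of \<open>t \<mapsto> \<phi> (r e\<^sup>i\<^sup>t) \<psi> (r y)\<close> is a nonzero
  constant multiple of \<open>\<psi> (r y)\<close>, and it converges by dominated convergence. So no Fatou theorem is
  needed to obtain the radial limits of \<open>\<psi>\<close>.\<close>

lemma factor_radial_limit:
  assumes \<phi>: "\<phi> holomorphic_on ball 0 1" "x \<in> ball 0 1" "\<phi> x \<noteq> 0"
    and C: "\<And>x r. x \<in> ball 0 1 \<Longrightarrow> 0 < r \<Longrightarrow> r < 1 \<Longrightarrow> cmod (\<phi> x * \<psi> (of_real r * y)) \<le> C"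
    and lim: "AE t in lebesgue_on {0..2 * pi}.
      \<exists>l. ((\<lambda>r. \<phi> (of_real r * cis t) * \<psi> (of_real r * y)) \<longlongrightarrow> l) (at_left 1)"
  shows "\<exists>l. ((\<lambda>r. \<psi> (of_real r * y)) \<longlongrightarrow> l) (at_left (1::real))"
proof -
  let ?M = "lebesgue_on {0..2 * pi}"
  obtain k where k: "(deriv ^^ k) \<phi> 0 \<noteq> 0" using holomorphic_deriv_nonzero[OF \<phi>] by blast
  define c where "c = of_real (2 * pi) / fact k * (deriv ^^ k) \<phi> 0"
  have c0: "c \<noteq> 0" unfolding c_def using k by simp
  define s where "s r t = \<phi> (of_real r * cis t) / (of_real r * cis t) ^ k * \<psi> (of_real r * y)" for r t
  have cont: "continuous_on {0..2 * pi} (s r)" if "0 < r" "r < 1" for r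
    unfolding s_def
  proof (intro continuous_intros ballI)
    have "continuous_on {0..2 * pi} (\<phi> \<circ> (\<lambda>t. of_real r * cis t))"
      by (intro continuous_on_compose continuous_intros
          continuous_on_subset[OF holomorphic_on_imp_continuous_on[OF \<phi>(1)]])
        (use that in \<open>auto simp: norm_mult\<close>)
    then show "continuous_on {0..2 * pi} (\<lambda>t. \<phi> (of_real r * cis t))" by (simp add: o_def)
  qed (use that in auto)
  have cbox: "{0..2 * pi} = cbox 0 (2 * pi)" by simp
  have int: "integrable ?M (s r)" if "0 < r" "r < 1" for r
    unfolding cbox by (rule continuous_imp_integrable) (use cont[OF that] in simp)
  have val: "integral\<^sup>L ?M (s r) = c * \<psi> (of_real r * y)" if "0 < r" "r < 1" for r
  proof -
    have "integral\<^sup>L ?M (s r) = integral {0..2 * pi} (s r)"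
      by (rule lebesgue_integral_eq_integral[OF int[OF that]]) simp
    also have "\<dots> = c * \<psi> (of_real r * y)"
      unfolding s_def c_def by (intro integral_unique has_integral_mult_left fourier_coefficient \<phi> that)
    finally show ?thesis .
  qed
  have rad': "0 < rad (Suc n)" for n by (simp add: rad_def field_simps)
  \<comment> \<open>A limit along one sequence keeps \<open>f\<close> measurable, and
    \<open>Suc n\<close> keeps the radii positive, as division by powers of the radius
    requires.\<close>
  define f where "f t = lim (\<lambda>n. s (rad (Suc n)) t)" for t
  have fm: "f \<in> borel_measurable ?M"
    unfolding f_def by (intro borel_measurable_lim_metric borel_measurable_integrable int rad' rad)
  have sl: "AE t in ?M. ((\<lambda>r. s r t) \<longlongrightarrow> f t) (at_left 1)"
    using lim
  proof eventually_elim
    case (elim t)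
    then obtain l where l: "((\<lambda>r. \<phi> (of_real r * cis t) * \<psi> (of_real r * y)) \<longlongrightarrow> l) (at_left 1)" by blast
    have "((\<lambda>r. (of_real r * cis t) ^ k) \<longlongrightarrow> (of_real 1 * cis t) ^ k) (at_left (1::real))"
      by (intro tendsto_intros)
    from tendsto_divide[OF l this]
    have st: "((\<lambda>r. s r t) \<longlongrightarrow> l / (of_real 1 * cis t) ^ k) (at_left 1)" by (simp add: s_def)
    have "filterlim (\<lambda>n. rad (Suc n)) (at_left 1) sequentially"
      by (rule filterlim_compose[OF rad_at_left filterlim_Suc])
    from filterlim_compose[OF st this]
    have "f t = l / (of_real 1 * cis t) ^ k" unfolding f_def by (rule limI)
    then show ?case using st by simp
  qed
  have "((\<lambda>r. \<psi> (of_real r * y)) \<longlongrightarrow> integral\<^sup>L ?M f / c) (at_left 1)"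
  \<comment> \<open>Radii above \<open>1/2\<close> bound the division by \<open>r ^ k\<close> and so
    give the dominating constant \<open>C * 2 ^ k\<close>.\<close>
  proof (rule tendsto_at_left_sequentially[where b = "1/2"])
    fix S :: "nat \<Rightarrow> real"
    assume S: "\<And>n. S n < 1" "\<And>n. 1/2 < S n" "S \<longlonglongrightarrow> 1"
    have S0: "0 < S n" for n using S(2)[of n] by simp
    have Sf: "filterlim S (at_left 1) sequentially"
      unfolding filterlim_at using S(1,3) S(1)[THEN less_imp_neq] by (auto intro!: always_eventually)
    have "(\<lambda>n. integral\<^sup>L ?M (s (S n))) \<longlonglongrightarrow> integral\<^sup>L ?M f"
    proof (rule integral_dominated_convergence[OF fm])
      show "s (S n) \<in> borel_measurable ?M" for n by (intro borel_measurable_integrable int S S0)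
      show "integrable ?M (\<lambda>_. C * 2 ^ k)"
        unfolding cbox by (rule continuous_imp_integrable) (intro continuous_intros)
      show "AE t in ?M. (\<lambda>n. s (S n) t) \<longlonglongrightarrow> f t"
        using sl by eventually_elim (rule filterlim_compose[OF _ Sf])
      show "AE t in ?M. norm (s (S n) t) \<le> C * 2 ^ k" for n
      proof (intro always_eventually allI)
        fix t
        have b: "of_real (S n) * cis t \<in> ball 0 1" using S(1)[of n] S0[of n] by (simp add: norm_mult)
        have n: "norm (s (S n) t) = cmod (\<phi> (of_real (S n) * cis t) * \<psi> (of_real (S n) * y)) * inverse (S n) ^ k"
          unfolding s_def using S0[of n] by (simp add: norm_mult norm_divide norm_power field_simps)
        have "inverse (S n) \<le> 2" using S(2)[of n] S0[of n] by (simp add: field_simps)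
        then show "norm (s (S n) t) \<le> C * 2 ^ k"
          unfolding n using S0[of n] order_trans[OF norm_ge_zero C[OF b S0[of n] S(1)[of n]]]
          by (intro mult_mono C[OF b S0 S(1)] power_mono) auto
      qed
    qed
    then have "(\<lambda>n. integral\<^sup>L ?M (s (S n)) / c) \<longlonglongrightarrow> integral\<^sup>L ?M f / c" by (intro tendsto_intros c0)
    then show "(\<lambda>n. \<psi> (of_real (S n) * y)) \<longlonglongrightarrow> integral\<^sup>L ?M f / c" using val[OF S0 S(1)] c0 by simp
  qed simp
  then show ?thesis by blast
qed

text \<open>Slices through a point where \<open>\<theta>\<close> is nonzero give the factors. Where
  both have radial limits and the product has a unimodular one, the moduli multiply to 1; so each
  modulus is constant almost everywhere, and a positive scalar normalizes both.\<close>

theorem inner1_factors: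
  assumes inner: "inner2 \<theta>"
    and mix: "\<And>a b c d. a \<in> ball 0 1 \<Longrightarrow> b \<in> ball 0 1 \<Longrightarrow> c \<in> ball 0 1 \<Longrightarrow> d \<in> ball 0 1 \<Longrightarrow>
      \<theta> (a, b) * \<theta> (c, d) = \<theta> (a, d) * \<theta> (c, b)"
  shows "\<exists>\<phi> \<psi>. inner1 \<phi> \<and> inner1 \<psi> \<and> (\<forall>z\<in>bidisk. \<theta> z = \<phi> (fst z) * \<psi> (snd z))"
proof -
  let ?I = "{0..2 * pi} :: real set"
  have hol: "holomorphic2 \<theta>" using inner unfolding inner2_def by blast
  obtain C0 where "\<forall>z\<in>bidisk. cmod (\<theta> z) \<le> C0" using inner unfolding inner2_def bounded_iff by blast
  then have C: "cmod (\<theta> (x, y)) \<le> C0" if "x \<in> ball 0 1" "y \<in> ball 0 1" for x y using that by (simp add: bidisk_iff)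
  define L where "L s t l \<longleftrightarrow> cmod l = 1 \<and> ((\<lambda>r. \<theta> (of_real r * cis s, of_real r * cis t)) \<longlongrightarrow> l) (at_left 1)" for s t l
  have "AE t in lebesgue_on torus_param. \<exists>l. L (fst t) (snd t) l"
    using inner unfolding inner2_def L_def by blast
  from AE_torus[OF this]
  have AE1: "AE s in lebesgue_on ?I. AE t in lebesgue_on ?I. \<exists>l. L s t l"
    and AE2: "AE t in lebesgue_on ?I. AE s in lebesgue_on ?I. \<exists>l. L s t l" by simp_all
  have ev: "\<forall>\<^sub>F r in at_left (1::real). 0 < r \<and> r < 1"
    using eventually_at_left_real[of 0 "1::real"] by simp
  have disc: "of_real r * cis t \<in> ball 0 1" if "0 < r" "r < 1" for r t using that by (simp add: norm_mult)
  \<comment> \<open>A function vanishing identically has radial limits 0, which are not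
    unimodular.\<close>
  have "\<exists>x0\<in>ball 0 1. \<exists>y0\<in>ball 0 1. \<theta> (x0, y0) \<noteq> 0"
  proof (rule ccontr)
    assume "\<not> ?thesis"
    then have 0: "\<theta> (x, y) = 0" if "x \<in> ball 0 1" "y \<in> ball 0 1" for x y using that by blast
    obtain s where s: "AE t in lebesgue_on ?I. \<exists>l. L s t l" using AE_interval_ex[OF AE1] by (elim exE)
    obtain t l where l: "L s t l" using AE_interval_ex[OF s] by (elim exE)
    have "((\<lambda>r. \<theta> (of_real r * cis s, of_real r * cis t)) \<longlongrightarrow> 0) (at_left 1)"
      by (rule tendsto_eventually) (use ev in \<open>eventually_elim, use 0 disc in blast\<close>)
    then have "l = 0" using l unfolding L_def by (intro tendsto_unique[of "at_left (1::real)"]) auto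
    then show False using l unfolding L_def by simp
  qed
  then obtain x0 y0 where xy0: "x0 \<in> ball 0 1" "y0 \<in> ball 0 1" "\<theta> (x0, y0) \<noteq> 0" by blast
  define \<phi> where "\<phi> x = \<theta> (x, y0) / \<theta> (x0, y0)" for x
  define \<psi> where "\<psi> y = \<theta> (x0, y)" for y
  have prod: "\<theta> (x, y) = \<phi> x * \<psi> y" if "x \<in> ball 0 1" "y \<in> ball 0 1" for x y
    using mix[OF that xy0(1,2)] xy0(3) unfolding \<phi>_def \<psi>_def by (simp add: field_simps)
  have h\<phi>: "\<phi> holomorphic_on ball 0 1"
    unfolding \<phi>_def using xy0 by (intro holomorphic_intros holomorphic2_slices(1)[OF hol]) auto
  have h\<psi>: "\<psi> holomorphic_on ball 0 1"
    unfolding \<psi>_def using xy0 by (intro holomorphic2_slices(2)[OF hol]) auto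
  have b\<phi>: "bounded (\<phi> ` ball 0 1)"
    unfolding bounded_iff \<phi>_def using C xy0
    by (auto simp: norm_divide intro!: exI[of _ "C0 / cmod (\<theta> (x0, y0))"] divide_right_mono)
  have b\<psi>: "bounded (\<psi> ` ball 0 1)"
    unfolding bounded_iff \<psi>_def using C xy0 by (auto intro!: exI[of _ C0])
  have nz: "\<phi> x0 \<noteq> 0" "\<psi> y0 \<noteq> 0" using xy0(3) unfolding \<phi>_def \<psi>_def by auto
  have tp: "((\<lambda>r. \<phi> (of_real r * cis s) * \<psi> (of_real r * cis t)) \<longlongrightarrow> l) (at_left 1)" if "L s t l" for s t l
  proof (rule Lim_transform_eventually)
    show "((\<lambda>r. \<theta> (of_real r * cis s, of_real r * cis t)) \<longlongrightarrow> l) (at_left 1)" using that unfolding L_def by simp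
    show "\<forall>\<^sub>F r in at_left 1. \<theta> (of_real r * cis s, of_real r * cis t) = \<phi> (of_real r * cis s) * \<psi> (of_real r * cis t)"
      using ev by eventually_elim (use prod disc in blast)
  qed
  have Cb: "cmod (\<phi> x * \<psi> y) \<le> C0" if "x \<in> ball 0 1" "y \<in> ball 0 1" for x y
    using prod[OF that] C[OF that] by simp
  have lim\<psi>: "\<exists>b. ((\<lambda>r. \<psi> (of_real r * cis t)) \<longlongrightarrow> b) (at_left 1)" if "AE s in lebesgue_on ?I. \<exists>l. L s t l" for t
  proof (rule factor_radial_limit[OF h\<phi> xy0(1) nz(1)])
    show "cmod (\<phi> x * \<psi> (of_real r * cis t)) \<le> C0" if "x \<in> ball 0 1" "0 < r" "r < 1" for x r
      using Cb disc that by blast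
    show "AE s in lebesgue_on ?I. \<exists>l. ((\<lambda>r. \<phi> (of_real r * cis s) * \<psi> (of_real r * cis t)) \<longlongrightarrow> l) (at_left 1)"
      using that by eventually_elim (use tp in blast)
  qed
  have lim\<phi>: "\<exists>a. ((\<lambda>r. \<phi> (of_real r * cis s)) \<longlongrightarrow> a) (at_left 1)" if "AE t in lebesgue_on ?I. \<exists>l. L s t l" for s
  proof (rule factor_radial_limit[OF h\<psi> xy0(2) nz(2)])
    show "cmod (\<psi> y * \<phi> (of_real r * cis s)) \<le> C0" if "y \<in> ball 0 1" "0 < r" "r < 1" for y r
      using Cb[OF disc[OF that(2,3)] that(1)] by (simp add: mult.commute)
    show "AE t in lebesgue_on ?I. \<exists>l. ((\<lambda>r. \<psi> (of_real r * cis t) * \<phi> (of_real r * cis s)) \<longlongrightarrow> l) (at_left 1)"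
      using that by eventually_elim (use tp in \<open>auto simp: mult.commute\<close>)
  qed
  have AE\<phi>: "AE s in lebesgue_on ?I. \<exists>a. ((\<lambda>r. \<phi> (of_real r * cis s)) \<longlongrightarrow> a) (at_left 1)"
    using AE1 by eventually_elim (rule lim\<phi>)
  have AE\<psi>: "AE t in lebesgue_on ?I. \<exists>b. ((\<lambda>r. \<psi> (of_real r * cis t)) \<longlongrightarrow> b) (at_left 1)"
    using AE2 by eventually_elim (rule lim\<psi>)
  have ab: "cmod a * cmod b = 1"
    if ex: "\<exists>l. L s t l" and lims: "((\<lambda>r. \<phi> (of_real r * cis s)) \<longlongrightarrow> a) (at_left 1)" "((\<lambda>r. \<psi> (of_real r * cis t)) \<longlongrightarrow> b) (at_left 1)"
    for s t a b
  proof -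
    obtain l where l: "L s t l" using ex by blast
    have "a * b = l" using tendsto_unique[OF _ tendsto_mult[OF lims] tp[OF l]] by simp
    then show ?thesis using l unfolding L_def by (simp flip: norm_mult)
  qed
  obtain t0 where t0: "AE s in lebesgue_on ?I. \<exists>l. L s t0 l" using AE_interval_ex[OF AE2] by (elim exE)
  obtain b0 where b0: "((\<lambda>r. \<psi> (of_real r * cis t0)) \<longlongrightarrow> b0) (at_left 1)" using lim\<psi>[OF t0] by blast
  \<comment> \<open>The angle \<open>s0\<close> has to be good for almost every \<open>t\<close> and
    also together with the chosen \<open>t0\<close>, so that one pair of limits \<open>a0\<close>,
    \<open>b0\<close> normalizes both factors.\<close>
  have "AE s in lebesgue_on ?I. (AE t in lebesgue_on ?I. \<exists>l. L s t l) \<and> (\<exists>l. L s t0 l)"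
    using AE1 t0 by eventually_elim simp
  from AE_interval_ex[OF this]
  obtain s0 where s0: "AE t in lebesgue_on ?I. \<exists>l. L s0 t l" "\<exists>l. L s0 t0 l" by blast
  obtain a0 where a0: "((\<lambda>r. \<phi> (of_real r * cis s0)) \<longlongrightarrow> a0) (at_left 1)" using lim\<phi>[OF s0(1)] by blast
  \<comment> \<open>Pairing with \<open>t0\<close> gives \<open>|a| |b0| = 1\<close> for almost
    every limit \<open>a\<close> of \<open>\<phi>\<close>; pairing with \<open>s0\<close> gives
    \<open>|b| = |b0|\<close> for almost every limit \<open>b\<close> of \<open>\<psi>\<close>. So
    \<open>c \<phi>\<close> and \<open>\<psi> / c\<close> are the normalized factors.\<close>
  define c where "c = complex_of_real (cmod b0)"
  have ab0: "cmod a0 * cmod b0 = 1" by (rule ab[OF s0(2) a0 b0])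
  have c0: "c \<noteq> 0" unfolding c_def using ab0 by auto
  have i\<phi>: "inner1 (\<lambda>x. c * \<phi> x)"
    unfolding inner1_def
  proof (intro conjI)
    show "(\<lambda>x. c * \<phi> x) holomorphic_on ball 0 1" by (intro holomorphic_intros h\<phi>)
    show "bounded ((\<lambda>x. c * \<phi> x) ` ball 0 1)"
      using bounded_scaling[OF b\<phi>, of "cmod b0"] unfolding c_def by (simp add: image_image scaleR_conv_of_real)
    show "AE s in lebesgue_on ?I. \<exists>l. cmod l = 1 \<and> ((\<lambda>r. c * \<phi> (of_real r * cis s)) \<longlongrightarrow> l) (at_left 1)"
      using AE\<phi> t0
    proof eventually_elim
      case (elim s)
      then obtain a where a: "((\<lambda>r. \<phi> (of_real r * cis s)) \<longlongrightarrow> a) (at_left 1)" by blast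
      have "cmod (c * a) = 1" using ab[OF elim(2) a b0] unfolding c_def by (simp add: norm_mult mult.commute)
      then show ?case using tendsto_mult_left[OF a, of c] by blast
    qed
  qed
  have i\<psi>: "inner1 (\<lambda>y. \<psi> y / c)"
    unfolding inner1_def
  proof (intro conjI)
    show "(\<lambda>y. \<psi> y / c) holomorphic_on ball 0 1" by (intro holomorphic_intros h\<psi> c0)
    have "\<psi> y / c = (1 / cmod b0) *\<^sub>R \<psi> y" for y unfolding c_def by (simp add: scaleR_conv_of_real)
    then show "bounded ((\<lambda>y. \<psi> y / c) ` ball 0 1)"
      using bounded_scaling[OF b\<psi>, of "1 / cmod b0"] by (simp add: image_image)
    show "AE t in lebesgue_on ?I. \<exists>l. cmod l = 1 \<and> ((\<lambda>r. \<psi> (of_real r * cis t) / c) \<longlongrightarrow> l) (at_left 1)"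
      using AE\<psi> s0(1)
    proof eventually_elim
      case (elim t)
      then obtain b where b: "((\<lambda>r. \<psi> (of_real r * cis t)) \<longlongrightarrow> b) (at_left 1)" by blast
      have e: "cmod a0 * cmod b = cmod a0 * cmod b0" using ab[OF elim(2) a0 b] ab0 by simp
      have "cmod a0 \<noteq> 0" "cmod b0 \<noteq> 0" using ab0 by auto
      then have "cmod (b / c) = 1" using e unfolding c_def by (simp add: norm_divide)
      then show ?case using tendsto_divide[OF b tendsto_const c0] by blast
    qed
  qed
  have "\<theta> z = (c * \<phi> (fst z)) * (\<psi> (snd z) / c)" if "z \<in> bidisk" for z
    using prod[of "fst z" "snd z"] that c0 by (simp add: mem_Times_iff)
  then show ?thesis using i\<phi> i\<psi> by blast
qed


section \<open>Reducing Agler spaces of a product\<close>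

lemma inner2_coord:
  assumes \<phi>: "inner1 \<phi>" and c: "coord c"
  shows "inner2 (\<lambda>z. \<phi> (c z))"
  unfolding inner2_def
proof (intro conjI)
  have hol: "\<phi> holomorphic_on ball 0 1" and bd: "bounded (\<phi> ` ball 0 1)"
    and ae: "AE t in lebesgue_on {0..2 * pi}. \<exists>l. cmod l = 1 \<and> ((\<lambda>r. \<phi> (of_real r * cis t)) \<longlongrightarrow> l) (at_left 1)"
    using \<phi> unfolding inner1_def by auto
  have c': "c = fst \<or> c = snd" using c unfolding coord_def .
  have cb: "c z \<in> ball 0 1" if "z \<in> bidisk" for z using that c' by (auto simp: bidisk_iff)
  show "holomorphic2 (\<lambda>z. \<phi> (c z))"
    unfolding holomorphic2_def
  proof
    fix z :: "complex \<times> complex" assume "z \<in> bidisk"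
    then obtain d where "(\<phi> has_field_derivative d) (at (c z))"
      using hol cb[of z] unfolding holomorphic_on_open[OF open_ball] by blast
    then have d: "(\<phi> has_derivative (\<lambda>h. d * h)) (at (c z))" unfolding has_field_derivative_def .
    have "(c has_derivative c) (at z)"
      using c' by (auto intro: bounded_linear_imp_has_derivative bounded_linear_fst bounded_linear_snd)
    from has_derivative_compose[OF this d]
    have "((\<lambda>z. \<phi> (c z)) has_derivative (\<lambda>h. d * c h)) (at z)" .
    moreover have "(\<lambda>h. d * c h) = (\<lambda>h. (if c = fst then d else 0) * fst h + (if c = fst then 0 else d) * snd h)"
      using c' by auto
    ultimately show "\<exists>a b. ((\<lambda>z. \<phi> (c z)) has_derivative (\<lambda>h. a * fst h + b * snd h)) (at z)" by metis
  qed
  show "bounded ((\<lambda>z. \<phi> (c z)) ` bidisk)"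
    by (rule bounded_subset[OF bd]) (use cb in blast)
  have "AE t in lebesgue_on torus_param. \<exists>l. cmod l = 1 \<and>
      ((\<lambda>r. \<phi> (of_real r * cis ((if c = fst then fst else snd) t))) \<longlongrightarrow> l) (at_left 1)"
    by (rule AE_torus_coord[OF ae]) auto
  moreover have "c (of_real r * cis (fst t), of_real r * cis (snd t))
      = of_real r * cis ((if c = fst then fst else snd) t)" for r t
    using c' fst_neq_snd by auto
  ultimately show "AE t in lebesgue_on torus_param. \<exists>l. cmod l = 1 \<and>
      ((\<lambda>r. \<phi> (c (of_real r * cis (fst t), of_real r * cis (snd t)))) \<longlongrightarrow> l) (at_left 1)"
    by simp
qed

text \<open>For \<open>\<theta> = \<Phi> \<Psi>\<close> the decomposition of the model space is
  \<open>K\<^sub>\<theta> = K\<^sub>\<Psi> \<oplus> \<Psi> K\<^sub>\<Phi>\<close>, and multiplication by \<open>p\<close> maps \<open>K\<^sub>\<Psi>\<close> to itself because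
  \<open>\<Psi>\<close> is independent of \<open>p\<close>.\<close>

theorem product_reducing:
  assumes \<theta>: "inner2 \<theta>" and pq: "coords p q" and \<phi>: "inner1 \<phi>" and \<psi>: "inner1 \<psi>"
    and "\<forall>z\<in>bidisk. \<theta> z = \<phi> (p z) * \<psi> (q z)"
  shows "\<exists>Kp Kq. positive_kernel bidisk Kp \<and> positive_kernel bidisk Kq \<and>
    (\<forall>z\<in>bidisk. \<forall>w\<in>bidisk.
      1 - \<theta> z * cnj (\<theta> w) = (1 - p z * cnj (p w)) * Kq z w + (1 - q z * cnj (q w)) * Kp z w) \<and>
    rkhs_reducing \<theta> p (agler_space_kernel p Kp) \<and> rkhs_reducing \<theta> p (agler_space_kernel q Kq)"
proof -
  note p = coords_left[OF pq] and q = coords_right[OF pq] and prod = bspec[OF assms(5)]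
  interpret T: inner_bidisk \<theta> by standard (rule \<theta>)
  interpret P: inner_bidisk "\<lambda>z. \<phi> (p z)" by standard (rule inner2_coord[OF \<phi> p])
  interpret Q: inner_bidisk "\<lambda>z. \<psi> (q z)" by standard (rule inner2_coord[OF \<psi> q])
  let ?Q = "model_space (\<lambda>z. \<psi> (q z))" and ?T = "model_space \<theta>"
  have nzp: "1 - p z * cnj (p w) \<noteq> 0" and nzq: "1 - q z * cnj (q w) \<noteq> 0" if "z \<in> bidisk" "w \<in> bidisk" for z w
    using one_minus_neq_0 coords_less[OF pq] that by auto
  \<comment> \<open>The kernels come from \<open>1 - \<theta> cnj \<theta> = (1 - \<psi> cnj \<psi>)
    + \<psi> cnj \<psi> (1 - \<phi> cnj \<phi>)\<close>, each summand divided by the Szego factor of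
    its own variable.\<close>
  define Kp where "Kp z w = (1 - \<psi> (q z) * cnj (\<psi> (q w))) / (1 - q z * cnj (q w))" for z w
  define Kq where "Kq z w = \<psi> (q z) * cnj (\<psi> (q w)) * ((1 - \<phi> (p z) * cnj (\<phi> (p w))) / (1 - p z * cnj (p w)))" for z w
  have posp: "positive_kernel bidisk Kp"
  proof -
    \<comment> \<open>On the slice \<open>p = 0\<close> the Szego kernel loses its factor in
      \<open>p\<close>, so the model kernel restricted to it is \<open>Kp\<close>.\<close>
    have "positive_kernel bidisk (\<lambda>z w. 1 * cnj 1 * Q.model_kernel (coord_zero p z) (coord_zero p w))"
      by (rule rkhs.gram_positive[OF Q.rkhs_model_space coord_zero_bidisk])
    moreover have "1 * cnj 1 * Q.model_kernel (coord_zero p z) (coord_zero p w) = Kp z w" for z w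
      by (simp add: Q.model_kernel_def Kp_def coords_szego[OF pq] coords_zero_left[OF pq] coords_zero_left'[OF pq])
    ultimately show ?thesis by simp
  qed
  have posq: "positive_kernel bidisk Kq"
  proof -
    have "positive_kernel bidisk (\<lambda>z w. \<psi> (q z) * cnj (\<psi> (q w)) * P.model_kernel (coord_zero q z) (coord_zero q w))"
      by (rule rkhs.gram_positive[OF P.rkhs_model_space coord_zero_bidisk])
    moreover have "\<psi> (q z) * cnj (\<psi> (q w)) * P.model_kernel (coord_zero q z) (coord_zero q w) = Kq z w" for z w
      by (simp add: P.model_kernel_def Kq_def coords_szego[OF pq] coords_zero_right[OF pq] coords_zero_right'[OF pq])
    ultimately show ?thesis by simp
  qed
  have agler: "1 - \<theta> z * cnj (\<theta> w) = (1 - p z * cnj (p w)) * Kq z w + (1 - q z * cnj (q w)) * Kp z w"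
    if "z \<in> bidisk" "w \<in> bidisk" for z w
  proof -
    have "(1 - p z * cnj (p w)) * Kq z w = \<psi> (q z) * cnj (\<psi> (q w)) * (1 - \<phi> (p z) * cnj (\<phi> (p w)))"
      "(1 - q z * cnj (q w)) * Kp z w = 1 - \<psi> (q z) * cnj (\<psi> (q w))"
      using nzp[OF that] nzq[OF that] by (simp_all add: Kp_def Kq_def)
    then show ?thesis unfolding prod[OF that(1)] prod[OF that(2)] by (simp add: algebra_simps)
  qed
  have kp: "agler_space_kernel p Kp z w = Q.model_kernel z w" for z w
    unfolding agler_space_kernel_def Kp_def Q.model_kernel_def coords_szego[OF pq] by simp
  have kq: "on_bidisk (\<lambda>z. agler_space_kernel q Kq z w)
      = (\<lambda>z. on_bidisk (\<lambda>z. T.model_kernel z w) z - on_bidisk (\<lambda>z. Q.model_kernel z w) z)" if w: "w \<in> bidisk" for w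
  proof
    fix z
    show "on_bidisk (\<lambda>z. agler_space_kernel q Kq z w) z
      = on_bidisk (\<lambda>z. T.model_kernel z w) z - on_bidisk (\<lambda>z. Q.model_kernel z w) z"
    proof (cases "z \<in> bidisk")
      case True
      have "agler_space_kernel q Kq z w = T.model_kernel z w - Q.model_kernel z w"
        unfolding agler_space_kernel_def Kq_def T.model_kernel_def Q.model_kernel_def coords_szego[OF pq]
          prod[OF True] prod[OF w] left_diff_distrib[symmetric]
        by (simp add: algebra_simps)
      then show ?thesis unfolding on_bidisk_def by (simp only: True if_True)
    next
      case False
      then show ?thesis unfolding on_bidisk_def by (simp only: if_False diff_self)
    qed
  qed
  have QT: "f \<in> ?T" if f: "f \<in> ?Q" for f
    unfolding T.model_iff
  proof (intro conjI ballI)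
    show fH: "f \<in> H2" by (rule Q.model_H2[OF f])
    fix g assume g: "g \<in> H2"
    have "\<theta> z * g z = \<psi> (q z) * (\<phi> (p z) * g z)" for z
    proof (cases "z \<in> bidisk")
      case True
      then show ?thesis using prod[OF True] by simp
    next
      case False
      then show ?thesis using bidisk_not[OF False g] by simp
    qed
    then have "(\<lambda>z. \<theta> z * g z) = (\<lambda>z. \<psi> (q z) * (\<phi> (p z) * g z))" by (rule ext)
    then show "H2_inner f (\<lambda>z. \<theta> z * g z) = 0" using f P.mult_mem[OF g] unfolding Q.model_iff by simp
  qed
  have pQ: "(\<lambda>z. p z * f z) \<in> ?Q" if f: "f \<in> ?Q" for f
    unfolding Q.model_iff
  proof (intro conjI ballI)
    have fH: "f \<in> H2" by (rule Q.model_H2[OF f])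
    then show pf: "(\<lambda>z. p z * f z) \<in> H2" by (rule mult_coord_mem[OF p])
    fix g assume g: "g \<in> H2"
    \<comment> \<open>\<open>g\<close> splits into its slice at \<open>p = 0\<close> and
      \<open>p\<close> times a backward shift. The slice part stays independent of \<open>p\<close>
      after multiplication by \<open>\<psi>\<close> and is orthogonal to all multiples of
      \<open>p\<close>; the other part reduces to the hypothesis on \<open>f\<close> by the
      isometry.\<close>
    define g0 where "g0 = (\<lambda>z. if z \<in> bidisk then g (coord_zero p z) else 0)"
    have g0: "g0 \<in> H2" unfolding g0_def by (rule slice_mem[OF p g])
    note b = bshift_mem[OF g, of p]
    have m0: "(\<lambda>z. \<psi> (q z) * g0 z) \<in> H2" and m1: "(\<lambda>z. p z * (\<psi> (q z) * bshift p g z)) \<in> H2"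
      by (intro Q.mult_mem mult_coord_mem p g0 b)+
    have "\<psi> (q z) * g z = \<psi> (q z) * g0 z + p z * (\<psi> (q z) * bshift p g z)" for z
    proof (cases "z \<in> bidisk")
      case True
      then show ?thesis using bshift_decomp[OF p g True] unfolding g0_def by (simp add: algebra_simps del: mem_Times_iff)
    next
      case False
      then show ?thesis using bidisk_not[OF False g] bidisk_not[OF False g0] bidisk_not[OF False b] by simp
    qed
    then have e: "(\<lambda>z. \<psi> (q z) * g z) = (\<lambda>z. \<psi> (q z) * g0 z + p z * (\<psi> (q z) * bshift p g z))" by (rule ext)
    have "coord_indep p (\<lambda>z. \<psi> (q z) * g0 z)"
      unfolding coord_indep_def
    proof
      fix z :: "complex \<times> complex" assume z: "z \<in> bidisk"
      have "coord_zero p (coord_zero p z) = coord_zero p z"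
        by (rule coords_zero_eq[OF pq coords_zero_left'[OF pq]])
      then show "\<psi> (q z) * g0 z = \<psi> (q (coord_zero p z)) * g0 (coord_zero p z)"
        unfolding g0_def coords_zero_left'[OF pq] using z coord_zero_bidisk[OF z, of p] by (simp only: if_True)
    qed
    from coord_indep_orth[OF p m0 this fH]
    have 0: "H2_inner (\<lambda>z. p z * f z) (\<lambda>z. \<psi> (q z) * g0 z) = 0" .
    have 1: "H2_inner (\<lambda>z. p z * f z) (\<lambda>z. p z * (\<psi> (q z) * bshift p g z)) = 0"
      using mult_coord_isometry[OF p fH Q.mult_mem[OF b]] f b unfolding Q.model_iff by simp
    show "H2_inner (\<lambda>z. p z * f z) (\<lambda>z. \<psi> (q z) * g z) = 0"
      unfolding e using H2.ip_add_right[OF m0 m1 pf] 0 1 by simp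
  qed
  have redQ: "rkhs_reducing \<theta> p (agler_space_kernel p Kp)"
  proof (rule T.rkhs_reducingI[OF p Q.model_closed])
    show "?Q \<subseteq> ?T" using QT by blast
    show "on_bidisk (\<lambda>z. agler_space_kernel p Kp z w) \<in> ?Q" if "w \<in> bidisk" for w
      unfolding kp by (rule Q.model_kernel_mem[OF that])
    show "H2_inner f (on_bidisk (\<lambda>z. agler_space_kernel p Kp z w)) = f w" if "f \<in> ?Q" "w \<in> bidisk" for f w
      unfolding kp by (rule Q.model_kernel_ip[OF that(2,1)])
    show "bshift p f \<in> ?Q" if "f \<in> ?Q" for f by (rule Q.bshift_model[OF p that])
    show "comp_shift \<theta> p f \<in> ?Q" if f: "f \<in> ?Q" for f
    proof -
      have pf: "(\<lambda>z. p z * f z) \<in> ?Q" by (rule pQ[OF f])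
      \<comment> \<open>\<open>p f\<close> already lies in the model space of
        \<open>\<theta>\<close>, so projecting changes nothing.\<close>
      have "model_proj \<theta> (\<lambda>z. p z * f z) = (\<lambda>z. p z * f z)"
        by (rule T.model_proj_unique[OF Q.model_H2[OF pf] QT[OF pf]]) (simp add: H2.ip_zero T.model_H2)
      then show ?thesis using pf unfolding comp_shift_def mult_coord_def by simp
    qed
  qed
  \<comment> \<open>Taken as an orthogonal complement, \<open>S\<close> has the difference of two
    model kernels as its kernel, and its invariance under the compressed shift and its adjoint is
    dual to that of \<open>?Q\<close>.\<close>
  define S where "S = {g \<in> ?T. \<forall>f\<in>?Q. H2_inner g f = 0}"
  have QH: "?Q \<subseteq> H2" using Q.model_H2 by blast
  have S_eq: "S = ?T \<inter> H2.orth ?Q" unfolding S_def H2.orth_def using T.model_H2 by auto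
  have clS: "H2.closed_sub S"
  proof (rule H2.closed_subI)
    note o = H2.closed_sub_orth[OF QH]
    show "S \<subseteq> H2" unfolding S_def using T.model_H2 by blast
    show "fun_subspace S"
      using H2.closed_subD(2)[OF o] H2.closed_subD(2)[OF T.model_closed] unfolding S_eq fun_subspace_def by simp
    show "f \<in> S" if "f \<in> H2" "\<And>n. F n \<in> S" "(\<lambda>n. H2.nrm (\<lambda>x. F n x - f x)) \<longlonglongrightarrow> 0" for f F
    proof -
      have "F n \<in> ?T" "F n \<in> H2.orth ?Q" for n using that(2)[of n] unfolding S_eq by auto
      then show ?thesis
        unfolding S_eq using H2.closed_subD(3)[OF o that(1) _ that(3)] H2.closed_subD(3)[OF T.model_closed that(1) _ that(3)]
        by simp
    qed
  qed
  have redS: "rkhs_reducing \<theta> p (agler_space_kernel q Kq)"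
  proof (rule T.rkhs_reducingI[OF p clS])
    show "S \<subseteq> ?T" unfolding S_def by blast
    fix w :: "complex \<times> complex" assume w: "w \<in> bidisk"
    note tm = T.model_kernel_mem[OF w] and qm = Q.model_kernel_mem[OF w]
    show "on_bidisk (\<lambda>z. agler_space_kernel q Kq z w) \<in> S"
      unfolding kq[OF w] S_def mem_Collect_eq
    proof (intro conjI ballI)
      show "(\<lambda>z. on_bidisk (\<lambda>z. T.model_kernel z w) z - on_bidisk (\<lambda>z. Q.model_kernel z w) z) \<in> ?T"
        by (rule T.model_diff[OF tm QT[OF qm]])
      fix f assume f: "f \<in> ?Q"
      have fH: "f \<in> H2" by (rule Q.model_H2[OF f])
      have "H2_inner f (\<lambda>z. on_bidisk (\<lambda>z. T.model_kernel z w) z - on_bidisk (\<lambda>z. Q.model_kernel z w) z) = 0"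
        using H2.ip_diff_right[OF T.model_H2[OF tm] Q.model_H2[OF qm] fH]
          T.model_kernel_ip[OF w QT[OF f]] Q.model_kernel_ip[OF w f] by simp
      then show "H2_inner (\<lambda>z. on_bidisk (\<lambda>z. T.model_kernel z w) z - on_bidisk (\<lambda>z. Q.model_kernel z w) z) f = 0"
        using H2.ip_cnj[OF fH H2.diff_mem[OF T.model_H2[OF tm] Q.model_H2[OF qm]]] by simp
    qed
    fix f assume "f \<in> S"
    then have f: "f \<in> ?T" "H2_inner f (on_bidisk (\<lambda>z. Q.model_kernel z w)) = 0"
      unfolding S_def using qm by auto
    show "H2_inner f (on_bidisk (\<lambda>z. agler_space_kernel q Kq z w)) = f w"
      unfolding kq[OF w] using H2.ip_diff_right[OF T.model_H2[OF tm] Q.model_H2[OF qm] T.model_H2[OF f(1)]]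
        f(2) T.model_kernel_ip[OF w f(1)] by simp
  next
    fix f assume fS: "f \<in> S"
    then have f: "f \<in> ?T" "\<And>g. g \<in> ?Q \<Longrightarrow> H2_inner f g = 0" unfolding S_def by auto
    have fH: "f \<in> H2" by (rule T.model_H2[OF f(1)])
    show "comp_shift \<theta> p f \<in> S"
      unfolding S_def mem_Collect_eq
    proof (intro conjI ballI T.comp_shift_mem[OF p f(1)])
      fix g assume g: "g \<in> ?Q"
      have "H2_inner (comp_shift \<theta> p f) g = H2_inner f (bshift p g)"
        using T.comp_shift_ip[OF p f(1) QT[OF g]] bshift_adjoint[OF p Q.model_H2[OF g] fH] by simp
      then show "H2_inner (comp_shift \<theta> p f) g = 0" using f(2)[OF Q.bshift_model[OF p g]] by simp
    qed
    show "bshift p f \<in> S"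
      unfolding S_def mem_Collect_eq
    proof (intro conjI ballI T.bshift_model[OF p f(1)])
      fix g assume g: "g \<in> ?Q"
      have "H2_inner g (bshift p f) = cnj (H2_inner f (\<lambda>z. p z * g z))"
        using bshift_adjoint[OF p fH Q.model_H2[OF g]] H2.ip_cnj[OF fH Q.model_H2[OF pQ[OF g]]] by simp
      then show "H2_inner (bshift p f) g = 0"
        using f(2)[OF pQ[OF g]] H2.ip_cnj[OF Q.model_H2[OF g] bshift_mem[OF fH, of p]] by simp
    qed
  qed
  show ?thesis using posp posq agler redQ redS by blast
qed

section \<open>The two equivalences, one for each order of the coordinates\<close>

theorem theorem1p2:
  fixes \<theta> :: "complex \<times> complex \<Rightarrow> complex"
  assumes "rational_inner2 \<theta>"
  shows "((\<exists>K1 K2. agler_kernels \<theta> K1 K2 \<and>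
            rkhs_reducing \<theta> fst (agler_space_kernel fst K1) \<and>
            rkhs_reducing \<theta> fst (agler_space_kernel snd K2))
          \<longleftrightarrow> (\<exists>\<phi> \<psi>. inner1 \<phi> \<and> inner1 \<psi> \<and> (\<forall>z\<in>bidisk. \<theta> z = \<phi> (fst z) * \<psi> (snd z))))
       \<and> ((\<exists>\<phi> \<psi>. inner1 \<phi> \<and> inner1 \<psi> \<and> (\<forall>z\<in>bidisk. \<theta> z = \<phi> (fst z) * \<psi> (snd z)))
          \<longleftrightarrow> (\<exists>K1 K2. agler_kernels \<theta> K1 K2 \<and>
            rkhs_reducing \<theta> snd (agler_space_kernel fst K1) \<and>
            rkhs_reducing \<theta> snd (agler_space_kernel snd K2)))"
    (is "(?red1 \<longleftrightarrow> ?prod) \<and> (?prod \<longleftrightarrow> ?red2)")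
proof -
  have \<theta>: "inner2 \<theta>" using assms unfolding rational_inner2_def by blast
  interpret inner_bidisk \<theta> by standard (rule \<theta>)
  have c1: "coords fst snd" and c2: "coords snd fst" unfolding coords_def by auto
  have 1: ?prod if ?red1
  proof -
    obtain K1 K2 where K: "agler_kernels \<theta> K1 K2" "rkhs_reducing \<theta> fst (agler_space_kernel fst K1)"
      "rkhs_reducing \<theta> fst (agler_space_kernel snd K2)" using \<open>?red1\<close> by (elim exE conjE)
    note A = K(1)[unfolded agler_kernels_def]
    show ?prod
    proof (rule inner1_factors[OF \<theta>])
      fix a b c d :: complex
      assume "a \<in> ball 0 1" "b \<in> ball 0 1" "c \<in> ball 0 1" "d \<in> ball 0 1"
      then have m: "(a, b) \<in> bidisk" "(c, d) \<in> bidisk" "(a, d) \<in> bidisk" "(c, b) \<in> bidisk" by auto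
      show "\<theta> (a, b) * \<theta> (c, d) = \<theta> (a, d) * \<theta> (c, b)"
      proof (rule mixed_product[OF c1 A[THEN conjunct1] A[THEN conjunct2, THEN conjunct1] _ K(2,3) m])
        fix z w :: "complex \<times> complex" assume "z \<in> bidisk" "w \<in> bidisk"
        then show "1 - \<theta> z * cnj (\<theta> w) = (1 - fst z * cnj (fst w)) * K2 z w + (1 - snd z * cnj (snd w)) * K1 z w"
          by (rule A[THEN conjunct2, THEN conjunct2, THEN bspec, THEN bspec])
      qed simp_all
    qed
  qed
  have 2: ?prod if ?red2
  proof -
    obtain K1 K2 where K: "agler_kernels \<theta> K1 K2" "rkhs_reducing \<theta> snd (agler_space_kernel fst K1)"
      "rkhs_reducing \<theta> snd (agler_space_kernel snd K2)" using \<open>?red2\<close> by (elim exE conjE)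
    note A = K(1)[unfolded agler_kernels_def]
    show ?prod
    proof (rule inner1_factors[OF \<theta>])
      fix a b c d :: complex
      assume "a \<in> ball 0 1" "b \<in> ball 0 1" "c \<in> ball 0 1" "d \<in> ball 0 1"
      then have m: "(a, b) \<in> bidisk" "(c, d) \<in> bidisk" "(c, b) \<in> bidisk" "(a, d) \<in> bidisk" by auto
      have "\<theta> (a, b) * \<theta> (c, d) = \<theta> (c, b) * \<theta> (a, d)"
      \<comment> \<open>With \<open>p = snd\<close> the kernels exchange roles: \<open>K2\<close>
        takes the place of \<open>Kp\<close> and \<open>K1\<close> that of
        \<open>Kq\<close>.\<close>
      proof (rule mixed_product[OF c2 A[THEN conjunct2, THEN conjunct1] A[THEN conjunct1] _ K(3,2) m])
        fix z w :: "complex \<times> complex" assume "z \<in> bidisk" "w \<in> bidisk"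
        then have "1 - \<theta> z * cnj (\<theta> w) = (1 - fst z * cnj (fst w)) * K2 z w + (1 - snd z * cnj (snd w)) * K1 z w"
          by (rule A[THEN conjunct2, THEN conjunct2, THEN bspec, THEN bspec])
        then show "1 - \<theta> z * cnj (\<theta> w) = (1 - snd z * cnj (snd w)) * K1 z w + (1 - fst z * cnj (fst w)) * K2 z w"
          by simp
      qed simp_all
      then show "\<theta> (a, b) * \<theta> (c, d) = \<theta> (a, d) * \<theta> (c, b)" by (simp add: mult.commute)
    qed
  qed
  have 3: "?red1 \<and> ?red2" if ?prod
  proof -
    obtain \<phi> \<psi> where f: "inner1 \<phi>" "inner1 \<psi>" "\<forall>z\<in>bidisk. \<theta> z = \<phi> (fst z) * \<psi> (snd z)"
      using \<open>?prod\<close> by (elim exE conjE)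
    have f': "\<forall>z\<in>bidisk. \<theta> z = \<psi> (snd z) * \<phi> (fst z)"
      using f(3) by (simp add: mult.commute del: split_paired_Ball_Sigma)
    obtain Kp Kq where K: "positive_kernel bidisk Kp" "positive_kernel bidisk Kq"
      "\<forall>z\<in>bidisk. \<forall>w\<in>bidisk. 1 - \<theta> z * cnj (\<theta> w) = (1 - fst z * cnj (fst w)) * Kq z w + (1 - snd z * cnj (snd w)) * Kp z w"
      "rkhs_reducing \<theta> fst (agler_space_kernel fst Kp)" "rkhs_reducing \<theta> fst (agler_space_kernel snd Kq)"
      using product_reducing[OF \<theta> c1 f] by (elim exE conjE)
    obtain Lp Lq where L: "positive_kernel bidisk Lp" "positive_kernel bidisk Lq"
      "\<forall>z\<in>bidisk. \<forall>w\<in>bidisk. 1 - \<theta> z * cnj (\<theta> w) = (1 - snd z * cnj (snd w)) * Lq z w + (1 - fst z * cnj (fst w)) * Lp z w"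
      "rkhs_reducing \<theta> snd (agler_space_kernel snd Lp)" "rkhs_reducing \<theta> snd (agler_space_kernel fst Lq)"
      using product_reducing[OF \<theta> c2 f(2,1) f'] by (elim exE conjE)
    have "agler_kernels \<theta> Kp Kq" unfolding agler_kernels_def by (intro conjI K)
    moreover have "agler_kernels \<theta> Lq Lp"
      unfolding agler_kernels_def
    proof (intro conjI L ballI)
      fix z w :: "complex \<times> complex" assume "z \<in> bidisk" "w \<in> bidisk"
      from bspec[OF bspec[OF L(3) this(1)] this(2)]
      show "1 - \<theta> z * cnj (\<theta> w) = (1 - fst z * cnj (fst w)) * Lp z w + (1 - snd z * cnj (snd w)) * Lq z w"
        by simp
    qed
    ultimately show ?thesis using K(4,5) L(4,5) by blast
  qed
  show ?thesis using 1 2 3 by blast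
qed

end
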